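(* Let $q\ge1$ be an integer, $n>0$ real, $S$ a symmetric positive definite $q\times q$ matrix and $F$ a real $q\times q$ matrix such that $V=S-FSF'$ is positive definite. Let $\{\Sigma_t\}_{t\ge0}$ be the first-order inverse Wishart autoregressive process with parameters $(n,F,S)$. Then for every $t\ge1$, $$\mathbb{E}[\Sigma_t\mid\Sigma_{t-1}]=F\Sigma_{t-1}F'+c_{n,q}\left[1+\mathrm{tr}\{\Sigma_{t-1}(nS)^{-1}\}\right]V,\qquad c_{n,q}=\frac{n}{n+q}.$$
   Context: A prime denotes transpose. For an integer $m\ge1$, a real $d>0$ and a symmetric positive definite $m\times m$ matrix $D$, $\mathrm{IW}_m(d,D)$ denotes the distribution on symmetric positive definite $m\times m$ matrices $X$ with density proportional to $|X|^{-(d+2m)/2}\exp\{-\tfrac12\mathrm{tr}(X^{-1}D)\}$; for $d>2$ its mean is $D/(d-2)$. $N(M,A,B)$ denotes the matrix normal law of a random $q\times q$ matrix $Y$ with mean $M$ and $\mathrm{Cov}(Y_{ik},Y_{jl})=A_{ij}B_{kl}$. Definition of the process. The first-order inverse Wishart autoregressive process with parameters $(n,F,S)$ is the stationary first-order Markov process $\{\Sigma_t\}_{t\ge0}$ on positive definite $q\times q$ matrices whose consecutive pairs $(\Sigma_{t-1},\Sigma_t)$ are distributed as the diagonal blocks in $$\begin{pmatrix}\Sigma_{t-1}&\phi_t'\\ \phi_t&\Sigma_t\end{pmatrix}\sim \mathrm{IW}_{2q}\left(n+2,\;n\begin{pmatrix}S & SF' \\ F S & S\end{pmatrix}\right).$$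 Equivalently, $\Sigma_0\sim\mathrm{IW}_q(n+2,nS)$ and $\Sigma_t=\Psi_t+\Upsilon_t\Sigma_{t-1}\Upsilon_t'$ for $t\ge1$, where the pairs $(\Upsilon_t,\Psi_t)$, $t\ge1$, are i.i.d., independent of $\Sigma_0$, with $\Psi_t\sim\mathrm{IW}_q(n+q+2,nV)$ and $\Upsilon_t\mid\Psi_t\sim N(F,\Psi_t,(nS)^{-1})$. *)

theory Defs
  imports "HOL-Probability.Probability"
begin

definition pos_def :: "real^'m^'m \<Rightarrow> bool" where
  "pos_def A \<longleftrightarrow> transpose A = A \<and> (\<forall>x. x \<noteq> 0 \<longrightarrow> 0 < x \<bullet> (A *v x))"

(* Lebesgue measure on the space of symmetric matrices: one real coordinate for each unordered
   pair {i, j} of indices (possibly i = j), i.e. m(m+1)/2 coordinates.  It is a measure on the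
   space of all matrices that is concentrated on the symmetric ones. *)
definition sym_lborel :: "(real^'m^'m) measure" where
  "sym_lborel = distr (\<Pi>\<^sub>M e\<in>range (\<lambda>(i::'m, j::'m). {i, j}). lborel) borel
     (\<lambda>x. \<chi> i j. x {i, j})"

definition iw_kernel :: "real \<Rightarrow> real^'m^'m \<Rightarrow> real^'m^'m \<Rightarrow> real" where
  "iw_kernel d D X =
     (if pos_def X
      then det X powr (- (d + 2 * real CARD('m)) / 2) * exp (- trace (matrix_inv X ** D) / 2)
      else 0)"

definition inverse_wishart :: "real \<Rightarrow> real^'m^'m \<Rightarrow> (real^'m^'m) measure" where
  "inverse_wishart d D = density sym_lborel
     (\<lambda>X. ennreal (iw_kernel d D X) / (\<integral>\<^sup>+ Y. ennreal (iw_kernel d D Y) \<partial>sym_lborel))"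

(* Block matrices are indexed by the sum type, so a 2q x 2q matrix is indexed by 'q + 'q. *)
definition block_matrix ::
    "real^'q^'q \<Rightarrow> real^'q^'q \<Rightarrow> real^'q^'q \<Rightarrow> real^'q^'q \<Rightarrow> real^('q + 'q)^('q + 'q)" where
  "block_matrix A B C D = (\<chi> i j.
     case i of
       Inl k \<Rightarrow> (case j of Inl l \<Rightarrow> A $ k $ l | Inr l \<Rightarrow> B $ k $ l)
     | Inr k \<Rightarrow> (case j of Inl l \<Rightarrow> C $ k $ l | Inr l \<Rightarrow> D $ k $ l))"

definition diag_blocks :: "real^('q + 'q)^('q + 'q) \<Rightarrow> (real^'q^'q) \<times> (real^'q^'q)" where
  "diag_blocks X = ((\<chi> i j. X $ Inl i $ Inl j), (\<chi> i j. X $ Inr i $ Inr j))"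

definition stationary_process :: "'w measure \<Rightarrow> (nat \<Rightarrow> 'w \<Rightarrow> 'a::topological_space) \<Rightarrow> bool" where
  "stationary_process M X \<longleftrightarrow>
     (\<forall>h. distr M (\<Pi>\<^sub>M t\<in>UNIV. borel) (\<lambda>\<omega> t. X (t + h) \<omega>) =
          distr M (\<Pi>\<^sub>M t\<in>UNIV. borel) (\<lambda>\<omega> t. X t \<omega>))"

definition gen_algebra :: "'w measure \<Rightarrow> ('w \<Rightarrow> 'a::topological_space) \<Rightarrow> 'w measure" where
  "gen_algebra M Y = vimage_algebra (space M) Y borel"

definition past_algebra ::
    "'w measure \<Rightarrow> (nat \<Rightarrow> 'w \<Rightarrow> 'a::topological_space) \<Rightarrow> nat \<Rightarrow> 'w measure" where
  "past_algebra M X t = sigma (space M) (\<Union>s\<in>{..t}. sets (gen_algebra M (X s)))"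

definition markov_process :: "'w measure \<Rightarrow> (nat \<Rightarrow> 'w \<Rightarrow> 'a::topological_space) \<Rightarrow> bool" where
  "markov_process M X \<longleftrightarrow>
     (\<forall>t. \<forall>A\<in>sets borel. AE \<omega> in M.
        real_cond_exp M (past_algebra M X t) (indicator (X (Suc t) -` A \<inter> space M)) \<omega> =
        real_cond_exp M (gen_algebra M (X t)) (indicator (X (Suc t) -` A \<inter> space M)) \<omega>)"

definition iwar_process ::
    "'w measure \<Rightarrow> real \<Rightarrow> real^'q^'q \<Rightarrow> real^'q^'q \<Rightarrow> (nat \<Rightarrow> 'w \<Rightarrow> real^'q^'q) \<Rightarrow> bool" where
  "iwar_process M n F S X \<longleftrightarrow>
     prob_space M \<and>
     (\<forall>t. X t \<in> borel_measurable M) \<and>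
     (\<forall>t. \<forall>\<omega>\<in>space M. pos_def (X t \<omega>)) \<and>
     stationary_process M X \<and>
     markov_process M X \<and>
     (\<forall>t\<ge>1. distr M (borel \<Otimes>\<^sub>M borel) (\<lambda>\<omega>. (X (t - 1) \<omega>, X t \<omega>)) =
        distr (inverse_wishart (n + 2)
                 (n *\<^sub>R block_matrix S (S ** transpose F) (F ** S) S))
          (borel \<Otimes>\<^sub>M borel) diag_blocks)"

(* Conditional expectation of a random matrix, entry by entry; meaningful for integrable Y. *)
definition matrix_cond_exp ::
    "'w measure \<Rightarrow> 'w measure \<Rightarrow> ('w \<Rightarrow> real^'q^'q) \<Rightarrow> 'w \<Rightarrow> real^'q^'q" where
  "matrix_cond_exp M G Y \<omega> = (\<chi> i j. real_cond_exp M G (\<lambda>\<omega>. Y \<omega> $ i $ j) \<omega>)"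

end

theory Submission
  imports Defs
begin

text \<open>
  All steps are identities between nonnegative integrals. The pair of consecutive states has a
  probability law, so the normalising constant of the inverse Wishart kernel is never computed.

  Write a positive definite matrix bordering \<open>C\<close> with a row \<open>u = C \<gamma>\<close> and a diagonal entry
  \<open>b = \<theta> + \<gamma> \<bullet> C \<gamma>\<close>. In the coordinates \<open>(C, \<gamma>, \<theta>)\<close> the kernel splits into the kernel of \<open>C\<close> (with
  the exponent shifted by one, the Jacobian being \<open>det C\<close>) and a factor in \<open>(\<gamma>, \<theta>)\<close> that does not
  involve \<open>C\<close>. Hence rows can be integrated out one at a time, and conditionally on \<open>C\<close> the entry
  \<open>b\<close> has a mean that is read off from an inverse gamma \<open>\<theta>\<close> and a vector \<open>\<gamma>\<close> that is Gaussian
  given \<open>\<theta>\<close>. With \<open>C\<close> the first diagonal block this is the claim for the diagonal entries of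
  \<open>\<Sigma>\<^sub>t\<close>, and with \<open>C\<close> empty it gives their integrability. Off-diagonal entries follow by
  polarisation, because adding one row and column of the second block to another one preserves
  Lebesgue measure on symmetric matrices.
\<close>

section \<open>Lebesgue measure in linear coordinates\<close>

text \<open>Identities are therefore stated in \<open>ennreal\<close> with a common unknown factor
  on both sides, and odd terms are cancelled by averaging over a reflection before integrating. The
  induction over rows changes the size of the matrix while its type stays fixed; hence blocks are
  full-size matrices, and Lebesgue measure on a coordinate subspace is an image of a product
  measure. Origin of the constants: with \<open>d = n + 2\<close> and a conditioning block of size
  \<open>q\<close>, the variable \<open>\<theta>\<close> is inverse gamma with shape
  \<open>(n + q) / 2 + 1\<close> and scale \<open>n (w' V w) / 2\<close>, so its mean is
  \<open>n (w' V w) / (n + q)\<close>. Given \<open>\<theta>\<close>, the vector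
  \<open>\<gamma>\<close> has mean \<open>F' w\<close> and covariance \<open>\<theta>\<close> times
  the inverse of \<open>n S\<close>. In the bracket of the claim the summand 1 stems from
  \<open>\<theta>\<close> itself and the trace from the fluctuation of \<open>\<gamma>\<close>.
  Polarisation needs only shears, whose Jacobian is 1; the Jacobian of a general congruence of
  symmetric matrices never enters.\<close>

definition coord_lborel :: "'i set \<Rightarrow> ('i \<Rightarrow> 'v) \<Rightarrow> 'v::euclidean_space measure" where
  "coord_lborel I b = distr (\<Pi>\<^sub>M i\<in>I. lborel) borel (\<lambda>x. \<Sum>i\<in>I. x i *\<^sub>R b i)"

lemma sets_coord_lborel [measurable_cong, simp]: "sets (coord_lborel I b) = sets borel"
  by (simp add: coord_lborel_def)

lemma space_coord_lborel [simp]: "space (coord_lborel I b) = UNIV"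
  by (simp add: coord_lborel_def)

lemma nn_integral_coord_lborel:
  assumes "h \<in> borel_measurable borel"
  shows "(\<integral>\<^sup>+ v. h v \<partial>coord_lborel I b) =
         (\<integral>\<^sup>+ x. h (\<Sum>i\<in>I. x i *\<^sub>R b i) \<partial>(\<Pi>\<^sub>M i\<in>I. lborel))"
  unfolding coord_lborel_def
  by (subst nn_integral_distr) (use assms in measurable)

lemma nn_integral_coord_cong:
  assumes "f \<in> borel_measurable borel" "g \<in> borel_measurable borel"
    and "\<And>v. v \<in> span (b ` I) \<Longrightarrow> f v = g v"
  shows "(\<integral>\<^sup>+ v. f v \<partial>coord_lborel I b) = (\<integral>\<^sup>+ v. g v \<partial>coord_lborel I b)"
proof -
  have "(\<Sum>i\<in>I. x i *\<^sub>R b i) \<in> span (b ` I)" for x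
    by (intro span_sum span_scale span_base) auto
  then show ?thesis
    using assms by (simp add: nn_integral_coord_lborel)
qed

text \<open>If the \<open>b i\<close> are linearly dependent, the image measure need not be
  sigma-finite. Measurability of the inner integral is therefore obtained on the coordinate side,
  where the product measure is sigma-finite.\<close>

lemma measurable_nn_integral_coord [measurable (raw)]:
  assumes "case_prod f \<in> borel_measurable (N \<Otimes>\<^sub>M borel)" and "finite I"
  shows "(\<lambda>x. \<integral>\<^sup>+ v. f x v \<partial>coord_lborel I b) \<in> borel_measurable N"
proof -
  interpret finite_product_sigma_finite "\<lambda>_. lborel" I
    by standard fact
  have [measurable]: "case_prod f \<in> borel_measurable (N \<Otimes>\<^sub>M borel)"
    by fact
  have "(\<lambda>x. \<integral>\<^sup>+ y. f x (\<Sum>i\<in>I. y i *\<^sub>R b i) \<partial>(\<Pi>\<^sub>M i\<in>I. lborel)) \<in> borel_measurable N"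
    by measurable
  moreover have "(\<integral>\<^sup>+ v. f x v \<partial>coord_lborel I b) =
      (\<integral>\<^sup>+ y. f x (\<Sum>i\<in>I. y i *\<^sub>R b i) \<partial>(\<Pi>\<^sub>M i\<in>I. lborel))" if "x \<in> space N" for x
    by (rule nn_integral_coord_lborel) (use that in measurable)
  ultimately show ?thesis
    by (simp cong: measurable_cong)
qed

lemma nn_integral_coord_empty [simp]:
  "h \<in> borel_measurable borel \<Longrightarrow> (\<integral>\<^sup>+ v. h v \<partial>coord_lborel {} b) = h 0"
  by (simp add: nn_integral_coord_lborel PiM_empty nn_integral_count_space_finite)

lemma nn_integral_coord_insert:
  assumes [simp]: "finite I" "k \<notin> I" and [measurable]: "h \<in> borel_measurable borel"
  shows "(\<integral>\<^sup>+ v. h v \<partial>coord_lborel (insert k I) b) =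
         (\<integral>\<^sup>+ v. \<integral>\<^sup>+ t. h (v + t *\<^sub>R b k) \<partial>lborel \<partial>coord_lborel I b)"
proof -
  interpret product_sigma_finite "\<lambda>_. lborel :: real measure"
    by standard
  have "(\<integral>\<^sup>+ v. h v \<partial>coord_lborel (insert k I) b) =
        (\<integral>\<^sup>+ x. h (\<Sum>i\<in>insert k I. x i *\<^sub>R b i) \<partial>(\<Pi>\<^sub>M i\<in>insert k I. lborel))"
    by (rule nn_integral_coord_lborel) measurable
  also have "\<dots> = (\<integral>\<^sup>+ x. \<integral>\<^sup>+ t. h (\<Sum>i\<in>insert k I. (x(k := t)) i *\<^sub>R b i) \<partial>lborel \<partial>(\<Pi>\<^sub>M i\<in>I. lborel))"
    by (rule product_nn_integral_insert) auto
  also have "\<dots> = (\<integral>\<^sup>+ x. \<integral>\<^sup>+ t. h ((\<Sum>i\<in>I. x i *\<^sub>R b i) + t *\<^sub>R b k) \<partial>lborel \<partial>(\<Pi>\<^sub>M i\<in>I. lborel))"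
  proof -
    have "(\<Sum>i\<in>I. (x(k := t)) i *\<^sub>R b i) = (\<Sum>i\<in>I. x i *\<^sub>R b i)" for x t
      by (rule sum.cong) auto
    then show ?thesis
      by (simp add: add.commute)
  qed
  also have "\<dots> = (\<integral>\<^sup>+ v. \<integral>\<^sup>+ t. h (v + t *\<^sub>R b k) \<partial>lborel \<partial>coord_lborel I b)"
    by (rule nn_integral_coord_lborel[symmetric]) measurable
  finally show ?thesis .
qed

lemma nn_integral_coord_swap:
  assumes [simp]: "finite I" and [measurable]: "case_prod f \<in> borel_measurable (borel \<Otimes>\<^sub>M borel)"
  shows "(\<integral>\<^sup>+ v. \<integral>\<^sup>+ t. f v t \<partial>lborel \<partial>coord_lborel I b) =
         (\<integral>\<^sup>+ t. \<integral>\<^sup>+ v. f v t \<partial>coord_lborel I b \<partial>(lborel :: real measure))"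
proof -
  interpret finite_product_sigma_finite "\<lambda>_. lborel :: real measure" I
    by standard simp
  interpret pair_sigma_finite "\<Pi>\<^sub>M i\<in>I. (lborel :: real measure)" "lborel :: real measure"
    ..
  have "(\<integral>\<^sup>+ v. \<integral>\<^sup>+ t. f v t \<partial>lborel \<partial>coord_lborel I b) =
        (\<integral>\<^sup>+ x. \<integral>\<^sup>+ t. f (\<Sum>i\<in>I. x i *\<^sub>R b i) t \<partial>lborel \<partial>(\<Pi>\<^sub>M i\<in>I. lborel))"
    by (rule nn_integral_coord_lborel) measurable
  also have "\<dots> = (\<integral>\<^sup>+ t. \<integral>\<^sup>+ x. f (\<Sum>i\<in>I. x i *\<^sub>R b i) t \<partial>(\<Pi>\<^sub>M i\<in>I. lborel) \<partial>lborel)"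
    by (rule Fubini'[symmetric]) measurable
  also have "\<dots> = (\<integral>\<^sup>+ t. \<integral>\<^sup>+ v. f v t \<partial>coord_lborel I b \<partial>lborel)"
    by (intro nn_integral_cong nn_integral_coord_lborel[symmetric]) measurable
  finally show ?thesis .
qed

lemma nn_integral_coord_union:
  assumes "finite I" "finite K" "I \<inter> K = {}" and [measurable]: "h \<in> borel_measurable borel"
  shows "(\<integral>\<^sup>+ v. h v \<partial>coord_lborel (I \<union> K) b) =
         (\<integral>\<^sup>+ v. \<integral>\<^sup>+ w. h (v + w) \<partial>coord_lborel K b \<partial>coord_lborel I b)"
  using assms(2,3,4)
proof (induction K arbitrary: h rule: finite_induct)
  case empty
  then show ?case by simp
next
  case (insert k K)
  have [simp]: "finite I" "finite K" "k \<notin> K" "k \<notin> I" "I \<inter> K = {}" and [measurable]: "h \<in> borel_measurable borel"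
    using insert assms(1) by auto
  have "(\<integral>\<^sup>+ v. h v \<partial>coord_lborel (I \<union> insert k K) b) =
      (\<integral>\<^sup>+ v. \<integral>\<^sup>+ t. h (v + t *\<^sub>R b k) \<partial>lborel \<partial>coord_lborel (I \<union> K) b)"
    by (simp add: nn_integral_coord_insert)
  also have "\<dots> = (\<integral>\<^sup>+ v. \<integral>\<^sup>+ w. \<integral>\<^sup>+ t. h (v + w + t *\<^sub>R b k) \<partial>lborel \<partial>coord_lborel K b \<partial>coord_lborel I b)"
    by (rule insert.IH) auto
  also have "\<dots> = (\<integral>\<^sup>+ v. \<integral>\<^sup>+ w. h (v + w) \<partial>coord_lborel (insert k K) b \<partial>coord_lborel I b)"
    by (intro nn_integral_cong, subst nn_integral_coord_insert) (auto simp: add.assoc)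
  finally show ?case .
qed

lemma nn_integral_coord_linear:
  fixes L :: "'v::euclidean_space \<Rightarrow> 'u::euclidean_space"
  assumes "finite I" "linear L" and [measurable]: "h \<in> borel_measurable borel"
  shows "(\<integral>\<^sup>+ v. h (L v) \<partial>coord_lborel I b) = (\<integral>\<^sup>+ v. h v \<partial>coord_lborel I (L \<circ> b))"
proof -
  have [measurable]: "L \<in> borel_measurable borel"
    using linear_continuous_on[OF linear_conv_bounded_linear[THEN iffD1, OF assms(2)]]
    by (intro borel_measurable_continuous_onI)
  show ?thesis
    by (simp add: nn_integral_coord_lborel linear_sum[OF assms(2)] linear_scale[OF assms(2)])
qed

lemma nn_integral_coord_reindex:
  assumes "finite I" "inj_on g I" and [measurable]: "h \<in> borel_measurable borel"
  shows "(\<integral>\<^sup>+ v. h v \<partial>coord_lborel (g ` I) b) = (\<integral>\<^sup>+ v. h v \<partial>coord_lborel I (b \<circ> g))"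
  using assms(1,2,3)
proof (induction I arbitrary: h rule: finite_induct)
  case empty
  then show ?case by simp
next
  case (insert k I)
  then have [simp]: "finite I" "k \<notin> I" "g k \<notin> g ` I" and [measurable]: "h \<in> borel_measurable borel"
    by auto
  show ?case
    using insert by (simp add: nn_integral_coord_insert)
qed

lemma nn_integral_lborel_translate:
  fixes h :: "real \<Rightarrow> ennreal"
  assumes [measurable]: "h \<in> borel_measurable borel"
  shows "(\<integral>\<^sup>+ t. h (t + c) \<partial>lborel) = (\<integral>\<^sup>+ t. h t \<partial>lborel)"
  using nn_integral_real_affine[of h 1 c] by (simp add: add.commute)

text \<open>A vector of the span is a sum of multiples of single \<open>b k\<close>, and such a
  multiple merely shifts the \<open>k\<close>-th real coordinate.\<close>

lemma nn_integral_coord_translate: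
  assumes "finite I" "c \<in> span (b ` I)" and [measurable]: "h \<in> borel_measurable borel"
  shows "(\<integral>\<^sup>+ v. h (v + c) \<partial>coord_lborel I b) = (\<integral>\<^sup>+ v. h v \<partial>coord_lborel I b)"
proof -
  have *: "(\<integral>\<^sup>+ v. h (v + c) \<partial>coord_lborel I b) = (\<integral>\<^sup>+ v. h v \<partial>coord_lborel I b)"
    if "finite I" "c = s *\<^sub>R b k" "k \<in> I" "h \<in> borel_measurable borel" for c s k h
  proof -
    define J where "J = I - {k}"
    have J: "I = insert k J" "finite J" "k \<notin> J"
      using that by (auto simp: J_def)
    note [measurable] = that(4)
    have "(\<integral>\<^sup>+ t. h (v + t *\<^sub>R b k + c) \<partial>lborel) = (\<integral>\<^sup>+ t. h (v + t *\<^sub>R b k) \<partial>lborel)" for v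
      using nn_integral_lborel_translate[of "\<lambda>t. h (v + t *\<^sub>R b k)" s] that
      by (simp add: algebra_simps)
    with J show ?thesis
      by (simp add: nn_integral_coord_insert)
  qed
  from assms(2,3) show ?thesis
  proof (induction arbitrary: h rule: span_induct_alt)
    case base
    then show ?case by simp
  next
    case (step s x y)
    then obtain k where k: "k \<in> I" "x = b k" by auto
    note [measurable] = \<open>h \<in> borel_measurable borel\<close>
    have "(\<integral>\<^sup>+ v. h (v + (s *\<^sub>R x + y)) \<partial>coord_lborel I b) = (\<integral>\<^sup>+ v. h (v + s *\<^sub>R x) \<partial>coord_lborel I b)"
      using step.IH[of "\<lambda>v. h (v + s *\<^sub>R x)"] by (simp add: algebra_simps)
    also have "\<dots> = (\<integral>\<^sup>+ v. h v \<partial>coord_lborel I b)"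
      by (rule *[OF assms(1)]) (use k in auto)
    finally show ?case .
  qed
qed

text \<open>The exponent counts coordinates, not the dimension of the span, because the scaling acts
  on each factor of the product measure.\<close>

lemma nn_integral_coord_scale:
  assumes "finite I" "c \<noteq> 0" and [measurable]: "h \<in> borel_measurable borel"
  shows "(\<integral>\<^sup>+ v. h v \<partial>coord_lborel I b) = ennreal (\<bar>c\<bar> ^ card I) * (\<integral>\<^sup>+ v. h (c *\<^sub>R v) \<partial>coord_lborel I b)"
  using assms(1,3)
proof (induction I arbitrary: h rule: finite_induct)
  case empty
  then show ?case by simp
next
  case (insert k I)
  note [measurable] = insert.prems
  note [simp] = insert.hyps
  have "(\<integral>\<^sup>+ v. h v \<partial>coord_lborel (insert k I) b) =
        (\<integral>\<^sup>+ v. \<integral>\<^sup>+ t. h (v + t *\<^sub>R b k) \<partial>lborel \<partial>coord_lborel I b)"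
    by (simp add: nn_integral_coord_insert)
  also have "\<dots> = ennreal (\<bar>c\<bar> ^ card I) * (\<integral>\<^sup>+ v. \<integral>\<^sup>+ t. h (c *\<^sub>R v + t *\<^sub>R b k) \<partial>lborel \<partial>coord_lborel I b)"
    by (rule insert.IH) measurable
  also have "\<dots> = ennreal (\<bar>c\<bar> ^ card I) * (\<integral>\<^sup>+ v. ennreal \<bar>c\<bar> * \<integral>\<^sup>+ t. h (c *\<^sub>R (v + t *\<^sub>R b k)) \<partial>lborel \<partial>coord_lborel I b)"
  proof -
    have "(\<integral>\<^sup>+ t. h (c *\<^sub>R v + t *\<^sub>R b k) \<partial>lborel) = ennreal \<bar>c\<bar> * \<integral>\<^sup>+ t. h (c *\<^sub>R (v + t *\<^sub>R b k)) \<partial>lborel" for v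
      using nn_integral_real_affine[of "\<lambda>t. h (c *\<^sub>R v + t *\<^sub>R b k)" c 0] assms(2)
      by (simp add: algebra_simps)
    then show ?thesis by simp
  qed
  also have "\<dots> = ennreal (\<bar>c\<bar> ^ card (insert k I)) * (\<integral>\<^sup>+ v. h (c *\<^sub>R v) \<partial>coord_lborel (insert k I) b)"
    by (simp add: nn_integral_coord_insert nn_integral_cmult ennreal_mult mult.assoc mult.left_commute)
  finally show ?case .
qed

section \<open>Bordered positive definite matrices\<close>

declare transpose_matrix_vector [simp del] vector_transpose_matrix [simp del]

section \<open>Dyads, inverses and positive definiteness\<close>

lemma axis_one_nth: "axis k (1::real) $ i = (if i = k then 1 else 0)"
  by (simp add: axis_def)

lemma matrix_axis_nth: "(A *v axis k 1) $ i = A $ i $ k" for A :: "real^'n^'m"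
  by (simp add: matrix_vector_mult_basis column_def)

text \<open>Dyads. Borders, shears, scalings of one coordinate and the inverse of a bordered matrix
  are all written as dyadic updates, which turns block identities into rewriting with the rules
  below.\<close>

definition outer :: "real^'m \<Rightarrow> real^'m \<Rightarrow> real^'m^'m" where
  "outer u v = (\<chi> i j. u $ i * v $ j)"

lemma outer_nth [simp]: "outer u v $ i $ j = u $ i * v $ j"
  by (simp add: outer_def)

lemma outer_vec: "outer u v *v x = (v \<bullet> x) *\<^sub>R u"
  by (simp add: vec_eq_iff matrix_vector_mult_def inner_vec_def sum_distrib_left sum_distrib_right mult_ac)

lemma matrix_mul_outer: "A ** outer u v = outer (A *v u) v"
  by (simp add: vec_eq_iff matrix_matrix_mult_def matrix_vector_mult_def sum_distrib_right mult.assoc)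

lemma outer_matrix_mul: "outer u v ** A = outer u (transpose A *v v)"
  by (simp add: vec_eq_iff matrix_matrix_mult_def matrix_vector_mult_def transpose_def sum_distrib_left mult_ac)

lemma transpose_outer: "transpose (outer u v) = outer v u"
  by (simp add: vec_eq_iff transpose_def mult.commute)

lemma trace_outer: "trace (outer u v) = u \<bullet> v"
  by (simp add: trace_def inner_vec_def)

lemma outer_add_left: "outer (u + u') v = outer u v + outer u' v"
  and outer_add_right: "outer u (v + v') = outer u v + outer u v'"
  and outer_diff_left: "outer (u - u') v = outer u v - outer u' v"
  and outer_diff_right: "outer u (v - v') = outer u v - outer u v'"
  and outer_scale_left: "outer (c *\<^sub>R u) v = c *\<^sub>R outer u v"
  and outer_scale_right: "outer u (c *\<^sub>R v) = c *\<^sub>R outer u v"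
  and outer_zero_right [simp]: "outer u 0 = 0"
  by (simp_all add: vec_eq_iff algebra_simps)

lemma dot_matrix_transpose: "(A *v x) \<bullet> y = x \<bullet> (transpose A *v y)"
  for A :: "real^'n^'m"
  by (metis adjoint_matrix adjoint_works matrix_vector_mul_linear inner_commute)

lemma transpose_add: "transpose (A + B) = transpose A + transpose (B :: real^'n^'m)"
  by (simp add: vec_eq_iff transpose_def)

lemma matrix_scaleR_left: "(c *\<^sub>R A) ** B = c *\<^sub>R (A ** B)"
  and matrix_scaleR_right: "A ** (c *\<^sub>R B) = c *\<^sub>R (A ** (B :: real^'p^'n))" for A :: "real^'n^'m"
  by (simp_all add: vec_eq_iff matrix_matrix_mult_def sum_distrib_left mult_ac)

lemma matrix_add_rdistrib: "(A + B) ** C = A ** C + B ** (C :: real^'p^'n)" for A B :: "real^'n^'m"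
  by (simp add: vec_eq_iff matrix_matrix_mult_def sum.distrib algebra_simps)

lemma matrix_diff_ldistrib: "A ** (B - C) = A ** B - A ** (C :: real^'p^'n)"
  and matrix_diff_rdistrib: "(D - E) ** B = D ** B - E ** B" for A D E :: "real^'n^'m"
  by (simp_all add: vec_eq_iff matrix_matrix_mult_def sum_subtractf algebra_simps)

lemma trace_scaleR: "trace (c *\<^sub>R A) = c * trace (A :: real^'m^'m)"
  by (simp add: trace_def sum_distrib_left)

text \<open>For square matrices a right inverse is two-sided and unique, which pins down the choice
  operator behind \<open>matrix_inv\<close>.\<close>

lemma matrix_inv_eqI: "A ** B = mat 1 \<Longrightarrow> matrix_inv A = B" for A B :: "real^'m^'m"
proof -
  assume AB: "A ** B = mat 1"
  then have BA: "B ** A = mat 1"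
    by (simp add: matrix_left_right_inverse)
  have "A ** matrix_inv A = mat 1 \<and> matrix_inv A ** A = mat 1"
    unfolding matrix_inv_def by (rule someI[of _ B]) (use AB BA in simp)
  then show "matrix_inv A = B"
    by (metis AB BA matrix_mul_assoc matrix_mul_lid)
qed

lemma matrix_inv_right: "invertible A \<Longrightarrow> A ** matrix_inv A = mat 1"
  and matrix_inv_left: "invertible A \<Longrightarrow> matrix_inv A ** A = mat 1" for A :: "real^'m^'m"
  by (metis invertible_def matrix_inv_eqI)+

lemma transpose_matrix_inv: "invertible A \<Longrightarrow> transpose (matrix_inv A) = matrix_inv (transpose A)"
  for A :: "real^'m^'m"
  by (metis matrix_inv_eqI matrix_inv_left matrix_transpose_mul transpose_mat)

lemma matrix_inv_mult:
  "invertible A \<Longrightarrow> invertible B \<Longrightarrow> matrix_inv (A ** B) = matrix_inv B ** matrix_inv A"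
  for A B :: "real^'m^'m"
  by (rule matrix_inv_eqI) (metis matrix_inv_right matrix_mul_assoc matrix_mul_rid)

lemma pos_def_sym: "pos_def A \<Longrightarrow> transpose A = A"
  and pos_def_pos: "pos_def A \<Longrightarrow> x \<noteq> 0 \<Longrightarrow> 0 < x \<bullet> (A *v x)"
  by (auto simp: pos_def_def)

lemma pos_def_nonneg: "pos_def A \<Longrightarrow> 0 \<le> x \<bullet> (A *v x)"
  using pos_def_pos[of A x] by (cases "x = 0") auto

lemma pos_def_invertible: "pos_def A \<Longrightarrow> invertible A"
  using matrix_left_invertible_ker[of A] pos_def_pos[of A]
  by (metis inner_zero_right invertible_left_inverse less_irrefl)

lemma pos_def_diag_pos: "pos_def A \<Longrightarrow> 0 < A $ k $ k"
  using pos_def_pos[of A "axis k 1"]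
  by (simp add: inner_axis' matrix_vector_mult_basis column_def axis_eq_0_iff)

lemma pos_def_congruence:
  fixes P A :: "real^'m^'m"
  assumes "invertible P"
  shows "pos_def (transpose P ** A ** P) \<longleftrightarrow> pos_def A"
proof -
  have *: "pos_def (transpose P ** A ** P)" if "invertible P" "pos_def A" for P A :: "real^'m^'m"
  proof -
    have "0 < x \<bullet> (transpose P ** A ** P *v x)" if "x \<noteq> 0" for x
    proof -
      have "P *v x \<noteq> 0"
        using \<open>invertible P\<close> \<open>x \<noteq> 0\<close>
        using matrix_left_invertible_ker[of P] invertible_left_inverse[of P] by blast
      then have "0 < (P *v x) \<bullet> (A *v (P *v x))"
        using \<open>pos_def A\<close> pos_def_pos by blast
      then show ?thesis
        by (simp add: dot_matrix_transpose matrix_vector_mul_assoc matrix_mul_assoc)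
    qed
    with that show ?thesis
      by (simp add: pos_def_def matrix_transpose_mul matrix_mul_assoc)
  qed
  show ?thesis
  proof
    assume a: "pos_def (transpose P ** A ** P)"
    \<comment> \<open>The converse is the forward direction applied to the inverse of
      \<open>P\<close>.\<close>
    let ?Q = "matrix_inv P"
    have Q: "P ** ?Q = mat 1" "?Q ** P = mat 1"
      using assms by (simp_all add: matrix_inv_left matrix_inv_right)
    have "invertible ?Q"
      using Q by (auto simp: invertible_def)
    then have "pos_def (transpose ?Q ** (transpose P ** A ** P) ** ?Q)"
      using a * by blast
    moreover have "transpose ?Q ** (transpose P ** A ** P) ** ?Q = transpose (P ** ?Q) ** A ** (P ** ?Q)"
      by (simp add: matrix_transpose_mul matrix_mul_assoc)
    ultimately show "pos_def A"
      by (simp add: Q)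
  qed (use * assms in blast)
qed

text \<open>The transpose is the identity with a combination of the other rows added to row
  \<open>k\<close>; \<open>\<gamma> $ k = 0\<close> keeps row \<open>k\<close> itself out of that
  combination.\<close>

lemma det_column_add:
  assumes "\<gamma> $ k = 0"
  shows "det (mat 1 + outer \<gamma> (axis k 1)) = 1"
proof -
  have "\<gamma> = (\<Sum>j\<in>UNIV. \<gamma> $ j *s axis j 1)"
    by (simp add: basis_expansion)
  also have "\<dots> = (\<Sum>j\<in>UNIV-{k}. \<gamma> $ j *s axis j 1)"
    using assms by (intro sum.mono_neutral_right) auto
  also have "\<dots> \<in> vec.span {row j (mat 1 :: real^'a^'a) |j. j \<noteq> k}"
    by (intro vec.span_sum vec.span_scale vec.span_base)
      (auto simp: row_def mat_def axis_def vec_eq_iff)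
  finally have "det (\<chi> i. if i = k then row k (mat 1) + \<gamma> else row i (mat 1)) = det (mat 1 :: real^'a^'a)"
    by (rule det_row_span)
  moreover have "(\<chi> i. if i = k then row k (mat 1) + \<gamma> else row i (mat 1)) = transpose (mat 1 + outer \<gamma> (axis k 1))"
    by (auto simp: vec_eq_iff transpose_def row_def mat_def axis_def)
  ultimately show ?thesis
    by (simp add: det_transpose)
qed

section \<open>Principal submatrices and Schur complements\<close>

definition supported :: "'m set \<Rightarrow> real^'m \<Rightarrow> bool" where
  "supported J u \<longleftrightarrow> (\<forall>i. i \<notin> J \<longrightarrow> u $ i = 0)"

text \<open>A principal submatrix indexed by \<open>J\<close> is represented by a matrix of full size that agrees with
  the identity outside \<open>J \<times> J\<close>; so determinant, inverse and positive definiteness are those of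
  the submatrix.\<close>

definition block_on :: "'m set \<Rightarrow> real^'m^'m \<Rightarrow> bool" where
  "block_on J C \<longleftrightarrow> (\<forall>i j. i \<notin> J \<or> j \<notin> J \<longrightarrow> C $ i $ j = (if i = j then 1 else 0))"

definition restrict_id :: "'m set \<Rightarrow> real^'m^'m \<Rightarrow> real^'m^'m" where
  "restrict_id J D = (\<chi> i j. if i \<in> J \<and> j \<in> J then D $ i $ j else if i = j then 1 else 0)"

text \<open>The zero extension is meant for the factor that meets an inverse inside a trace: the
  identity part of that inverse outside \<open>J\<close> then contributes nothing.\<close>

definition restrict_zero :: "'m set \<Rightarrow> real^'m^'m \<Rightarrow> real^'m^'m" where
  "restrict_zero J D = (\<chi> i j. if i \<in> J \<and> j \<in> J then D $ i $ j else 0)"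

text \<open>If \<open>C\<close> is a matrix on \<open>J\<close> and \<open>k \<notin> J\<close>, then \<open>C\<close> has the entry \<open>1\<close> at \<open>(k, k)\<close>; the last
  summand replaces it by \<open>b\<close>.\<close>

definition border :: "'m \<Rightarrow> real^'m^'m \<Rightarrow> real^'m \<Rightarrow> real \<Rightarrow> real^'m^'m" where
  "border k C u b = C + outer u (axis k 1) + outer (axis k 1) u + (b - 1) *\<^sub>R outer (axis k 1) (axis k 1)"

text \<open>Here \<open>\<theta>\<close> is the Schur complement of \<open>C\<close> in the bordered
  matrix, and \<open>\<gamma>\<close> holds the regression coefficients of row \<open>k\<close> on
  \<open>C\<close>.\<close>

definition schur_border :: "'m \<Rightarrow> real^'m^'m \<Rightarrow> real^'m \<Rightarrow> real \<Rightarrow> real^'m^'m" where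
  "schur_border k C \<gamma> \<theta> = border k C (C *v \<gamma>) (\<theta> + \<gamma> \<bullet> (C *v \<gamma>))"

lemma block_on_axis:
  assumes "block_on J C" "k \<notin> J"
  shows "C *v axis k 1 = axis k 1" "transpose C *v axis k 1 = axis k 1"
  using assms
  by (auto simp: block_on_def matrix_axis_nth axis_one_nth vec_eq_iff transpose_def)

text \<open>In terms of fixed axes, closure under products, transposes and inverses is
  immediate.\<close>

lemma block_on_iff_axis:
  "block_on J C \<longleftrightarrow> (\<forall>k. k \<notin> J \<longrightarrow> C *v axis k 1 = axis k 1 \<and> transpose C *v axis k 1 = axis k 1)"
  by (auto simp: block_on_def matrix_axis_nth axis_one_nth vec_eq_iff transpose_def)

lemma block_on_mult: "block_on J A \<Longrightarrow> block_on J B \<Longrightarrow> block_on J (A ** B)"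
  unfolding block_on_iff_axis
  by (simp add: matrix_vector_mul_assoc[symmetric] matrix_transpose_mul)

lemma block_on_transpose: "block_on J A \<Longrightarrow> block_on J (transpose A)"
  unfolding block_on_iff_axis by simp

lemma block_on_inv:
  assumes "block_on J A" "invertible A"
  shows "block_on J (matrix_inv A)"
proof -
  have "matrix_inv A *v (A *v axis k 1) = axis k 1" 
    "transpose (matrix_inv A) *v (transpose A *v axis k 1) = axis k 1" for k
    using assms(2)
    by (simp_all add: matrix_vector_mul_assoc matrix_transpose_mul[symmetric] matrix_inv_left matrix_inv_right)
  then show ?thesis
    using assms(1) unfolding block_on_iff_axis by metis
qed

lemma block_on_restrict_id [simp]: "block_on J (restrict_id J D)"
  by (auto simp: block_on_def restrict_id_def)

lemma block_on_mono: "block_on J C \<Longrightarrow> J \<subseteq> K \<Longrightarrow> block_on K C"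
  unfolding block_on_def by (meson subsetD)

lemma supported_mult: "block_on J C \<Longrightarrow> supported J u \<Longrightarrow> supported J (C *v u)"
  by (auto simp: block_on_def supported_def matrix_vector_mult_def intro!: sum.neutral)

lemma supported_axis_inner: "supported J u \<Longrightarrow> k \<notin> J \<Longrightarrow> axis k 1 \<bullet> u = 0"
  by (simp add: supported_def inner_axis')

text \<open>One elimination step: the shear clears the border and leaves \<open>C\<close> with the
  Schur complement at \<open>(k, k)\<close>. Determinant, positive definiteness and the later
  factorisation are all read off this congruence.\<close>

lemma schur_border_factor:
  assumes "block_on J C" "k \<notin> J" "supported J \<gamma>" "transpose C = C"
  shows "schur_border k C \<gamma> \<theta> =
    transpose (mat 1 + outer \<gamma> (axis k 1)) ** (C + (\<theta> - 1) *\<^sub>R outer (axis k 1) (axis k 1))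
      ** (mat 1 + outer \<gamma> (axis k 1))"
proof -
  have g: "axis k 1 \<bullet> \<gamma> = 0" "\<gamma> \<bullet> axis k 1 = 0"
    using supported_axis_inner[OF assms(3,2)] by (simp_all add: inner_commute)
  have s: "supported J (C *v \<gamma>)"
    using assms supported_mult by blast
  have "(C + (\<theta> - 1) *\<^sub>R outer (axis k 1) (axis k 1)) ** (mat 1 + outer \<gamma> (axis k 1)) =
      C + (\<theta> - 1) *\<^sub>R outer (axis k 1) (axis k 1) + outer (C *v \<gamma>) (axis k 1)"
    by (simp add: matrix_add_ldistrib matrix_add_rdistrib matrix_scaleR_left matrix_mul_outer
        outer_vec g scaleR_matrix_vector_assoc[symmetric] algebra_simps)
  then have "transpose (mat 1 + outer \<gamma> (axis k 1)) ** (C + (\<theta> - 1) *\<^sub>R outer (axis k 1) (axis k 1))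
      ** (mat 1 + outer \<gamma> (axis k 1)) =
     (mat 1 + outer (axis k 1) \<gamma>) ** (C + (\<theta> - 1) *\<^sub>R outer (axis k 1) (axis k 1) + outer (C *v \<gamma>) (axis k 1))"
    by (simp add: matrix_mul_assoc[symmetric] transpose_add transpose_outer)
  also have "\<dots> = C + (\<theta> - 1) *\<^sub>R outer (axis k 1) (axis k 1) + outer (C *v \<gamma>) (axis k 1)
     + outer (axis k 1) (C *v \<gamma>) + (\<gamma> \<bullet> (C *v \<gamma>)) *\<^sub>R outer (axis k 1) (axis k 1)"
    using assms(4) g
    by (simp add: matrix_add_ldistrib matrix_add_rdistrib matrix_scaleR_right outer_matrix_mul
        transpose_outer outer_vec transpose_add transpose_scalar outer_scale_right inner_commute)
  also have "\<dots> = schur_border k C \<gamma> \<theta>"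
    by (simp add: schur_border_def border_def algebra_simps)
  finally show ?thesis ..
qed

lemma diag_scale_factor:
  assumes "C *v axis k 1 = axis k 1"
  shows "C + (\<theta> - 1) *\<^sub>R outer (axis k 1) (axis k 1) = C ** (mat 1 + (\<theta> - 1) *\<^sub>R outer (axis k 1) (axis k 1))"
  by (simp add: matrix_add_ldistrib matrix_scaleR_right matrix_mul_outer assms)

lemma det_diag_scale: "det (mat 1 + (\<theta> - 1) *\<^sub>R outer (axis k 1) (axis k 1) :: real^'m^'m) = \<theta>"
proof -
  have "det (mat 1 + (\<theta> - 1) *\<^sub>R outer (axis k 1) (axis k 1) :: real^'m^'m)
      = (\<Prod>i\<in>UNIV. (mat 1 + (\<theta> - 1) *\<^sub>R outer (axis k 1) (axis k 1) :: real^'m^'m) $ i $ i)"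
    by (rule det_diagonal) (auto simp: mat_def axis_def)
  also have "\<dots> = (\<Prod>i\<in>(UNIV::'m set). if i = k then \<theta> else 1)"
    by (rule prod.cong) (auto simp: mat_def axis_def)
  finally show ?thesis
    by simp
qed

lemma det_schur_border:
  assumes "block_on J C" "k \<notin> J" "supported J \<gamma>" "transpose C = C"
  shows "det (schur_border k C \<gamma> \<theta>) = \<theta> * det C"
proof -
  have "\<gamma> $ k = 0"
    using assms by (simp add: supported_def)
  then show ?thesis
    by (simp add: schur_border_factor[OF assms] det_mul det_transpose det_column_add
        diag_scale_factor[OF block_on_axis(1)[OF assms(1,2)]] det_diag_scale)
qed

lemma invertible_shear: "\<gamma> $ k = 0 \<Longrightarrow> invertible (mat 1 + outer \<gamma> (axis k 1))"
  by (simp add: invertible_det_nz det_column_add)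

text \<open>Vectors orthogonal to \<open>axis k 1\<close> do not see the border, and
  \<open>C\<close> fixes that axis. Hence the form of \<open>C\<close> at \<open>x\<close> is the
  bordered form at the projection \<open>y\<close> plus the square of the coordinate
  \<open>t\<close>.\<close>

lemma pos_def_border_imp:
  assumes "block_on J C" "k \<notin> J" "supported J u" "pos_def (border k C u b)"
  shows "pos_def C"
  unfolding pos_def_def
proof (intro conjI allI impI)
  let ?e = "axis k 1 :: real^'a"
  show "transpose C = C"
    using pos_def_sym[OF assms(4)]
    by (simp add: border_def transpose_add transpose_outer transpose_scalar)
  fix x :: "real^'a" assume "x \<noteq> 0"
  define t where "t = x $ k"
  define y where "y = x - t *\<^sub>R ?e"
  have yk: "?e \<bullet> y = 0"
    by (simp add: y_def t_def inner_axis' inner_diff_right)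
  have C: "C *v ?e = ?e" "transpose C *v ?e = ?e"
    using block_on_axis assms by blast+
  have "?e \<bullet> (C *v y) = (transpose C *v ?e) \<bullet> y"
    by (simp add: dot_matrix_transpose)
  then have eCy: "?e \<bullet> (C *v y) = 0"
    using C yk by simp
  have x: "x = y + t *\<^sub>R ?e"
    by (simp add: y_def)
  have xCx: "x \<bullet> (C *v x) = y \<bullet> (C *v y) + t\<^sup>2"
    unfolding x using C yk eCy
    by (simp add: algebra_simps inner_commute power2_eq_square)
  have yBy: "y \<bullet> (border k C u b *v y) = y \<bullet> (C *v y)"
    using yk by (simp add: border_def algebra_simps outer_vec inner_commute scaleR_matrix_vector_assoc[symmetric])
  show "0 < x \<bullet> (C *v x)"
  proof (cases "y = 0")
    case True
    then show ?thesis
      using xCx \<open>x \<noteq> 0\<close> x by auto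
  next
    case False
    then show ?thesis
      using xCx yBy pos_def_pos[OF assms(4), of y] by (simp add: add_pos_nonneg)
  qed
qed

text \<open>After the elimination congruence the form is that of \<open>C\<close> at the projected
  vector plus \<open>\<theta>\<close> times the square of the coordinate \<open>k\<close>.\<close>

lemma pos_def_schur_border_iff:
  assumes "block_on J C" "k \<notin> J" "supported J \<gamma>" "pos_def C"
  shows "pos_def (schur_border k C \<gamma> \<theta>) \<longleftrightarrow> 0 < \<theta>"
proof -
  let ?e = "axis k 1 :: real^'a"
  let ?B = "C + (\<theta> - 1) *\<^sub>R outer ?e ?e"
  have C: "C *v ?e = ?e" "transpose C *v ?e = ?e"
    using block_on_axis assms by blast+
  have "pos_def (schur_border k C \<gamma> \<theta>) \<longleftrightarrow> pos_def ?B"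
    unfolding schur_border_factor[OF assms(1-3) pos_def_sym[OF assms(4)]]
    by (rule pos_def_congruence) (use assms in \<open>simp add: invertible_shear supported_def\<close>)
  also have "\<dots> \<longleftrightarrow> 0 < \<theta>"
  proof
    assume "pos_def ?B"
    then have "0 < ?B $ k $ k"
      by (rule pos_def_diag_pos)
    then show "0 < \<theta>"
      using assms by (simp add: block_on_def)
  next
    assume "0 < \<theta>"
    show "pos_def ?B"
      unfolding pos_def_def
    proof (intro conjI allI impI)
      show "transpose ?B = ?B"
        using pos_def_sym[OF assms(4)]
        by (simp add: transpose_add transpose_outer transpose_scalar)
      fix x :: "real^'a" assume "x \<noteq> 0"
      define t where "t = x $ k"
      define y where "y = x - t *\<^sub>R ?e"
      have yk: "?e \<bullet> y = 0"
        by (simp add: y_def t_def inner_axis' inner_diff_right)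
      have "?e \<bullet> (C *v y) = (transpose C *v ?e) \<bullet> y"
        by (simp add: dot_matrix_transpose)
      then have eCy: "?e \<bullet> (C *v y) = 0"
        using C yk by simp
      have x: "x = y + t *\<^sub>R ?e"
        by (simp add: y_def)
      have e1: "?e \<bullet> ?e = 1"
        by (simp add: inner_axis_axis)
      have xCx: "x \<bullet> (?B *v x) = y \<bullet> (C *v y) + \<theta> * t\<^sup>2"
        unfolding x using C yk eCy e1
        by (simp add: algebra_simps inner_commute power2_eq_square outer_vec scaleR_matrix_vector_assoc[symmetric])
      show "0 < x \<bullet> (?B *v x)"
      proof (cases "y = 0")
        case True
        then have "t \<noteq> 0" using x \<open>x \<noteq> 0\<close> by auto
        then show ?thesis
          using xCx True \<open>0 < \<theta>\<close> by simp
      next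
        case False
        then show ?thesis
          using xCx pos_def_pos[OF assms(4), of y] \<open>0 < \<theta>\<close> by (simp add: add_pos_nonneg)
      qed
    qed
  qed
  finally show ?thesis .
qed

text \<open>In Schur coordinates the inverse separates into a part in \<open>C\<close> and a single
  dyad in \<open>(\<gamma>, \<theta>)\<close>. The subtracted dyad removes the entry 1 that the
  identity extension of \<open>C\<close> leaves at \<open>(k, k)\<close>.\<close>

lemma matrix_inv_schur_border:
  assumes "block_on J C" "k \<notin> J" "supported J \<gamma>" "pos_def C" "0 < \<theta>"
  shows "matrix_inv (schur_border k C \<gamma> \<theta>) =
    matrix_inv C - outer (axis k 1) (axis k 1) + (1 / \<theta>) *\<^sub>R outer (axis k 1 - \<gamma>) (axis k 1 - \<gamma>)"
proof (rule matrix_inv_eqI)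
  let ?e = "axis k 1 :: real^'a"
  have inv: "invertible C" and sym: "transpose C = C"
    using assms pos_def_invertible pos_def_sym by auto
  have g: "?e \<bullet> \<gamma> = 0" "\<gamma> \<bullet> ?e = 0" "?e \<bullet> (C *v \<gamma>) = 0" "(C *v \<gamma>) \<bullet> ?e = 0"
    using supported_axis_inner[OF assms(3,2)] supported_axis_inner[OF supported_mult[OF assms(1,3)] assms(2)]
    by (simp_all add: inner_commute)
  have e1: "?e \<bullet> ?e = 1"
    by (simp add: inner_axis_axis)
  have C: "C *v ?e = ?e"
    using block_on_axis assms by blast
  have symi: "transpose (matrix_inv C) = matrix_inv C"
    using inv sym by (simp add: transpose_matrix_inv)
  have Ci: "matrix_inv C *v ?e = ?e" "matrix_inv C *v (C *v \<gamma>) = \<gamma>" "C ** matrix_inv C = mat 1"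
    using inv C matrix_inv_left[OF inv] matrix_inv_right[OF inv]
    by (metis matrix_vector_mul_assoc matrix_vector_mul_lid)+
  show "schur_border k C \<gamma> \<theta> **
    (matrix_inv C - outer ?e ?e + (1 / \<theta>) *\<^sub>R outer (?e - \<gamma>) (?e - \<gamma>)) = mat 1"
    using \<open>0 < \<theta>\<close>
    by (simp add: schur_border_def border_def matrix_add_ldistrib matrix_add_rdistrib matrix_diff_ldistrib
        matrix_diff_rdistrib matrix_scaleR_left matrix_scaleR_right outer_matrix_mul matrix_mul_outer outer_vec
        transpose_outer symi Ci C g e1 outer_diff_left outer_diff_right outer_add_left outer_add_right
        outer_scale_left outer_scale_right scaleR_matrix_vector_assoc[symmetric]
        inner_commute[of "C *v \<gamma>" \<gamma>] algebra_simps)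
qed

section \<open>Linear substitutions\<close>

abbreviation vec_lborel :: "'m set \<Rightarrow> (real^'m) measure" where
  "vec_lborel J \<equiv> coord_lborel J (\<lambda>j. axis j 1)"

section \<open>Measurability of matrix operations\<close>

lemma borel_measurable_vec_nth [measurable (raw)]:
  "f \<in> borel_measurable M \<Longrightarrow> (\<lambda>x. f x $ k) \<in> borel_measurable M"
  for f :: "'x \<Rightarrow> ('a::topological_space)^'n"
  by (erule measurable_compose) (intro borel_measurable_continuous_onI continuous_intros)

lemma borel_measurable_vec_lambda [measurable (raw)]:
  fixes f :: "'n::finite \<Rightarrow> 'x \<Rightarrow> 'a::euclidean_space"
  assumes "\<And>i. f i \<in> borel_measurable M"
  shows "(\<lambda>x. \<chi> i. f i x) \<in> borel_measurable M"
proof (subst borel_measurable_euclidean_space, rule ballI)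
  fix e :: "'a^'n" assume "e \<in> Basis"
  then obtain i u where "e = axis i u" "u \<in> Basis"
    by (auto simp: Basis_vec_def)
  then show "(\<lambda>x. (\<chi> i. f i x) \<bullet> e) \<in> borel_measurable M"
    using assms by (simp add: inner_axis)
qed

lemma borel_measurable_matrix_vector [measurable (raw)]:
  fixes A :: "'x \<Rightarrow> real^'n^'m"
  assumes [measurable]: "A \<in> borel_measurable M" "f \<in> borel_measurable M"
  shows "(\<lambda>x. A x *v f x) \<in> borel_measurable M"
  unfolding matrix_vector_mult_def by measurable

lemma borel_measurable_outer [measurable (raw)]:
  assumes [measurable]: "f \<in> borel_measurable M" "g \<in> borel_measurable M"
  shows "(\<lambda>x. outer (f x) (g x)) \<in> borel_measurable M"
  unfolding outer_def by measurable

lemma borel_measurable_matrix_mult [measurable (raw)]: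
  fixes A :: "'x \<Rightarrow> real^'n^'m" and B :: "'x \<Rightarrow> real^'p^'n"
  assumes [measurable]: "A \<in> borel_measurable M" "B \<in> borel_measurable M"
  shows "(\<lambda>x. A x ** B x) \<in> borel_measurable M"
  unfolding matrix_matrix_mult_def by measurable

lemma borel_measurable_trace [measurable (raw)]:
  fixes A :: "'x \<Rightarrow> real^'n^'n"
  assumes [measurable]: "A \<in> borel_measurable M"
  shows "(\<lambda>x. trace (A x)) \<in> borel_measurable M"
  unfolding trace_def by measurable

lemma borel_measurable_det [measurable (raw)]:
  fixes A :: "'x \<Rightarrow> real^'n^'n"
  assumes [measurable]: "A \<in> borel_measurable M"
  shows "(\<lambda>x. det (A x)) \<in> borel_measurable M"
  unfolding det_def by measurable

section \<open>Jacobians on coordinate subspaces\<close>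

lemma span_axis_iff: "v \<in> span ((\<lambda>j. axis j 1) ` J) \<longleftrightarrow> supported J v" for v :: "real^'m"
proof
  assume "v \<in> span ((\<lambda>j. axis j 1) ` J)"
  then show "supported J v"
    by (induction rule: span_induct_alt) (auto simp: supported_def axis_one_nth split: if_splits)
next
  assume *: "supported J v"
  have "v = (\<Sum>j\<in>UNIV. v $ j *\<^sub>R axis j 1)"
    using basis_expansion[of v] by (simp add: scalar_mult_eq_scaleR)
  also have "\<dots> = (\<Sum>j\<in>J. v $ j *\<^sub>R axis j 1)"
    using * by (intro sum.mono_neutral_right) (auto simp: supported_def)
  also have "\<dots> \<in> span ((\<lambda>j. axis j 1) ` J)"
    by (intro span_sum span_scale span_base) auto
  finally show "v \<in> span ((\<lambda>j. axis j 1) ` J)" .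
qed

lemma nn_integral_vec_cong:
  fixes f g :: "real^'m \<Rightarrow> ennreal"
  assumes "f \<in> borel_measurable borel" "g \<in> borel_measurable borel"
    and "\<And>v. supported J v \<Longrightarrow> f v = g v"
  shows "(\<integral>\<^sup>+ v. f v \<partial>vec_lborel J) = (\<integral>\<^sup>+ v. g v \<partial>vec_lborel J)"
  by (rule nn_integral_coord_cong) (use assms in \<open>auto simp: span_axis_iff\<close>)

text \<open>Change of variables on the coordinates in \<open>J\<close> with the full determinant;
  for \<open>K\<close> equal to the identity outside \<open>J\<close> this is the determinant of the
  \<open>J\<close>-block. Closure under products reduces it to elementary maps.\<close>

definition lborel_jacobian :: "'m set \<Rightarrow> real^'m^'m \<Rightarrow> bool" where
  "lborel_jacobian J K \<longleftrightarrow> (\<forall>h\<in>borel_measurable borel.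
     ennreal \<bar>det K\<bar> * (\<integral>\<^sup>+ v. h (K *v v) \<partial>vec_lborel J) = (\<integral>\<^sup>+ v. h v \<partial>vec_lborel J))"

lemma lborel_jacobian_mult:
  assumes "lborel_jacobian J A" "lborel_jacobian J B"
  shows "lborel_jacobian J (A ** B)"
  unfolding lborel_jacobian_def
proof
  fix h :: "real^'a \<Rightarrow> ennreal" assume [measurable]: "h \<in> borel_measurable borel"
  have "ennreal \<bar>det B\<bar> * (\<integral>\<^sup>+ v. h (A *v (B *v v)) \<partial>vec_lborel J) = (\<integral>\<^sup>+ v. h (A *v v) \<partial>vec_lborel J)"
    using assms(2)[unfolded lborel_jacobian_def, rule_format, of "\<lambda>v. h (A *v v)"] by simp
  moreover have "ennreal \<bar>det A\<bar> * (\<integral>\<^sup>+ v. h (A *v v) \<partial>vec_lborel J) = (\<integral>\<^sup>+ v. h v \<partial>vec_lborel J)"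
    using assms(1)[unfolded lborel_jacobian_def] by simp
  ultimately show "ennreal \<bar>det (A ** B)\<bar> * (\<integral>\<^sup>+ v. h (A ** B *v v) \<partial>vec_lborel J) = (\<integral>\<^sup>+ v. h v \<partial>vec_lborel J)"
    by (simp add: det_mul abs_mult ennreal_mult mult.assoc matrix_vector_mul_assoc)
qed

lemma shear_vec: "(mat 1 + outer \<gamma> (axis k 1)) *v v = v + (v $ k) *\<^sub>R \<gamma>"
  and transpose_shear_vec: "transpose (mat 1 + outer \<gamma> (axis k 1)) *v v = v + (\<gamma> \<bullet> v) *\<^sub>R axis k 1"
  by (simp_all add: matrix_vector_mult_add_rdistrib outer_vec inner_axis' transpose_add transpose_outer)

lemma diag_scale_vec: "(mat 1 + (s - 1) *\<^sub>R outer (axis k 1) (axis k 1)) *v v = v + ((s - 1) * v $ k) *\<^sub>R axis k 1"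
  by (simp add: matrix_vector_mult_add_rdistrib outer_vec inner_axis' scaleR_matrix_vector_assoc[symmetric])

text \<open>For a fixed coordinate \<open>k\<close> the shear translates the coordinates in
  \<open>J\<close>; its transpose, for fixed coordinates in \<open>J\<close>, translates the
  coordinate \<open>k\<close>. Both cases are translation invariance under Fubini.\<close>

lemma lborel_jacobian_shear:
  assumes "finite J" "k \<notin> J" "supported J \<gamma>"
  shows "lborel_jacobian (insert k J) (mat 1 + outer \<gamma> (axis k 1))"
    and "lborel_jacobian (insert k J) (transpose (mat 1 + outer \<gamma> (axis k 1)))"
proof -
  note [simp] = assms(1,2)
  have gk: "\<gamma> $ k = 0"
    using assms by (simp add: supported_def)
  have "(\<integral>\<^sup>+ v. h (v + (v $ k) *\<^sub>R \<gamma>) \<partial>vec_lborel (insert k J)) = (\<integral>\<^sup>+ v. h v \<partial>vec_lborel (insert k J))"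
    if [measurable]: "h \<in> borel_measurable borel" for h :: "real^'a \<Rightarrow> ennreal"
  proof -
    have "(\<integral>\<^sup>+ v. h (v + (v $ k) *\<^sub>R \<gamma>) \<partial>vec_lborel (insert k J)) =
        (\<integral>\<^sup>+ v. \<integral>\<^sup>+ t. h (v + t *\<^sub>R axis k 1 + (v $ k + t) *\<^sub>R \<gamma>) \<partial>lborel \<partial>vec_lborel J)"
      by (simp add: nn_integral_coord_insert axis_one_nth)
    \<comment> \<open>Vectors supported on \<open>J\<close> satisfy \<open>v $ k = 0\<close>,
      because \<open>k\<close> lies outside \<open>J\<close>.\<close>
    also have "\<dots> = (\<integral>\<^sup>+ v. \<integral>\<^sup>+ t. h (v + t *\<^sub>R axis k 1 + t *\<^sub>R \<gamma>) \<partial>lborel \<partial>vec_lborel J)"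
      by (rule nn_integral_vec_cong) (auto simp: supported_def)
    also have "\<dots> = (\<integral>\<^sup>+ t. \<integral>\<^sup>+ v. h (v + t *\<^sub>R axis k 1 + t *\<^sub>R \<gamma>) \<partial>vec_lborel J \<partial>lborel)"
      by (rule nn_integral_coord_swap) auto
    also have "\<dots> = (\<integral>\<^sup>+ t. \<integral>\<^sup>+ v. h (v + t *\<^sub>R axis k 1) \<partial>vec_lborel J \<partial>lborel)"
    proof (rule nn_integral_cong)
      fix t :: real
      have "t *\<^sub>R \<gamma> \<in> span ((\<lambda>j. axis j 1) ` J)"
        using assms(3) by (simp add: span_axis_iff supported_def)
      from nn_integral_coord_translate[OF _ this, of "\<lambda>v. h (v + t *\<^sub>R axis k 1)"]
      show "(\<integral>\<^sup>+ v. h (v + t *\<^sub>R axis k 1 + t *\<^sub>R \<gamma>) \<partial>vec_lborel J) = (\<integral>\<^sup>+ v. h (v + t *\<^sub>R axis k 1) \<partial>vec_lborel J)"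
        by (simp add: add_ac)
    qed
    also have "\<dots> = (\<integral>\<^sup>+ v. \<integral>\<^sup>+ t. h (v + t *\<^sub>R axis k 1) \<partial>lborel \<partial>vec_lborel J)"
      by (rule nn_integral_coord_swap[symmetric]) auto
    finally show ?thesis
      by (simp add: nn_integral_coord_insert)
  qed
  then show "lborel_jacobian (insert k J) (mat 1 + outer \<gamma> (axis k 1))"
    by (simp add: lborel_jacobian_def det_column_add[OF gk] shear_vec)
  have "(\<integral>\<^sup>+ v. h (v + (\<gamma> \<bullet> v) *\<^sub>R axis k 1) \<partial>vec_lborel (insert k J)) = (\<integral>\<^sup>+ v. h v \<partial>vec_lborel (insert k J))"
    if [measurable]: "h \<in> borel_measurable borel" for h :: "real^'a \<Rightarrow> ennreal"
  proof -
    have "(\<integral>\<^sup>+ t. h (v + t *\<^sub>R axis k 1 + (\<gamma> \<bullet> (v + t *\<^sub>R axis k 1)) *\<^sub>R axis k 1) \<partial>lborel) =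
        (\<integral>\<^sup>+ t. h (v + t *\<^sub>R axis k 1) \<partial>lborel)" for v
      using nn_integral_lborel_translate[of "\<lambda>t. h (v + t *\<^sub>R axis k 1)" "\<gamma> \<bullet> v"] gk
      by (simp add: algebra_simps inner_axis)
    then show ?thesis
      by (simp add: nn_integral_coord_insert)
  qed
  then show "lborel_jacobian (insert k J) (transpose (mat 1 + outer \<gamma> (axis k 1)))"
    by (simp add: lborel_jacobian_def det_transpose det_column_add[OF gk] transpose_shear_vec)
qed

text \<open>Passes from \<open>J\<close> to \<open>insert k J\<close>: as \<open>K\<close> fixes the
  new axis, the new coordinate is only multiplied by \<open>s\<close>, and Fubini separates it from
  the action of \<open>K\<close>.\<close>

lemma lborel_jacobian_diag_scale:
  assumes "finite J" "k \<notin> J" "lborel_jacobian J K" "K *v axis k 1 = axis k 1" "s \<noteq> 0"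
  shows "lborel_jacobian (insert k J) (K ** (mat 1 + (s - 1) *\<^sub>R outer (axis k 1) (axis k 1)))"
  unfolding lborel_jacobian_def
proof
  fix h :: "real^'a \<Rightarrow> ennreal" assume [measurable]: "h \<in> borel_measurable borel"
  note [simp] = assms(1,2)
  let ?D = "mat 1 + (s - 1) *\<^sub>R outer (axis k 1) (axis k 1) :: real^'a^'a"
  have "(\<integral>\<^sup>+ v. h (K ** ?D *v v) \<partial>vec_lborel (insert k J)) =
    (\<integral>\<^sup>+ v. \<integral>\<^sup>+ t. h (K *v (v + t *\<^sub>R axis k 1 + ((s - 1) * (v $ k + t)) *\<^sub>R axis k 1)) \<partial>lborel \<partial>vec_lborel J)"
    by (simp add: nn_integral_coord_insert matrix_vector_mul_assoc[symmetric] diag_scale_vec axis_one_nth)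
  also have "\<dots> = (\<integral>\<^sup>+ v. \<integral>\<^sup>+ t. h (K *v v + (s * t) *\<^sub>R axis k 1) \<partial>lborel \<partial>vec_lborel J)"
    by (rule nn_integral_vec_cong) (auto simp: supported_def algebra_simps assms(4))
  finally have "ennreal \<bar>s\<bar> * (\<integral>\<^sup>+ v. h (K ** ?D *v v) \<partial>vec_lborel (insert k J)) =
      (\<integral>\<^sup>+ v. ennreal \<bar>s\<bar> * (\<integral>\<^sup>+ t. h (K *v v + (s * t) *\<^sub>R axis k 1) \<partial>lborel) \<partial>vec_lborel J)"
    by (simp add: nn_integral_cmult)
  also have "\<dots> = (\<integral>\<^sup>+ v. \<integral>\<^sup>+ t. h (K *v v + t *\<^sub>R axis k 1) \<partial>lborel \<partial>vec_lborel J)"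
    using nn_integral_real_affine[of "\<lambda>t. h (K *v v + t *\<^sub>R axis k 1)" s 0 for v] assms(5)
    by simp
  finally have "ennreal \<bar>det K\<bar> * (ennreal \<bar>s\<bar> * (\<integral>\<^sup>+ v. h (K ** ?D *v v) \<partial>vec_lborel (insert k J))) =
     ennreal \<bar>det K\<bar> * (\<integral>\<^sup>+ v. \<integral>\<^sup>+ t. h (K *v v + t *\<^sub>R axis k 1) \<partial>lborel \<partial>vec_lborel J)"
    by simp
  also have "\<dots> = (\<integral>\<^sup>+ v. \<integral>\<^sup>+ t. h (v + t *\<^sub>R axis k 1) \<partial>lborel \<partial>vec_lborel J)"
    using assms(3)[unfolded lborel_jacobian_def, rule_format, of "\<lambda>v. \<integral>\<^sup>+ t. h (v + t *\<^sub>R axis k 1) \<partial>lborel"]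
    by simp
  finally show "ennreal \<bar>det (K ** ?D)\<bar> * (\<integral>\<^sup>+ v. h (K ** ?D *v v) \<partial>vec_lborel (insert k J)) =
     (\<integral>\<^sup>+ v. h v \<partial>vec_lborel (insert k J))"
    by (simp add: nn_integral_coord_insert det_mul det_diag_scale abs_mult ennreal_mult mult.assoc)
qed

text \<open>The transpose of \<open>A\<close> fixes \<open>axis k 1\<close>. Together with
  \<open>diag_scale_factor\<close> this shows that the scaling commutes with
  \<open>A\<close>.\<close>

lemma diag_scale_commute:
  assumes "block_on J A" "k \<notin> J"
  shows "(mat 1 + (s - 1) *\<^sub>R outer (axis k 1) (axis k 1)) ** A = A + (s - 1) *\<^sub>R outer (axis k 1) (axis k 1)"
  using block_on_axis[OF assms]
  by (simp add: matrix_add_rdistrib matrix_scaleR_left outer_matrix_mul)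

text \<open>The factor is a product of shears and scalings of single coordinates, whose Jacobians come
  from Fubini's theorem alone.\<close>

lemma pos_def_factorization:
  fixes C :: "real^'m^'m"
  assumes "block_on J C" "pos_def C"
  shows "\<exists>K. C = transpose K ** K \<and> block_on J K \<and> lborel_jacobian J K \<and> lborel_jacobian J (transpose K)"
  using finite[of J] assms
proof (induction J arbitrary: C rule: finite_induct)
  case empty
  have "C = mat 1"
    using \<open>block_on {} C\<close> by (simp add: block_on_def vec_eq_iff mat_def)
  then show ?case
    using empty by (intro exI[of _ "mat 1"]) (simp add: lborel_jacobian_def)
next
  case (insert k J)
  define e where "e = (axis k 1 :: real^'m)"
  define C0 where "C0 = restrict_id J C"
  define u where "u = (\<chi> i. if i \<in> J then C $ i $ k else 0)"
  \<comment> \<open>Schur coordinates of \<open>C\<close>: \<open>\<gamma>\<close> solves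
    \<open>C0 *v \<gamma> = u\<close>, and \<open>\<theta>\<close> is what remains of the diagonal
    entry.\<close>
  define \<gamma> where "\<gamma> = matrix_inv C0 *v u"
  define \<theta> where "\<theta> = C $ k $ k - \<gamma> \<bullet> (C0 *v \<gamma>)"
  have sym: "C $ i $ j = C $ j $ i" for i j
    using arg_cong[OF pos_def_sym[OF insert.prems(2)], of "\<lambda>A. A $ i $ j"] by (simp add: transpose_def)
  have C0: "block_on J C0"
    by (simp add: C0_def)
  have u: "supported J u"
    by (simp add: u_def supported_def)
  have C: "border k C0 u (C $ k $ k) = C"
    using insert.hyps insert.prems(1) sym
    by (auto simp: vec_eq_iff border_def C0_def u_def restrict_id_def block_on_def axis_one_nth)
  have pd0: "pos_def C0"
    by (rule pos_def_border_imp[OF C0 insert.hyps(2) u, of "C $ k $ k"]) (simp add: C insert.prems)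
  have u': "C0 *v \<gamma> = u"
    using matrix_inv_right[OF pos_def_invertible[OF pd0]] by (simp add: \<gamma>_def matrix_vector_mul_assoc)
  have \<gamma>: "supported J \<gamma>"
    unfolding \<gamma>_def by (intro supported_mult block_on_inv C0 pos_def_invertible pd0 u)
  have C': "C = schur_border k C0 \<gamma> \<theta>"
    unfolding schur_border_def u' using C by (simp add: \<theta>_def u')
  have "0 < \<theta>"
    using pos_def_schur_border_iff[OF C0 insert.hyps(2) \<gamma> pd0] insert.prems C' by metis
  obtain K where K: "C0 = transpose K ** K" "block_on J K" "lborel_jacobian J K" "lborel_jacobian J (transpose K)"
    using insert.IH[OF C0 pd0] by blast
  \<comment> \<open>A Cholesky step: \<open>S\<close> carries the square root of the Schur
    complement and \<open>E\<close> eliminates the border, so the new factor is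
    \<open>K ** S ** E\<close>.\<close>
  define s where "s = sqrt \<theta>"
  have s: "s \<noteq> 0" "s * s = \<theta>"
    using \<open>0 < \<theta>\<close> by (simp_all add: s_def)
  define S where "S = mat 1 + (s - 1) *\<^sub>R outer e e"
  define E where "E = mat 1 + outer \<gamma> e"
  have tS: "transpose S = S"
    by (simp add: S_def transpose_add transpose_scalar transpose_outer)
  have e1: "e \<bullet> e = 1"
    by (simp add: e_def inner_axis_axis)
  have "transpose (K ** S ** E) ** (K ** S ** E) = transpose E ** (S ** (C0 ** S)) ** E"
    by (simp add: K(1) matrix_transpose_mul tS matrix_mul_assoc)
  also have "C0 ** S = C0 + (s - 1) *\<^sub>R outer e e"
    unfolding S_def e_def by (rule diag_scale_factor[symmetric]) (rule block_on_axis(1)[OF C0 insert.hyps(2)])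
  also have "S ** (C0 + (s - 1) *\<^sub>R outer e e) = C0 + (\<theta> - 1) *\<^sub>R outer e e"
  proof -
    have "S ** C0 = C0 + (s - 1) *\<^sub>R outer e e"
      unfolding S_def e_def by (rule diag_scale_commute[OF C0 insert.hyps(2)])
    moreover have "S ** outer e e = s *\<^sub>R outer e e"
      by (simp add: S_def matrix_mul_outer algebra_simps scaleR_matrix_vector_assoc[symmetric] outer_vec e1 outer_add_left outer_scale_left outer_diff_left)
    ultimately have "S ** (C0 + (s - 1) *\<^sub>R outer e e) =
        C0 + (s - 1) *\<^sub>R outer e e + (s - 1) *\<^sub>R s *\<^sub>R outer e e"
      by (simp only: matrix_add_ldistrib matrix_scaleR_right)
    then show ?thesis
      by (simp add: algebra_simps s(2)[symmetric])
  qed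
  also have "transpose E ** \<dots> ** E = C"
    unfolding C' E_def e_def
    by (rule schur_border_factor[OF C0 insert.hyps(2) \<gamma> pos_def_sym[OF pd0], symmetric])
  finally have "C = transpose (K ** S ** E) ** (K ** S ** E)" ..
  moreover have "block_on (insert k J) (K ** S ** E)"
  proof (intro block_on_mult)
    show "block_on (insert k J) K"
      using K(2) by (rule block_on_mono) auto
    show "block_on (insert k J) S" 
      by (auto simp: block_on_def S_def e_def mat_def axis_one_nth)
    show "block_on (insert k J) E" 
      using \<gamma> by (auto simp: block_on_def E_def e_def mat_def axis_one_nth supported_def)
  qed
  moreover have "lborel_jacobian (insert k J) (K ** S ** E)"
    unfolding S_def E_def e_def
    by (intro lborel_jacobian_mult lborel_jacobian_diag_scale lborel_jacobian_shear K s insert.hyps \<gamma>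
      block_on_axis(1)[OF K(2)])
  moreover have "lborel_jacobian (insert k J) (transpose (K ** S ** E))"
  proof -
    have "transpose (K ** S ** E) = transpose E ** (S ** transpose K)"
      by (simp add: matrix_transpose_mul tS matrix_mul_assoc)
    \<comment> \<open>The scaling has to stand to the right of \<open>transpose K\<close> for
      \<open>lborel_jacobian_diag_scale\<close> to apply.\<close>
    also have "S ** transpose K = transpose K ** S"
      unfolding S_def e_def
      using diag_scale_commute[OF block_on_transpose[OF K(2)] insert.hyps(2)]
        diag_scale_factor[OF block_on_axis(1)[OF block_on_transpose[OF K(2)] insert.hyps(2)]]
      by simp
    finally show ?thesis
      unfolding S_def E_def e_def
      by (simp only:) (intro lborel_jacobian_mult lborel_jacobian_diag_scale lborel_jacobian_shear K s insert.hyps \<gamma>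
        block_on_axis(2)[OF K(2)])
  qed
  ultimately show ?case by blast
qed

lemma det_pos_def: "0 < det C" if C: "pos_def C" for C :: "real^'m^'m"
proof -
  have "block_on UNIV C"
    by (simp add: block_on_def)
  then obtain K :: "real^'m^'m" where "C = transpose K ** K"
    using pos_def_factorization C by blast
  then have "det C = det K * det K"
    by (simp add: det_mul det_transpose)
  moreover have "det C \<noteq> 0"
    using pos_def_invertible[OF C] by (simp add: invertible_det_nz)
  ultimately show ?thesis
    by (metis mult_eq_0_iff not_real_square_gt_zero)
qed

text \<open>Both factors of \<open>C = transpose K ** K\<close> have the Jacobian property, and
  \<open>0 < det C\<close> removes the absolute value.\<close>

lemma nn_integral_vec_subst:
  assumes "block_on J C" "pos_def C" "h \<in> borel_measurable borel"
  shows "(\<integral>\<^sup>+ v. h v \<partial>vec_lborel J) = ennreal (det C) * (\<integral>\<^sup>+ v. h (C *v v) \<partial>vec_lborel J)"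
proof -
  obtain K where "C = transpose K ** K" "lborel_jacobian J K" "lborel_jacobian J (transpose K)"
    using pos_def_factorization[OF assms(1,2)] by auto
  then have "lborel_jacobian J C"
    using lborel_jacobian_mult by blast
  then show ?thesis
    using assms(3) det_pos_def[OF assms(2)] by (auto simp: lborel_jacobian_def)
qed

section \<open>The Wishart kernel in Schur coordinates\<close>

text \<open>The basis vector of the symmetric matrices that belongs to one unordered pair; diagonal
  entries correspond to singletons, as \<open>{i, i} = {i}\<close>.\<close>

definition edge_matrix :: "'m set \<Rightarrow> real^'m^'m" where
  "edge_matrix e = (\<chi> i j. if {i, j} = e then 1 else 0)"

definition pairs_on :: "'m set \<Rightarrow> 'm set set" where
  "pairs_on J = (\<lambda>(i, j). {i, j}) ` (J \<times> J)"

text \<open>The offset is zero on the block and the identity outside it, so the measure is carried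
  by symmetric matrices with \<open>block_on J\<close>.\<close>

definition sym_lborel_on :: "'m set \<Rightarrow> (real^'m^'m) measure" where
  "sym_lborel_on J = distr (coord_lborel (pairs_on J) edge_matrix) borel (\<lambda>v. restrict_id J 0 + v)"

lemma sets_sym_lborel_on [measurable_cong, simp]: "sets (sym_lborel_on J) = sets borel"
  by (simp add: sym_lborel_on_def)

lemma space_sym_lborel_on [simp]: "space (sym_lborel_on J) = UNIV"
  by (simp add: sym_lborel_on_def)

lemma finite_pairs_on [simp]: "finite (pairs_on J)" for J :: "'m::finite set"
  by (simp add: pairs_on_def)

lemma sym_lborel_eq: "sym_lborel = sym_lborel_on (UNIV :: 'm::finite set)"
proof -
  have "(\<Sum>e\<in>pairs_on UNIV. x e *\<^sub>R edge_matrix e) = (\<chi> i j. x {i, j})" for x :: "'m set \<Rightarrow> real"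
  proof -
    have "(\<Sum>e\<in>pairs_on (UNIV :: 'm set). x e * (if {i, j} = e then 1 else 0)) = x {i, j}" for i j :: 'm
    proof -
      have "{i, j} \<in> pairs_on (UNIV :: 'm set)"
        by (auto simp: pairs_on_def)
      then show ?thesis
        by (simp add: if_distrib[of "\<lambda>z. _ * z"] cong: if_cong)
    qed
    then show ?thesis
      by (simp add: vec_eq_iff edge_matrix_def)
  qed
  moreover have "restrict_id (UNIV :: 'm set) 0 = 0"
    by (simp add: restrict_id_def vec_eq_iff)
  moreover have "sym_lborel_on (UNIV :: 'm set) = distr (\<Pi>\<^sub>M e\<in>pairs_on UNIV. lborel) borel
      ((\<lambda>v. restrict_id UNIV 0 + v) \<circ> (\<lambda>x. \<Sum>e\<in>pairs_on UNIV. x e *\<^sub>R edge_matrix e))"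
    unfolding sym_lborel_on_def coord_lborel_def by (rule distr_distr) measurable
  ultimately show ?thesis
    by (simp add: sym_lborel_def comp_def pairs_on_def)
qed

lemma nn_integral_sym:
  assumes [measurable]: "h \<in> borel_measurable borel"
  shows "(\<integral>\<^sup>+ X. h X \<partial>sym_lborel_on J) = (\<integral>\<^sup>+ v. h (restrict_id J 0 + v) \<partial>coord_lborel (pairs_on J) edge_matrix)"
  unfolding sym_lborel_on_def by (subst nn_integral_distr) auto

text \<open>Each generator \<open>edge_matrix e\<close> with \<open>e\<close> in
  \<open>pairs_on J\<close> is symmetric and vanishes outside the block. Through this rule facts
  about blocks enter the integrals.\<close>

lemma nn_integral_sym_cong:
  fixes f g :: "real^'m^'m \<Rightarrow> ennreal"
  assumes [measurable]: "f \<in> borel_measurable borel" "g \<in> borel_measurable borel"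
    and eq: "\<And>C. block_on J C \<Longrightarrow> transpose C = C \<Longrightarrow> f C = g C"
  shows "(\<integral>\<^sup>+ C. f C \<partial>sym_lborel_on J) = (\<integral>\<^sup>+ C. g C \<partial>sym_lborel_on J)"
proof -
  have "(\<forall>i j. v $ i $ j = v $ j $ i) \<and> (\<forall>i j. i \<notin> J \<or> j \<notin> J \<longrightarrow> v $ i $ j = 0)"
    if "v \<in> span (edge_matrix ` pairs_on J)" for v :: "real^'m^'m"
    using that
    by (induction rule: span_induct_alt)
      (auto simp: edge_matrix_def pairs_on_def doubleton_eq_iff insert_commute split: if_splits)
  then show ?thesis
    unfolding nn_integral_sym[OF assms(1)] nn_integral_sym[OF assms(2)]
    by (intro nn_integral_coord_cong eq)
      (auto simp: block_on_def restrict_id_def vec_eq_iff transpose_def)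
qed

lemma measurable_nn_integral_sym [measurable (raw)]:
  assumes [measurable]: "case_prod f \<in> borel_measurable (N \<Otimes>\<^sub>M borel)"
  shows "(\<lambda>x. \<integral>\<^sup>+ v. f x v \<partial>sym_lborel_on J) \<in> borel_measurable N"
proof -
  have "(\<lambda>x. \<integral>\<^sup>+ v. f x (restrict_id J 0 + v) \<partial>coord_lborel (pairs_on J) edge_matrix) \<in> borel_measurable N"
    by measurable
  moreover have "(\<integral>\<^sup>+ v. f x v \<partial>sym_lborel_on J) = (\<integral>\<^sup>+ v. f x (restrict_id J 0 + v) \<partial>coord_lborel (pairs_on J) edge_matrix)"
    if "x \<in> space N" for x
    by (rule nn_integral_sym) (use that in measurable)
  ultimately show ?thesis
    by (simp cong: measurable_cong)
qed

lemma borel_measurable_border [measurable (raw)]: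
  assumes [measurable]: "C \<in> borel_measurable M" "u \<in> borel_measurable M" "b \<in> borel_measurable M"
  shows "(\<lambda>x. border k (C x) (u x) (b x)) \<in> borel_measurable M"
  unfolding border_def by measurable

lemma borel_measurable_schur_border [measurable (raw)]:
  assumes [measurable]: "C \<in> borel_measurable M" "u \<in> borel_measurable M" "b \<in> borel_measurable M"
  shows "(\<lambda>x. schur_border k (C x) (u x) (b x)) \<in> borel_measurable M"
  unfolding schur_border_def by measurable

lemma coord_lborel_cong:
  assumes "\<And>i. i \<in> I \<Longrightarrow> b i = b' i"
  shows "coord_lborel I b = coord_lborel I b'"
  using assms by (simp add: coord_lborel_def)

lemma pairs_on_insert: "pairs_on (insert k J) = pairs_on J \<union> insert {k} ((\<lambda>j. {k, j}) ` J)"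
  by (auto simp: pairs_on_def)

text \<open>The unordered pairs in \<open>insert k J\<close> are those inside \<open>J\<close>,
  those joining \<open>k\<close> to \<open>J\<close>, and \<open>{k}\<close>; they are the
  coordinates of \<open>C\<close>, \<open>u\<close> and \<open>b\<close>.\<close>

lemma nn_integral_sym_insert:
  assumes "k \<notin> J" and [measurable]: "h \<in> borel_measurable borel"
  shows "(\<integral>\<^sup>+ X. h X \<partial>sym_lborel_on (insert k J)) =
    (\<integral>\<^sup>+ C. \<integral>\<^sup>+ u. \<integral>\<^sup>+ b. h (border k C u b) \<partial>lborel \<partial>vec_lborel J \<partial>sym_lborel_on J)"
proof -
  let ?e = "axis k 1 :: real^'a"
  let ?E = "(\<lambda>j. {k, j}) ` J"
  let ?P = "restrict_id (insert k J) 0 :: real^'a^'a"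
  let ?L = "\<lambda>u. outer u ?e + outer ?e u"
  have L: "linear ?L"
    by (auto intro!: linearI simp: outer_add_left outer_add_right outer_scale_left outer_scale_right scaleR_add_right)
  have [simp]: "finite J" by simp
  have disj: "pairs_on J \<inter> insert {k} ?E = {}" "{k} \<notin> ?E"
    using assms(1) by (auto simp: pairs_on_def doubleton_eq_iff)
  have inj: "inj_on (\<lambda>j. {k, j}) J"
    by (auto simp: inj_on_def doubleton_eq_iff)
  \<comment> \<open>When \<open>k\<close> joins the block, the offset loses its entry 1 at
    \<open>(k, k)\<close>; this is the origin of \<open>b - 1\<close> in
    \<open>border\<close>.\<close>
  have P: "?P = restrict_id J 0 - outer ?e ?e"
    using assms(1) by (auto simp: vec_eq_iff restrict_id_def axis_one_nth)
  have ek: "edge_matrix {k} = outer ?e ?e"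
    by (auto simp: vec_eq_iff edge_matrix_def axis_one_nth doubleton_eq_iff)
  \<comment> \<open>Here \<open>j \<noteq> k\<close> matters: at \<open>j = k\<close> the
    symmetrised dyad would count the diagonal entry twice.\<close>
  have ekj: "(edge_matrix \<circ> (\<lambda>j. {k, j})) j = (?L \<circ> (\<lambda>j. axis j 1)) j" if "j \<in> J" for j
    using that assms(1) by (auto simp: vec_eq_iff edge_matrix_def axis_one_nth doubleton_eq_iff)
  have "(\<integral>\<^sup>+ X. h X \<partial>sym_lborel_on (insert k J)) =
     (\<integral>\<^sup>+ v. \<integral>\<^sup>+ w. h (?P + (v + w)) \<partial>coord_lborel (insert {k} ?E) edge_matrix \<partial>coord_lborel (pairs_on J) edge_matrix)"
    unfolding nn_integral_sym[OF assms(2)]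
    by (subst pairs_on_insert, subst nn_integral_coord_union) (use disj in auto)
  also have "\<dots> = (\<integral>\<^sup>+ v. \<integral>\<^sup>+ u. \<integral>\<^sup>+ b. h (border k (restrict_id J 0 + v) u b) \<partial>lborel \<partial>vec_lborel J
      \<partial>coord_lborel (pairs_on J) edge_matrix)"
  proof (rule nn_integral_cong)
    fix v :: "real^'a^'a"
    have "(\<integral>\<^sup>+ w. h (?P + (v + w)) \<partial>coord_lborel (insert {k} ?E) edge_matrix) =
      (\<integral>\<^sup>+ w. \<integral>\<^sup>+ b. h (?P + (v + (w + b *\<^sub>R edge_matrix {k}))) \<partial>lborel \<partial>coord_lborel ?E edge_matrix)"
      by (subst nn_integral_coord_insert) (use disj in auto)
    also have "\<dots> = (\<integral>\<^sup>+ w. \<integral>\<^sup>+ b. h (?P + (v + (w + b *\<^sub>R edge_matrix {k}))) \<partial>lborel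
        \<partial>coord_lborel J (edge_matrix \<circ> (\<lambda>j. {k, j})))"
      by (subst nn_integral_coord_reindex) (use inj in auto)
    also have "coord_lborel J (edge_matrix \<circ> (\<lambda>j. {k, j})) = coord_lborel J (?L \<circ> (\<lambda>j. axis j 1))"
      by (rule coord_lborel_cong) (rule ekj)
    also have "(\<integral>\<^sup>+ w. \<integral>\<^sup>+ b. h (?P + (v + (w + b *\<^sub>R edge_matrix {k}))) \<partial>lborel
        \<partial>coord_lborel J (?L \<circ> (\<lambda>j. axis j 1))) =
      (\<integral>\<^sup>+ u. \<integral>\<^sup>+ b. h (?P + (v + (?L u + b *\<^sub>R edge_matrix {k}))) \<partial>lborel \<partial>vec_lborel J)"
      by (rule nn_integral_coord_linear[symmetric, OF _ L]) auto
    also have "\<dots> = (\<integral>\<^sup>+ u. \<integral>\<^sup>+ b. h (border k (restrict_id J 0 + v) u b) \<partial>lborel \<partial>vec_lborel J)"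
    proof -
      have "?P + (v + (?L u + b *\<^sub>R edge_matrix {k})) = border k (restrict_id J 0 + v) u b" for u b
        by (simp add: P ek border_def algebra_simps)
      then show ?thesis by simp
    qed
    finally show "(\<integral>\<^sup>+ w. h (?P + (v + w)) \<partial>coord_lborel (insert {k} ?E) edge_matrix) =
      (\<integral>\<^sup>+ u. \<integral>\<^sup>+ b. h (border k (restrict_id J 0 + v) u b) \<partial>lborel \<partial>vec_lborel J)" .
  qed
  also have "\<dots> = (\<integral>\<^sup>+ C. \<integral>\<^sup>+ u. \<integral>\<^sup>+ b. h (border k C u b) \<partial>lborel \<partial>vec_lborel J \<partial>sym_lborel_on J)"
    by (subst nn_integral_sym) auto
  finally show ?thesis .
qed

text \<open>Compactness of the unit sphere makes positivity uniform, which exhibits the positive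
  definite matrices as a countable union of closed sets and hence as a Borel set.\<close>

lemma pos_def_iff_bounded_below:
  "pos_def A \<longleftrightarrow> transpose A = A \<and> (\<exists>n. \<forall>x. norm x = 1 \<longrightarrow> 1 / Suc n \<le> x \<bullet> (A *v x))"
  for A :: "real^'m^'m"
proof (intro iffI conjI)
  assume A: "pos_def A"
  then show "transpose A = A"
    by (rule pos_def_sym)
  have "compact (sphere (0 :: real^'m) 1)" "sphere (0 :: real^'m) 1 \<noteq> {}"
    by auto
  moreover have "continuous_on (sphere 0 1) (\<lambda>x. x \<bullet> (A *v x))"
    by (intro continuous_intros linear_continuous_on)
      (simp add: linear_conv_bounded_linear[symmetric])
  ultimately obtain x0 where x0: "x0 \<in> sphere 0 1" "\<And>x. x \<in> sphere 0 1 \<Longrightarrow> x0 \<bullet> (A *v x0) \<le> x \<bullet> (A *v x)"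
    using continuous_attains_inf[of "sphere (0 :: real^'m) 1" "\<lambda>x. x \<bullet> (A *v x)"] by blast
  have "0 < x0 \<bullet> (A *v x0)"
    using x0(1) by (intro pos_def_pos A) auto
  then obtain n where "1 / Suc n < x0 \<bullet> (A *v x0)"
    by (rule nat_approx_posE)
  then show "\<exists>n. \<forall>x. norm x = 1 \<longrightarrow> 1 / Suc n \<le> x \<bullet> (A *v x)"
    using x0(2) by (intro exI[of _ n]) (auto intro: order_trans[OF less_imp_le])
next
  assume *: "transpose A = A \<and> (\<exists>n. \<forall>x. norm x = 1 \<longrightarrow> 1 / Suc n \<le> x \<bullet> (A *v x))"
  then obtain n where n: "\<And>x. norm x = 1 \<Longrightarrow> 1 / Suc n \<le> x \<bullet> (A *v x)"
    by auto
  have "0 < x \<bullet> (A *v x)" if "x \<noteq> 0" for x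
  proof -
    have "1 / Suc n \<le> (x /\<^sub>R norm x) \<bullet> (A *v (x /\<^sub>R norm x))"
      using that by (intro n) simp
    moreover have "0 < 1 / real (Suc n)"
      by simp
    ultimately have "0 < (x /\<^sub>R norm x) \<bullet> (A *v (x /\<^sub>R norm x))"
      by linarith
    then show ?thesis
      using that by (simp add: matrix_vector_mult_scaleR zero_less_mult_iff)
  qed
  with * show "pos_def A"
    by (simp add: pos_def_def)
qed

lemma pred_pos_def [measurable]: "Measurable.pred borel (pos_def :: real^'m^'m \<Rightarrow> bool)"
proof -
  have cont: "continuous_on UNIV (\<lambda>A :: real^'m^'m. x \<bullet> (A *v x))" for x
    unfolding inner_vec_def matrix_vector_mult_def by (auto intro!: continuous_intros)
  have contt: "continuous_on UNIV (\<lambda>A :: real^'m^'m. transpose A)"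
    unfolding transpose_def by (auto intro!: continuous_intros)
  have "{A :: real^'m^'m. pos_def A} = {A. transpose A = A} \<inter> (\<Union>n. \<Inter>x\<in>{x. norm x = 1}. {A. 1 / Suc n \<le> x \<bullet> (A *v x)})"
    by (auto simp: pos_def_iff_bounded_below)
  moreover have "closed {A :: real^'m^'m. transpose A = A}"
    by (intro closed_Collect_eq contt continuous_on_id)
  moreover have "closed (\<Inter>x\<in>{x. norm x = 1}. {A :: real^'m^'m. 1 / Suc n \<le> x \<bullet> (A *v x)})" for n
    by (intro closed_INT ballI closed_Collect_le cont continuous_on_const)
  ultimately have "{A :: real^'m^'m. pos_def A} \<in> sets borel"
    by (auto intro!: sets.Int sets.countable_UN borel_closed)
  then show ?thesis
    by (simp add: pred_def)
qed

text \<open>Replaces the choice operator in \<open>matrix_inv\<close> by quotients of determinants,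
  from which measurability of the kernel follows.\<close>

lemma matrix_inv_cramer:
  fixes A :: "real^'m^'m"
  assumes "invertible A"
  shows "matrix_inv A = (\<chi> i j. det (\<chi> r c. if c = i then (if r = j then 1 else 0) else A $ r $ c) / det A)"
proof -
  have "matrix_inv A $ i $ j = det (\<chi> r c. if c = i then (if r = j then 1 else 0) else A $ r $ c) / det A" for i j
  proof -
    have "A *v (matrix_inv A *v axis j 1) = axis j 1"
      using assms by (simp add: matrix_vector_mul_assoc matrix_inv_right)
    moreover have "det A \<noteq> 0"
      using assms by (simp add: invertible_det_nz)
    ultimately have "matrix_inv A *v axis j 1 =
       (\<chi> k. det (\<chi> r c. if c = k then axis j 1 $ r else A $ r $ c) / det A)"
      using cramer by blast
    then have "(matrix_inv A *v axis j 1) $ i = det (\<chi> r c. if c = i then axis j 1 $ r else A $ r $ c) / det A"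
      by simp
    then show ?thesis
      unfolding matrix_axis_nth axis_one_nth .
  qed
  then show ?thesis
    by (simp add: vec_eq_iff)
qed

text \<open>The exponent is a free parameter because it drops by one with every row that is
  integrated out; in \<open>iw_kernel\<close> it is tied to the size of the matrix.\<close>

definition wishart_kernel :: "'m set \<Rightarrow> real \<Rightarrow> real^'m^'m \<Rightarrow> real^'m^'m \<Rightarrow> real" where
  "wishart_kernel J a D X =
     (if pos_def X then det X powr (- a) * exp (- trace (matrix_inv X ** restrict_zero J D) / 2) else 0)"

lemma borel_measurable_wishart_kernel [measurable]: "wishart_kernel J a D \<in> borel_measurable borel"
proof -
  have "wishart_kernel J a D X = (if pos_def X then det X powr (- a) * exp (- trace
      ((\<chi> i j. det (\<chi> r c. if c = i then (if r = j then 1 else 0) else X $ r $ c) / det X) ** restrict_zero J D) / 2) else 0)" for X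
    by (simp add: wishart_kernel_def matrix_inv_cramer[OF pos_def_invertible])
  then show ?thesis
    by (subst measurable_cong) measurable
qed

lemma wishart_kernel_nonneg [simp]: "0 \<le> wishart_kernel J a D X"
  by (simp add: wishart_kernel_def)

lemma iw_kernel_eq: "iw_kernel d D = wishart_kernel UNIV ((d + 2 * real CARD('m)) / 2) D" for D :: "real^'m^'m"
proof -
  have "restrict_zero UNIV D = D"
    by (simp add: restrict_zero_def vec_eq_iff)
  moreover have "- (d + 2 * real CARD('m)) / 2 = - ((d + 2 * real CARD('m)) / 2)"
    by (rule minus_divide_left[symmetric])
  ultimately show ?thesis
    by (simp only: fun_eq_iff iw_kernel_def wishart_kernel_def) simp
qed

text \<open>Unnormalised joint density of an inverse gamma \<open>\<theta>\<close> and, given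
  \<open>\<theta>\<close>, a Gaussian \<open>\<gamma>\<close> whose covariance is
  \<open>\<theta>\<close> times the inverse of the \<open>J\<close>-block of
  \<open>D\<close>.\<close>

definition schur_kernel :: "'m \<Rightarrow> real \<Rightarrow> real^'m^'m \<Rightarrow> real^'m \<Rightarrow> real \<Rightarrow> real" where
  "schur_kernel k a D \<gamma> \<theta> =
     (if 0 < \<theta> then \<theta> powr (- a) * exp (- ((axis k 1 - \<gamma>) \<bullet> (D *v (axis k 1 - \<gamma>))) / (2 * \<theta>)) else 0)"

lemma borel_measurable_schur_kernel [measurable (raw)]:
  assumes [measurable]: "f \<in> borel_measurable M" "g \<in> borel_measurable M"
  shows "(\<lambda>x. schur_kernel k a D (f x) (g x)) \<in> borel_measurable M"
  unfolding schur_kernel_def by measurable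

lemma schur_kernel_nonneg [simp]: "0 \<le> schur_kernel k a D \<gamma> \<theta>"
  by (simp add: schur_kernel_def)

lemma trace_mult: "trace (A ** B) = (\<Sum>i\<in>UNIV. \<Sum>j\<in>UNIV. A $ i $ j * B $ j $ i)"
  by (simp add: trace_def matrix_matrix_mult_def)

text \<open>Outside \<open>J\<close> the matrix \<open>A\<close> is the identity, so the new index
  only meets the entry \<open>A $ k $ k = 1\<close>.\<close>

lemma trace_restrict_zero_insert:
  assumes "block_on J A" "k \<notin> J"
  shows "trace (A ** restrict_zero (insert k J) D) = trace (A ** restrict_zero J D) + D $ k $ k"
proof -
  have "A $ i $ j * restrict_zero (insert k J) D $ j $ i =
      A $ i $ j * restrict_zero J D $ j $ i + (if j = k then (if i = k then D $ k $ k else 0) else 0)" for i j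
    using assms by (auto simp: block_on_def restrict_zero_def)
  then show ?thesis
    by (simp add: trace_mult sum.distrib)
qed

lemma restrict_zero_quad:
  assumes "supported J v"
  shows "v \<bullet> (restrict_zero J D *v v) = v \<bullet> (D *v v)"
proof -
  have "v $ i * (\<Sum>j\<in>UNIV. restrict_zero J D $ i $ j * v $ j) = v $ i * (\<Sum>j\<in>UNIV. D $ i $ j * v $ j)" for i
  proof (cases "i \<in> J")
    case True
    have "restrict_zero J D $ i $ j * v $ j = D $ i $ j * v $ j" for j
      using assms True by (auto simp: supported_def restrict_zero_def)
    then show ?thesis by (simp only:)
  qed (use assms in \<open>simp add: supported_def\<close>)
  then show ?thesis
    unfolding inner_vec_def matrix_vector_mult_def by (simp only: vec_lambda_beta inner_real_def)
qed

text \<open>The determinant is the product \<open>\<theta> * det C\<close>, and the inverse is a sum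
  of separated parts; the exponential turns that sum into a product.\<close>

lemma wishart_kernel_schur_border:
  assumes "block_on J C" "k \<notin> J" "supported J \<gamma>" "pos_def C"
  shows "wishart_kernel (insert k J) a D (schur_border k C \<gamma> \<theta>) =
    wishart_kernel J a D C * schur_kernel k a D \<gamma> \<theta>"
proof (cases "0 < \<theta>")
  case True
  let ?e = "axis k 1 :: real^'a"
  let ?D = "restrict_zero (insert k J) D"
  have supp: "supported (insert k J) (?e - \<gamma>)"
    using assms by (auto simp: supported_def axis_one_nth)
  have tr: "trace (outer v v ** ?D) = v \<bullet> (?D *v v)" for v
    by (simp add: outer_matrix_mul trace_outer dot_matrix_transpose[symmetric] inner_commute)
  have "trace (matrix_inv (schur_border k C \<gamma> \<theta>) ** ?D) = trace (matrix_inv C ** ?D) - trace (outer ?e ?e ** ?D)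
     + trace (outer (?e - \<gamma>) (?e - \<gamma>) ** ?D) / \<theta>"
    by (simp add: matrix_inv_schur_border[OF assms True] matrix_add_rdistrib matrix_diff_rdistrib trace_add trace_sub
       matrix_scaleR_left trace_scaleR)
  \<comment> \<open>The entry 1 of the extended inverse at \<open>(k, k)\<close> contributes
    \<open>D $ k $ k\<close>, which the subtracted dyad cancels.\<close>
  also have "trace (matrix_inv C ** ?D) = trace (matrix_inv C ** restrict_zero J D) + D $ k $ k"
    by (rule trace_restrict_zero_insert) (use assms in \<open>auto intro: block_on_inv pos_def_invertible\<close>)
  also have "trace (outer ?e ?e ** ?D) = D $ k $ k"
    by (simp add: tr inner_axis' matrix_axis_nth) (simp add: restrict_zero_def)
  also have "trace (outer (?e - \<gamma>) (?e - \<gamma>) ** ?D) = (?e - \<gamma>) \<bullet> (D *v (?e - \<gamma>))"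
    by (simp only: tr restrict_zero_quad[OF supp])
  finally have *: "trace (matrix_inv (schur_border k C \<gamma> \<theta>) ** ?D) =
     trace (matrix_inv C ** restrict_zero J D) + (?e - \<gamma>) \<bullet> (D *v (?e - \<gamma>)) / \<theta>"
    by simp
  have "pos_def (schur_border k C \<gamma> \<theta>)"
    using pos_def_schur_border_iff[OF assms] True by simp
  moreover have "det (schur_border k C \<gamma> \<theta>) powr (- a) = \<theta> powr (- a) * det C powr (- a)"
    using True det_pos_def[OF assms(4)]
    by (simp add: det_schur_border[OF assms(1-3) pos_def_sym[OF assms(4)]] powr_mult)
  moreover have "exp (- (T + Q / \<theta>) / 2) = exp (- T / 2) * exp (- Q / (2 * \<theta>))" for T Q
    using True by (simp add: exp_add[symmetric] field_simps)
  ultimately show ?thesis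
    using True assms(4)
    by (simp only: wishart_kernel_def schur_kernel_def * if_True mult_ac)
next
  case False
  then show ?thesis
    using pos_def_schur_border_iff[OF assms] by (simp add: wishart_kernel_def schur_kernel_def)
qed

text \<open>With \<open>g\<close> arbitrary, the identity serves to integrate a row out and, read
  backwards, to put it back.\<close>

lemma nn_integral_wishart_kernel_insert:
  assumes "k \<notin> J" and [measurable]: "g \<in> borel_measurable borel"
  shows "(\<integral>\<^sup>+ X. g X * ennreal (wishart_kernel (insert k J) a D X) \<partial>sym_lborel_on (insert k J)) =
    (\<integral>\<^sup>+ C. ennreal (wishart_kernel J (a - 1) D C) *
       (\<integral>\<^sup>+ \<gamma>. \<integral>\<^sup>+ \<theta>. g (schur_border k C \<gamma> \<theta>) * ennreal (schur_kernel k a D \<gamma> \<theta>) \<partial>lborel \<partial>vec_lborel J)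
     \<partial>sym_lborel_on J)"
proof -
  let ?\<kappa> = "wishart_kernel (insert k J) a D"
  have [simp]: "finite J" by simp
  have "(\<integral>\<^sup>+ X. g X * ennreal (?\<kappa> X) \<partial>sym_lborel_on (insert k J)) =
    (\<integral>\<^sup>+ C. \<integral>\<^sup>+ u. \<integral>\<^sup>+ b. g (border k C u b) * ennreal (?\<kappa> (border k C u b)) \<partial>lborel \<partial>vec_lborel J \<partial>sym_lborel_on J)"
    by (rule nn_integral_sym_insert) (use assms in auto)
  also have "\<dots> = (\<integral>\<^sup>+ C. ennreal (wishart_kernel J (a - 1) D C) *
       (\<integral>\<^sup>+ \<gamma>. \<integral>\<^sup>+ \<theta>. g (schur_border k C \<gamma> \<theta>) * ennreal (schur_kernel k a D \<gamma> \<theta>) \<partial>lborel \<partial>vec_lborel J)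
     \<partial>sym_lborel_on J)"
  proof (rule nn_integral_sym_cong)
    fix C :: "real^'a^'a" assume C: "block_on J C" "transpose C = C"
    show "(\<integral>\<^sup>+ u. \<integral>\<^sup>+ b. g (border k C u b) * ennreal (?\<kappa> (border k C u b)) \<partial>lborel \<partial>vec_lborel J) =
       ennreal (wishart_kernel J (a - 1) D C) *
       (\<integral>\<^sup>+ \<gamma>. \<integral>\<^sup>+ \<theta>. g (schur_border k C \<gamma> \<theta>) * ennreal (schur_kernel k a D \<gamma> \<theta>) \<partial>lborel \<partial>vec_lborel J)"
    proof (cases "pos_def C")
      case False
      \<comment> \<open>A positive definite border forces \<open>C\<close> to be positive definite,
        so here both sides vanish.\<close>
      have "(\<integral>\<^sup>+ u. \<integral>\<^sup>+ b. g (border k C u b) * ennreal (?\<kappa> (border k C u b)) \<partial>lborel \<partial>vec_lborel J) =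
         (\<integral>\<^sup>+ u. 0 \<partial>vec_lborel J)"
      proof (rule nn_integral_vec_cong)
        fix u :: "real^'a" assume "supported J u"
        then have "?\<kappa> (border k C u b) = 0" for b
          using pos_def_border_imp[OF C(1) assms(1)] False by (auto simp: wishart_kernel_def)
        then show "(\<integral>\<^sup>+ b. g (border k C u b) * ennreal (?\<kappa> (border k C u b)) \<partial>lborel) = 0"
          by simp
      qed auto
      then show ?thesis
        using False by (simp add: wishart_kernel_def)
    next
      case True
      have "(\<integral>\<^sup>+ u. \<integral>\<^sup>+ b. g (border k C u b) * ennreal (?\<kappa> (border k C u b)) \<partial>lborel \<partial>vec_lborel J) =
        ennreal (det C) * (\<integral>\<^sup>+ \<gamma>. \<integral>\<^sup>+ b. g (border k C (C *v \<gamma>) b) * ennreal (?\<kappa> (border k C (C *v \<gamma>) b)) \<partial>lborel \<partial>vec_lborel J)"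
        by (rule nn_integral_vec_subst[OF C(1) True]) measurable
      also have "(\<integral>\<^sup>+ \<gamma>. \<integral>\<^sup>+ b. g (border k C (C *v \<gamma>) b) * ennreal (?\<kappa> (border k C (C *v \<gamma>) b)) \<partial>lborel \<partial>vec_lborel J) =
        (\<integral>\<^sup>+ \<gamma>. ennreal (wishart_kernel J a D C) *
           (\<integral>\<^sup>+ \<theta>. g (schur_border k C \<gamma> \<theta>) * ennreal (schur_kernel k a D \<gamma> \<theta>) \<partial>lborel) \<partial>vec_lborel J)"
      proof (rule nn_integral_vec_cong)
        fix \<gamma> :: "real^'a" assume \<gamma>: "supported J \<gamma>"
        have "(\<integral>\<^sup>+ b. g (border k C (C *v \<gamma>) b) * ennreal (?\<kappa> (border k C (C *v \<gamma>) b)) \<partial>lborel) =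
          (\<integral>\<^sup>+ \<theta>. g (schur_border k C \<gamma> \<theta>) * ennreal (?\<kappa> (schur_border k C \<gamma> \<theta>)) \<partial>lborel)"
          unfolding schur_border_def
          by (rule nn_integral_lborel_translate[symmetric]) measurable
        also have "\<dots> = (\<integral>\<^sup>+ \<theta>. ennreal (wishart_kernel J a D C) *
            (g (schur_border k C \<gamma> \<theta>) * ennreal (schur_kernel k a D \<gamma> \<theta>)) \<partial>lborel)"
          by (simp add: wishart_kernel_schur_border[OF C(1) assms(1) \<gamma> True] ennreal_mult mult_ac)
        also have "\<dots> = ennreal (wishart_kernel J a D C) *
            (\<integral>\<^sup>+ \<theta>. g (schur_border k C \<gamma> \<theta>) * ennreal (schur_kernel k a D \<gamma> \<theta>) \<partial>lborel)"
          by (rule nn_integral_cmult) measurable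
        finally show "(\<integral>\<^sup>+ b. g (border k C (C *v \<gamma>) b) * ennreal (?\<kappa> (border k C (C *v \<gamma>) b)) \<partial>lborel) = \<dots>" .
      qed measurable
      also have "\<dots> = ennreal (wishart_kernel J a D C) *
           (\<integral>\<^sup>+ \<gamma>. \<integral>\<^sup>+ \<theta>. g (schur_border k C \<gamma> \<theta>) * ennreal (schur_kernel k a D \<gamma> \<theta>) \<partial>lborel \<partial>vec_lborel J)"
        by (rule nn_integral_cmult) measurable
      also have "ennreal (det C) * \<dots> = ennreal (wishart_kernel J (a - 1) D C) * 
           (\<integral>\<^sup>+ \<gamma>. \<integral>\<^sup>+ \<theta>. g (schur_border k C \<gamma> \<theta>) * ennreal (schur_kernel k a D \<gamma> \<theta>) \<partial>lborel \<partial>vec_lborel J)"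
      proof -
        \<comment> \<open>The Jacobian of \<open>u = C *v \<gamma>\<close> is absorbed by lowering
          the exponent by one.\<close>
        have "det C * det C powr (- a) = det C powr (1 - a)"
          using det_pos_def[OF True] by (simp add: powr_mult_base)
        then have "det C * wishart_kernel J a D C = wishart_kernel J (a - 1) D C"
          using True by (simp add: wishart_kernel_def mult.assoc[symmetric])
        then show ?thesis
          using det_pos_def[OF True] by (simp add: ennreal_mult[symmetric] mult.assoc[symmetric])
      qed
      finally show ?thesis .
    qed
  qed measurable
  finally show ?thesis .
qed

lemma restrict_id_schur_border:
  assumes "k \<notin> J"
  shows "restrict_id J (schur_border k C \<gamma> \<theta>) = restrict_id J C"
  using assms by (auto simp: vec_eq_iff restrict_id_def schur_border_def border_def axis_one_nth)

lemma restrict_id_block: "block_on J C \<Longrightarrow> restrict_id J C = C"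
  by (auto simp: vec_eq_iff restrict_id_def block_on_def)

lemma borel_measurable_restrict_id [measurable (raw)]:
  assumes [measurable]: "f \<in> borel_measurable M"
  shows "(\<lambda>x. restrict_id J (f x)) \<in> borel_measurable M"
  unfolding restrict_id_def by measurable

text \<open>The constant collects the masses of the integrated rows. It is chosen before
  \<open>G\<close>, so it is common to any two integrands, and its value is irrelevant, be it zero
  or infinite.\<close>

lemma wishart_kernel_marginal:
  fixes J R :: "'m::finite set"
  assumes "J \<inter> R = {}"
  shows "\<exists>c. \<forall>G\<in>borel_measurable borel.
    (\<integral>\<^sup>+ X. G (restrict_id J X) * ennreal (wishart_kernel (J \<union> R) a D X) \<partial>sym_lborel_on (J \<union> R)) =
    c * (\<integral>\<^sup>+ C. G C * ennreal (wishart_kernel J (a - card R) D C) \<partial>sym_lborel_on J)"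
  using finite[of R] assms
proof (induction R arbitrary: a rule: finite_induct)
  case empty
  show ?case
  proof (intro exI[of _ 1] ballI)
    fix G :: "real^'m^'m \<Rightarrow> ennreal" assume [measurable]: "G \<in> borel_measurable borel"
    have "(\<integral>\<^sup>+ X. G (restrict_id J X) * ennreal (wishart_kernel J a D X) \<partial>sym_lborel_on J) =
      (\<integral>\<^sup>+ C. G C * ennreal (wishart_kernel J a D C) \<partial>sym_lborel_on J)"
      by (rule nn_integral_sym_cong) (auto simp: restrict_id_block)
    then show "(\<integral>\<^sup>+ X. G (restrict_id J X) * ennreal (wishart_kernel (J \<union> {}) a D X) \<partial>sym_lborel_on (J \<union> {})) =
      1 * (\<integral>\<^sup>+ C. G C * ennreal (wishart_kernel J (a - card {}) D C) \<partial>sym_lborel_on J)"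
      by simp
  qed
next
  case (insert k R)
  then have "J \<inter> R = {}"
    by auto
  from insert.IH[OF this, of "a - 1"] obtain c where c: "\<And>G. G \<in> borel_measurable borel \<Longrightarrow>
    (\<integral>\<^sup>+ X. G (restrict_id J X) * ennreal (wishart_kernel (J \<union> R) (a - 1) D X) \<partial>sym_lborel_on (J \<union> R)) =
    c * (\<integral>\<^sup>+ C. G C * ennreal (wishart_kernel J (a - 1 - card R) D C) \<partial>sym_lborel_on J)"
    by blast
  have k: "k \<notin> J" "k \<notin> J \<union> R"
    using insert by auto
  \<comment> \<open>The mass of the new row depends neither on \<open>C\<close> nor on
    \<open>G\<close>.\<close>
  define z where "z = (\<integral>\<^sup>+ \<gamma>. \<integral>\<^sup>+ \<theta>. ennreal (schur_kernel k a D \<gamma> \<theta>) \<partial>lborel \<partial>vec_lborel (J \<union> R))"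
  show ?case
  proof (intro exI[of _ "z * c"] ballI)
    fix G :: "real^'m^'m \<Rightarrow> ennreal" assume [measurable]: "G \<in> borel_measurable borel"
    have "(\<integral>\<^sup>+ X. G (restrict_id J X) * ennreal (wishart_kernel (J \<union> insert k R) a D X) \<partial>sym_lborel_on (J \<union> insert k R)) =
       (\<integral>\<^sup>+ C. ennreal (wishart_kernel (J \<union> R) (a - 1) D C) * (\<integral>\<^sup>+ \<gamma>. \<integral>\<^sup>+ \<theta>.
          G (restrict_id J (schur_border k C \<gamma> \<theta>)) * ennreal (schur_kernel k a D \<gamma> \<theta>) \<partial>lborel \<partial>vec_lborel (J \<union> R))
        \<partial>sym_lborel_on (J \<union> R))"
      using nn_integral_wishart_kernel_insert[OF k(2), of "\<lambda>X. G (restrict_id J X)" a D] by simp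
    also have "\<dots> = (\<integral>\<^sup>+ C. z * (G (restrict_id J C) * ennreal (wishart_kernel (J \<union> R) (a - 1) D C)) \<partial>sym_lborel_on (J \<union> R))"
      by (simp add: restrict_id_schur_border[OF k(1)] nn_integral_cmult z_def mult_ac)
    also have "\<dots> = z * (\<integral>\<^sup>+ C. G (restrict_id J C) * ennreal (wishart_kernel (J \<union> R) (a - 1) D C) \<partial>sym_lborel_on (J \<union> R))"
      by (rule nn_integral_cmult) measurable
    also have "\<dots> = z * c * (\<integral>\<^sup>+ C. G C * ennreal (wishart_kernel J (a - card (insert k R)) D C) \<partial>sym_lborel_on J)"
      using insert.hyps by (simp add: c mult.assoc diff_diff_eq add.commute)
    finally show "(\<integral>\<^sup>+ X. G (restrict_id J X) * ennreal (wishart_kernel (J \<union> insert k R) a D X) \<partial>sym_lborel_on (J \<union> insert k R)) =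
       z * c * (\<integral>\<^sup>+ C. G C * ennreal (wishart_kernel J (a - card (insert k R)) D C) \<partial>sym_lborel_on J)" .
  qed
qed

section \<open>Gaussian and inverse gamma moments\<close>

text \<open>Terms odd in \<open>t\<close> have no sign and cannot be split off in
  \<open>ennreal\<close>; averaging over the reflection removes them inside the integrand.\<close>

lemma nn_integral_lborel_symmetrize:
  fixes f :: "real \<Rightarrow> ennreal"
  assumes [measurable]: "f \<in> borel_measurable borel" "g \<in> borel_measurable borel"
    and "\<And>t. f t + f (- t) = 2 * g t"
  shows "(\<integral>\<^sup>+ t. f t \<partial>lborel) = (\<integral>\<^sup>+ t. g t \<partial>lborel)"
proof -
  have "2 * (\<integral>\<^sup>+ t. f t \<partial>lborel) = (\<integral>\<^sup>+ t. f t \<partial>lborel) + (\<integral>\<^sup>+ t. f (- t) \<partial>lborel)"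
    using nn_integral_real_affine[of f "-1" 0] by (simp add: mult_2)
  also have "\<dots> = 2 * (\<integral>\<^sup>+ t. g t \<partial>lborel)"
    by (simp add: nn_integral_add[symmetric] assms(3) nn_integral_cmult)
  finally show ?thesis
    by (simp add: ennreal_mult_cancel_left)
qed

lemma nn_integral_vec_symmetrize:
  fixes f :: "real^'m \<Rightarrow> ennreal"
  assumes [measurable]: "f \<in> borel_measurable borel" "g \<in> borel_measurable borel"
    and "\<And>v. supported J v \<Longrightarrow> f v + f (- v) = 2 * g v"
  shows "(\<integral>\<^sup>+ v. f v \<partial>vec_lborel J) = (\<integral>\<^sup>+ v. g v \<partial>vec_lborel J)"
proof -
  have "2 * (\<integral>\<^sup>+ v. f v \<partial>vec_lborel J) = (\<integral>\<^sup>+ v. f v \<partial>vec_lborel J) + (\<integral>\<^sup>+ v. f (- v) \<partial>vec_lborel J)"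
    using nn_integral_coord_scale[of J "-1" f "\<lambda>j. axis j 1"] by (simp add: mult_2)
  also have "\<dots> = (\<integral>\<^sup>+ v. f v + f (- v) \<partial>vec_lborel J)"
    by (simp add: nn_integral_add)
  also have "\<dots> = (\<integral>\<^sup>+ v. 2 * g v \<partial>vec_lborel J)"
    by (rule nn_integral_vec_cong) (use assms in auto)
  also have "\<dots> = 2 * (\<integral>\<^sup>+ v. g v \<partial>vec_lborel J)"
    by (simp add: nn_integral_cmult)
  finally show ?thesis
    by (simp add: ennreal_mult_cancel_left)
qed

lemma gaussian_second_moment:
  "(\<integral>\<^sup>+ t. ennreal (t\<^sup>2 * exp (- t\<^sup>2 / 2)) \<partial>lborel) = (\<integral>\<^sup>+ t. ennreal (exp (- t\<^sup>2 / 2)) \<partial>lborel)"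
proof -
  have *: "(\<integral>\<^sup>+ t. ennreal (std_normal_density t * t ^ (2 * k)) \<partial>lborel) = 1" if "k \<le> 1" for k
  proof -
    \<comment> \<open>The even moments of orders 0 and 2 of the standard normal law are both
      1.\<close>
    have "fact (2 * k) / (2^k * fact k) = (1 :: real)"
      using that by (cases k) auto
    then have "has_bochner_integral lborel (\<lambda>t. std_normal_density t * t ^ (2 * k)) 1"
      using std_normal_moment_even[of k] by simp
    then show ?thesis
      by (subst nn_integral_eq_integral)
        (auto simp: has_bochner_integral_iff power_mult zero_le_even_power)
  qed
  have eq: "ennreal (x * exp (- t\<^sup>2 / 2)) = ennreal (sqrt (2 * pi)) * ennreal (std_normal_density t * x)" if "0 \<le> x" for x t
    using that by (simp add: std_normal_density_def ennreal_mult[symmetric])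
  have "(\<integral>\<^sup>+ t. ennreal (t\<^sup>2 * exp (- t\<^sup>2 / 2)) \<partial>lborel) =
      (\<integral>\<^sup>+ t. ennreal (sqrt (2 * pi)) * ennreal (std_normal_density t * t\<^sup>2) \<partial>lborel)"
    by (intro nn_integral_cong eq) simp
  also have "\<dots> = ennreal (sqrt (2 * pi)) * 1"
    using *[of 1] by (simp add: nn_integral_cmult)
  finally have "(\<integral>\<^sup>+ t. ennreal (t\<^sup>2 * exp (- t\<^sup>2 / 2)) \<partial>lborel) = ennreal (sqrt (2 * pi)) * 1" .
  moreover have "(\<integral>\<^sup>+ t. ennreal (exp (- t\<^sup>2 / 2)) \<partial>lborel) =
      (\<integral>\<^sup>+ t. ennreal (sqrt (2 * pi)) * ennreal (std_normal_density t) \<partial>lborel)"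
    using eq[of 1] by (intro nn_integral_cong) simp
  moreover have "(\<integral>\<^sup>+ t. ennreal (sqrt (2 * pi)) * ennreal (std_normal_density t) \<partial>lborel) = ennreal (sqrt (2 * pi)) * 1"
    using *[of 0] by (simp add: nn_integral_cmult)
  ultimately show ?thesis by simp
qed

text \<open>One coordinate at a time: the part linear in the new coordinate is odd and cancels, and
  its square contributes \<open>B $ k $ k\<close> by \<open>gaussian_second_moment\<close>.\<close>

lemma gaussian_quadratic_moment:
  fixes B :: "real^'m^'m"
  assumes "\<And>z. supported J z \<Longrightarrow> 0 \<le> z \<bullet> (B *v z)"
  shows "(\<integral>\<^sup>+ z. ennreal (z \<bullet> (B *v z) * exp (- (z \<bullet> z) / 2)) \<partial>vec_lborel J) =
    ennreal (\<Sum>i\<in>J. B $ i $ i) * (\<integral>\<^sup>+ z. ennreal (exp (- (z \<bullet> z) / 2)) \<partial>vec_lborel J)"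
  using finite[of J] assms
proof (induction J rule: finite_induct)
  case empty
  then show ?case by simp
next
  case (insert k J)
  note [simp] = insert.hyps
  let ?e = "axis k 1 :: real^'m"
  define g where "g = (\<integral>\<^sup>+ t. ennreal (exp (- t\<^sup>2 / 2)) \<partial>lborel)"
  have "supported (insert k J) w" if "supported J w" for w
    using that by (auto simp: supported_def)
  then have nonneg: "0 \<le> w \<bullet> (B *v w)" if "supported J w" for w
    using insert.prems that by blast
  have axis: "B $ i $ i = axis i 1 \<bullet> (B *v axis i 1)" for i
    by (simp add: inner_axis' matrix_axis_nth)
  have diag: "0 \<le> B $ i $ i" if "i \<in> insert k J" for i
    unfolding axis using that by (intro insert.prems) (auto simp: supported_def axis_one_nth)
  have sq: "(w + t *\<^sub>R ?e) \<bullet> (w + t *\<^sub>R ?e) = w \<bullet> w + t\<^sup>2" if "supported J w" for w t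
    using that by (simp add: algebra_simps inner_axis inner_axis' supported_def power2_eq_square inner_axis_axis)
  have quad: "(w + t *\<^sub>R ?e) \<bullet> (B *v (w + t *\<^sub>R ?e)) =
      w \<bullet> (B *v w) + t\<^sup>2 * B $ k $ k + t * (w \<bullet> (B *v ?e) + ?e \<bullet> (B *v w))" for w t
    by (simp add: axis algebra_simps power2_eq_square)
  have "(\<integral>\<^sup>+ z. ennreal (z \<bullet> (B *v z) * exp (- (z \<bullet> z) / 2)) \<partial>vec_lborel (insert k J)) =
     (\<integral>\<^sup>+ w. \<integral>\<^sup>+ t. ennreal ((w + t *\<^sub>R ?e) \<bullet> (B *v (w + t *\<^sub>R ?e)) *
         exp (- ((w + t *\<^sub>R ?e) \<bullet> (w + t *\<^sub>R ?e)) / 2)) \<partial>lborel \<partial>vec_lborel J)"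
    by (rule nn_integral_coord_insert) auto
  also have "\<dots> = (\<integral>\<^sup>+ w. ennreal (w \<bullet> (B *v w) * exp (- (w \<bullet> w) / 2)) * g
      + ennreal (B $ k $ k) * ennreal (exp (- (w \<bullet> w) / 2)) * g \<partial>vec_lborel J)"
  proof (rule nn_integral_vec_cong)
    fix w :: "real^'m" assume w: "supported J w"
    let ?E = "exp (- (w \<bullet> w) / 2)"
    have E: "exp (- ((w + t *\<^sub>R ?e) \<bullet> (w + t *\<^sub>R ?e)) / 2) = ?E * exp (- t\<^sup>2 / 2)" for t
      by (simp add: sq[OF w] exp_add[symmetric] diff_divide_distrib add_divide_distrib)
    have pos: "0 \<le> (w + t *\<^sub>R ?e) \<bullet> (B *v (w + t *\<^sub>R ?e))" for t
      by (rule insert.prems) (use w in \<open>auto simp: supported_def axis_one_nth\<close>)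
    have "(\<integral>\<^sup>+ t. ennreal ((w + t *\<^sub>R ?e) \<bullet> (B *v (w + t *\<^sub>R ?e)) *
         exp (- ((w + t *\<^sub>R ?e) \<bullet> (w + t *\<^sub>R ?e)) / 2)) \<partial>lborel) =
      (\<integral>\<^sup>+ t. ennreal (w \<bullet> (B *v w) * ?E) * ennreal (exp (- t\<^sup>2 / 2)) +
         ennreal (B $ k $ k) * ennreal ?E * ennreal (t\<^sup>2 * exp (- t\<^sup>2 / 2)) \<partial>lborel)"
    proof (rule nn_integral_lborel_symmetrize)
      fix t :: real
      let ?X = "\<lambda>t. (w + t *\<^sub>R ?e) \<bullet> (B *v (w + t *\<^sub>R ?e)) * (?E * exp (- t\<^sup>2 / 2))"
      have "ennreal (?X t) + ennreal (?X (- t)) = ennreal (?X t + ?X (- t))"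
        by (intro ennreal_plus[symmetric] mult_nonneg_nonneg pos) auto
      also have "?X t + ?X (- t) = 2 * (w \<bullet> (B *v w) * ?E * exp (- t\<^sup>2 / 2) + B $ k $ k * ?E * (t\<^sup>2 * exp (- t\<^sup>2 / 2)))"
        unfolding quad by (simp add: algebra_simps)
      also have "ennreal \<dots> = 2 * (ennreal (w \<bullet> (B *v w) * ?E) * ennreal (exp (- t\<^sup>2 / 2)) +
         ennreal (B $ k $ k) * ennreal ?E * ennreal (t\<^sup>2 * exp (- t\<^sup>2 / 2)))"
        using nonneg[OF w] diag[of k]
        by (simp add: ennreal_mult[symmetric] ennreal_plus[symmetric] ennreal_numeral[symmetric]
            del: ennreal_numeral ennreal_plus)
      finally show "ennreal ((w + t *\<^sub>R ?e) \<bullet> (B *v (w + t *\<^sub>R ?e)) * exp (- ((w + t *\<^sub>R ?e) \<bullet> (w + t *\<^sub>R ?e)) / 2)) +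
         ennreal ((w + (- t) *\<^sub>R ?e) \<bullet> (B *v (w + (- t) *\<^sub>R ?e)) * exp (- ((w + (- t) *\<^sub>R ?e) \<bullet> (w + (- t) *\<^sub>R ?e)) / 2)) =
         2 * (ennreal (w \<bullet> (B *v w) * ?E) * ennreal (exp (- t\<^sup>2 / 2)) +
           ennreal (B $ k $ k) * ennreal ?E * ennreal (t\<^sup>2 * exp (- t\<^sup>2 / 2)))"
        unfolding E .
    qed auto
    also have "\<dots> = ennreal (w \<bullet> (B *v w) * ?E) * g + ennreal (B $ k $ k) * ennreal ?E * g"
      by (simp add: nn_integral_add nn_integral_cmult gaussian_second_moment[simplified] g_def)
    finally show "(\<integral>\<^sup>+ t. ennreal ((w + t *\<^sub>R ?e) \<bullet> (B *v (w + t *\<^sub>R ?e)) *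
         exp (- ((w + t *\<^sub>R ?e) \<bullet> (w + t *\<^sub>R ?e)) / 2)) \<partial>lborel) = \<dots>" .
  qed auto
  also have "\<dots> = (\<integral>\<^sup>+ w. ennreal (w \<bullet> (B *v w) * exp (- (w \<bullet> w) / 2)) \<partial>vec_lborel J) * g
      + ennreal (B $ k $ k) * ((\<integral>\<^sup>+ w. ennreal (exp (- (w \<bullet> w) / 2)) \<partial>vec_lborel J) * g)"
    by (simp add: nn_integral_add nn_integral_cmult nn_integral_multc mult.assoc)
  also have "\<dots> = ennreal (\<Sum>i\<in>insert k J. B $ i $ i) * ((\<integral>\<^sup>+ w. ennreal (exp (- (w \<bullet> w) / 2)) \<partial>vec_lborel J) * g)"
    using insert.IH nonneg diag by (simp add: distrib_right mult.assoc sum_nonneg add.commute)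
  also have "(\<integral>\<^sup>+ w. ennreal (exp (- (w \<bullet> w) / 2)) \<partial>vec_lborel J) * g =
      (\<integral>\<^sup>+ w. \<integral>\<^sup>+ t. ennreal (exp (- (w \<bullet> w) / 2)) * ennreal (exp (- t\<^sup>2 / 2)) \<partial>lborel \<partial>vec_lborel J)"
    by (simp add: nn_integral_cmult nn_integral_multc g_def)
  also have "\<dots> = (\<integral>\<^sup>+ w. \<integral>\<^sup>+ t. ennreal (exp (- ((w + t *\<^sub>R ?e) \<bullet> (w + t *\<^sub>R ?e)) / 2)) \<partial>lborel \<partial>vec_lborel J)"
    by (rule nn_integral_vec_cong)
      (auto simp: sq ennreal_mult[symmetric] exp_add[symmetric] diff_divide_distrib add_divide_distrib)
  also have "\<dots> = (\<integral>\<^sup>+ z. ennreal (exp (- (z \<bullet> z) / 2)) \<partial>vec_lborel (insert k J))"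
    by (rule nn_integral_coord_insert[symmetric]) auto
  finally show ?case .
qed

section \<open>Quadratic forms on principal blocks\<close>

lemma restrict_quad:
  fixes D :: "real^'m^'m" and J :: "'m set"
  defines "m x \<equiv> (\<chi> i. if i \<in> J then x $ i else 0)"
  shows "x \<bullet> (restrict_zero J D *v x) = m x \<bullet> (D *v m x)"
    and "x \<bullet> (restrict_id J D *v x) = m x \<bullet> (D *v m x) + (\<Sum>i\<in>- J. (x $ i)\<^sup>2)"
proof -
  have q: "y \<bullet> (A *v y) = (\<Sum>i\<in>UNIV. \<Sum>j\<in>UNIV. y $ i * A $ i $ j * y $ j)" for y :: "real^'m" and A
    by (simp add: inner_vec_def matrix_vector_mult_def sum_distrib_left mult.assoc)
  have "x $ i * restrict_zero J D $ i $ j * x $ j = m x $ i * D $ i $ j * m x $ j" for i j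
    by (simp add: m_def restrict_zero_def)
  then show 1: "x \<bullet> (restrict_zero J D *v x) = m x \<bullet> (D *v m x)"
    unfolding q by (simp only:)
  have "x $ i * restrict_id J D $ i $ j * x $ j = m x $ i * D $ i $ j * m x $ j
      + (if j = i then (if i \<in> - J then (x $ i)\<^sup>2 else 0) else 0)" for i j
    by (auto simp: m_def restrict_id_def power2_eq_square)
  then show "x \<bullet> (restrict_id J D *v x) = m x \<bullet> (D *v m x) + (\<Sum>i\<in>- J. (x $ i)\<^sup>2)"
    unfolding q by (simp add: sum.distrib sum.If_cases Compl_eq)
qed

lemma restrict_id_quad: "supported J x \<Longrightarrow> x \<bullet> (restrict_id J D *v x) = x \<bullet> (D *v x)"
proof -
  assume x: "supported J x"
  then have "(\<chi> i. if i \<in> J then x $ i else 0) = x"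
    by (auto simp: supported_def vec_eq_iff)
  moreover have "(\<Sum>i\<in>- J. (x $ i)\<^sup>2) = 0"
    using x by (intro sum.neutral) (auto simp: supported_def)
  ultimately show ?thesis
    using restrict_quad(2)[of x J D] by simp
qed

text \<open>A nonzero vector either has a nonzero part in \<open>J\<close>, where \<open>D\<close>
  is positive, or lives outside \<open>J\<close>, where the extension is the identity.\<close>

lemma pos_def_restrict_id:
  assumes "pos_def D"
  shows "pos_def (restrict_id J D)"
  unfolding pos_def_def
proof (intro conjI allI impI)
  have "D $ i $ j = D $ j $ i" for i j
    using arg_cong[OF pos_def_sym[OF assms], of "\<lambda>A. A $ i $ j"] by (simp add: transpose_def)
  then show "transpose (restrict_id J D) = restrict_id J D"
    by (auto simp: vec_eq_iff transpose_def restrict_id_def)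
  fix x :: "real^'a" assume "x \<noteq> 0"
  let ?m = "\<chi> i. if i \<in> J then x $ i else 0"
  have s: "0 \<le> (\<Sum>i\<in>- J. (x $ i)\<^sup>2)"
    by (intro sum_nonneg) auto
  show "0 < x \<bullet> (restrict_id J D *v x)"
  proof (cases "?m = 0")
    case False
    then show ?thesis
      using pos_def_pos[OF assms False] s by (simp add: restrict_quad)
  next
    case True
    obtain i where i: "x $ i \<noteq> 0"
      using \<open>x \<noteq> 0\<close> by (auto simp: vec_eq_iff)
    have "i \<in> - J"
    proof (rule ccontr)
      assume "i \<notin> - J"
      then show False
        using arg_cong[OF True, of "\<lambda>v. v $ i"] i by simp
    qed
    then have "0 < (\<Sum>i\<in>- J. (x $ i)\<^sup>2)"
      using i by (intro sum_pos2[where i = i]) auto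
    then show ?thesis
      using True by (simp add: restrict_quad)
  qed
qed

text \<open>Whitening by \<open>z = K y\<close> with \<open>T = transpose K ** K\<close> reduces
  this to the standard Gaussian case; cyclicity of the trace turns the whitened form
  \<open>B\<close> back into \<open>C\<close> against the inverse of \<open>T\<close>.\<close>

lemma gaussian_quadratic_moment_cov:
  fixes C T :: "real^'m^'m"
  assumes "block_on J T" "pos_def T" "\<And>z. 0 \<le> z \<bullet> (C *v z)"
  shows "(\<integral>\<^sup>+ y. ennreal (y \<bullet> (C *v y) * exp (- (y \<bullet> (T *v y)) / 2)) \<partial>vec_lborel J) =
      ennreal (trace (restrict_zero J C ** matrix_inv T)) *
      (\<integral>\<^sup>+ y. ennreal (exp (- (y \<bullet> (T *v y)) / 2)) \<partial>vec_lborel J)" (is ?eq)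
    and "0 \<le> trace (restrict_zero J C ** matrix_inv T)" (is ?nonneg)
proof -
  obtain K where K: "T = transpose K ** K" "block_on J K" "lborel_jacobian J K"
    using pos_def_factorization[OF assms(1,2)] by auto
  have "det T = det K * det K"
    by (simp add: K(1) det_mul det_transpose)
  then have dK: "det K \<noteq> 0"
    using det_pos_def[OF assms(2)] by auto
  then have iK: "invertible K"
    by (simp add: invertible_det_nz)
  define L where "L = matrix_inv K"
  have L: "K ** L = mat 1" "L ** K = mat 1" "block_on J L"
    using iK K(2) by (auto simp: L_def matrix_inv_left matrix_inv_right block_on_inv)
  have "T ** (L ** transpose L) = transpose K ** (K ** L) ** transpose L"
    by (simp add: K(1) matrix_mul_assoc)
  also have "\<dots> = transpose (L ** K)"
    by (simp add: L(1) matrix_transpose_mul)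
  finally have Tinv: "matrix_inv T = L ** transpose L"
    by (intro matrix_inv_eqI) (simp add: L)
  define B where "B = transpose L ** restrict_zero J C ** L"
  have zBz: "z \<bullet> (B *v z) = (L *v z) \<bullet> (restrict_zero J C *v (L *v z))" for z
    by (simp add: B_def dot_matrix_transpose matrix_vector_mul_assoc matrix_mul_assoc)
  have zBz': "z \<bullet> (B *v z) = (L *v z) \<bullet> (C *v (L *v z))" if "supported J z" for z
    unfolding zBz by (rule restrict_zero_quad) (rule supported_mult[OF L(3) that])
  have nonneg: "0 \<le> z \<bullet> (B *v z)" for z
    unfolding zBz restrict_quad by (rule assms(3))
  have trB: "trace (restrict_zero J C ** matrix_inv T) = trace B"
  proof -
    have "trace B = trace (transpose L ** (restrict_zero J C ** L))"
      by (simp add: B_def matrix_mul_assoc)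
    also have "\<dots> = trace ((restrict_zero J C ** L) ** transpose L)"
      by (rule trace_mul_sym)
    finally show ?thesis
      by (simp add: Tinv matrix_mul_assoc)
  qed
  have Bii: "B $ i $ i = axis i 1 \<bullet> (B *v axis i 1)" for i
    by (simp add: inner_axis' matrix_axis_nth)
  \<comment> \<open>The sum over \<open>J\<close> from the standard case is then the full
    trace.\<close>
  have B0: "B $ i $ i = 0" if "i \<notin> J" for i
  proof -
    have "L *v axis i 1 = axis i 1"
      using block_on_axis(1)[OF L(3) that] .
    then have "B $ i $ i = axis i 1 \<bullet> (restrict_zero J C *v axis i 1)"
      unfolding Bii zBz by simp
    then show ?thesis
      using that by (simp add: inner_axis' matrix_axis_nth restrict_zero_def)
  qed
  have trB': "trace B = (\<Sum>i\<in>J. B $ i $ i)"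
    unfolding trace_def using B0 by (intro sum.mono_neutral_right) auto
  show ?nonneg
    unfolding trB trB' by (intro sum_nonneg) (metis Bii nonneg)
  let ?h = "\<lambda>z. ennreal ((L *v z) \<bullet> (C *v (L *v z)) * exp (- (z \<bullet> z) / 2))"
  have KK: "(K *v y) \<bullet> (K *v y) = y \<bullet> (T *v y)" for y
    by (simp add: K(1) dot_matrix_transpose matrix_vector_mul_assoc)
  have LK: "L *v (K *v y) = y" for y
    by (simp add: matrix_vector_mul_assoc L)
  have "ennreal \<bar>det K\<bar> * (\<integral>\<^sup>+ y. ennreal (y \<bullet> (C *v y) * exp (- (y \<bullet> (T *v y)) / 2)) \<partial>vec_lborel J) =
      ennreal \<bar>det K\<bar> * (\<integral>\<^sup>+ y. ?h (K *v y) \<partial>vec_lborel J)"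
    by (simp add: KK LK)
  also have "\<dots> = (\<integral>\<^sup>+ z. ?h z \<partial>vec_lborel J)"
    using K(3)[unfolded lborel_jacobian_def, rule_format, of ?h] by simp
  also have "\<dots> = (\<integral>\<^sup>+ z. ennreal (z \<bullet> (B *v z) * exp (- (z \<bullet> z) / 2)) \<partial>vec_lborel J)"
    by (rule nn_integral_vec_cong) (auto simp: zBz')
  also have "\<dots> = ennreal (trace B) * (\<integral>\<^sup>+ z. ennreal (exp (- (z \<bullet> z) / 2)) \<partial>vec_lborel J)"
    unfolding trB' by (rule gaussian_quadratic_moment) (rule nonneg)
  also have "(\<integral>\<^sup>+ z. ennreal (exp (- (z \<bullet> z) / 2)) \<partial>vec_lborel J) =
      ennreal \<bar>det K\<bar> * (\<integral>\<^sup>+ y. ennreal (exp (- (y \<bullet> (T *v y)) / 2)) \<partial>vec_lborel J)"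
    using K(3)[unfolded lborel_jacobian_def, rule_format, of "\<lambda>z. ennreal (exp (- (z \<bullet> z) / 2))"]
    by (simp add: KK)
  finally have "ennreal \<bar>det K\<bar> * (\<integral>\<^sup>+ y. ennreal (y \<bullet> (C *v y) * exp (- (y \<bullet> (T *v y)) / 2)) \<partial>vec_lborel J) =
      ennreal \<bar>det K\<bar> * (ennreal (trace B) * (\<integral>\<^sup>+ y. ennreal (exp (- (y \<bullet> (T *v y)) / 2)) \<partial>vec_lborel J))"
    by (simp add: mult_ac)
  then show ?eq
    using dK by (simp add: ennreal_mult_cancel_left trB)
qed

section \<open>Inverse gamma integrals\<close>

definition inv_gamma_integral :: "real \<Rightarrow> real \<Rightarrow> ennreal" where
  "inv_gamma_integral s c = (\<integral>\<^sup>+ \<theta>. ennreal (if 0 < \<theta> then \<theta> powr (- s) * exp (- c / \<theta>) else 0) \<partial>lborel)"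

text \<open>The fundamental theorem of calculus on \<open>(0, \<theta>)\<close>; the lower boundary
  term disappears because \<open>exp (- c / r)\<close> tends to 0 as \<open>r\<close> decreases to
  0.\<close>

lemma nn_integral_exp_inverse:
  assumes "0 < c" "0 < \<theta>"
  shows "(\<integral>\<^sup>+ r. ennreal (if 0 < r \<and> r < \<theta> then c / r\<^sup>2 * exp (- c / r) else 0) \<partial>lborel) = ennreal (exp (- c / \<theta>))"
proof -
  let ?f = "\<lambda>r. c / r\<^sup>2 * exp (- c / r)"
  have lim0: "((\<lambda>r. exp (- c / r)) \<longlongrightarrow> 0) (at_right 0)"
  proof (rule filterlim_compose[OF exp_at_bot])
    have "filterlim (\<lambda>r. (- c) * inverse r) at_bot (at_right (0::real))"
      by (rule filterlim_tendsto_neg_mult_at_bot[OF tendsto_const])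
        (use assms filterlim_inverse_at_top_right in auto)
    then show "filterlim (\<lambda>r. - c / r) at_bot (at_right (0::real))"
      by (simp add: divide_inverse)
  qed
  have lim1: "((\<lambda>r. exp (- c / r)) \<longlongrightarrow> exp (- c / \<theta>)) (at_left \<theta>)"
    using assms by (auto intro!: tendsto_intros)
  have der: "((\<lambda>r. exp (- c / r)) has_real_derivative ?f r) (at r)" if "0 < r" for r
    using that by (auto intro!: derivative_eq_intros simp: power2_eq_square)
  have ae: "AE x in lborel. (0::ereal) < ereal x \<longrightarrow> ereal x < ereal \<theta> \<longrightarrow> 0 \<le> ?f x"
    using assms by auto
  have A: "(((\<lambda>r. exp (- c / r)) \<circ> real_of_ereal) \<longlongrightarrow> 0) (at_right (0::ereal))"
    using lim0 by (simp add: ereal_tendsto_simps zero_ereal_def)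
  have B: "(((\<lambda>r. exp (- c / r)) \<circ> real_of_ereal) \<longlongrightarrow> exp (- c / \<theta>)) (at_left (ereal \<theta>))"
    using lim1 by (simp add: ereal_tendsto_simps)
  have "(0::ereal) < ereal \<theta>"
    using assms by simp
  note FTC = interval_integral_FTC_nonneg[OF this _ _ ae A B]
  have cont: "isCont ?f x" if "0 < x" for x
    using that by (auto intro!: continuous_intros)
  have 1: "set_integrable lborel (einterval 0 \<theta>) ?f"
    by (rule FTC(1)) (use der cont in auto)
  have 2: "(LBINT x=0..ereal \<theta>. ?f x) = exp (- c / \<theta>) - 0"
    by (rule FTC(2)) (use der cont in auto)
  have e: "einterval 0 \<theta> = {0<..<\<theta>}"
    by (auto simp: einterval_def)
  have ind: "(if 0 < r \<and> r < \<theta> then ?f r else 0) = indicator {0<..<\<theta>} r *\<^sub>R ?f r" for r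
    by (simp add: indicator_def)
  have int: "integrable lborel (\<lambda>r. indicator {0<..<\<theta>} r *\<^sub>R ?f r)"
    using 1 unfolding set_integrable_def e .
  have "(\<integral>r. indicator {0<..<\<theta>} r *\<^sub>R ?f r \<partial>lborel) = exp (- c / \<theta>)"
    using 2 assms unfolding interval_lebesgue_integral_def set_lebesgue_integral_def e by simp
  then show ?thesis
    unfolding ind
    by (subst nn_integral_eq_integral[OF int]) (use assms in auto)
qed

lemma nn_integral_powr_tail:
  assumes "0 < r" "1 < p"
  shows "(\<integral>\<^sup>+ \<theta>. ennreal (if r < \<theta> then \<theta> powr (- p) else 0) \<partial>lborel) = ennreal (r powr (1 - p) / (p - 1))"
proof -
  \<comment> \<open>The strict and the weak inequality differ only at the single point
    \<open>r\<close>.\<close>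
  have "(\<integral>\<^sup>+ \<theta>. ennreal (if r < \<theta> then \<theta> powr (- p) else 0) \<partial>lborel) =
      (\<integral>\<^sup>+ \<theta>. ennreal (\<theta> powr (- p)) * indicator {r..} \<theta> \<partial>lborel)"
    by (rule nn_integral_cong_AE, rule eventually_mono[OF AE_lborel_singleton[of r]])
      (auto simp: indicator_def)
  also have "\<dots> = ennreal (0 - (- (r powr (1 - p) / (p - 1))))"
  proof (rule nn_integral_FTC_atLeast)
    show "((\<lambda>x. - (x powr (1 - p) / (p - 1))) has_real_derivative x powr (- p)) (at x)" if "r \<le> x" for x
    proof -
      have "((\<lambda>x. x powr (1 - p)) has_real_derivative (1 - p) * x powr (1 - p - 1)) (at x)"
        using that assms by (intro has_real_derivative_powr) auto
      from DERIV_cdivide[OF this, of "1 - p"] show ?thesis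
        using assms by (simp add: minus_divide_right)
    qed
    have "((\<lambda>x. x powr (1 - p)) \<longlongrightarrow> 0) at_top"
      using assms by (intro tendsto_neg_powr filterlim_ident) auto
    then have "((\<lambda>x. - (x powr (1 - p) / (p - 1))) \<longlongrightarrow> - (0 / (p - 1))) at_top"
      using assms by (intro tendsto_minus tendsto_divide tendsto_const) auto
    then show "((\<lambda>x. - (x powr (1 - p) / (p - 1))) \<longlongrightarrow> 0) at_top"
      by simp
  qed auto
  finally show ?thesis by simp
qed

text \<open>Writing \<open>exp (- c / \<theta>)\<close> as the integral of its derivative and exchanging the integrals
  replaces an integration by parts, so that no integrability has to be known beforehand.\<close>

lemma inv_gamma_integral_rec:
  assumes "2 < s" "0 < c"
  shows "inv_gamma_integral (s - 1) c = ennreal (c / (s - 2)) * inv_gamma_integral s c"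
proof -
  let ?K = "\<lambda>\<theta> r. ennreal (if 0 < r \<and> r < \<theta> then c / r\<^sup>2 * exp (- c / r) else 0)"
  have "inv_gamma_integral (s - 1) c = (\<integral>\<^sup>+ \<theta>. \<integral>\<^sup>+ r. ennreal (\<theta> powr (1 - s)) * ?K \<theta> r \<partial>lborel \<partial>lborel)"
    unfolding inv_gamma_integral_def
  proof (rule nn_integral_cong)
    fix \<theta> :: real
    show "ennreal (if 0 < \<theta> then \<theta> powr - (s - 1) * exp (- c / \<theta>) else 0) =
       (\<integral>\<^sup>+ r. ennreal (\<theta> powr (1 - s)) * ?K \<theta> r \<partial>lborel)"
    proof (cases "0 < \<theta>")
      case True
      then show ?thesis
        using nn_integral_exp_inverse[OF assms(2) True] by (simp add: nn_integral_cmult ennreal_mult)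
    next
      case False
      then have "?K \<theta> r = 0" for r by auto
      with False show ?thesis by simp
    qed
  qed
  also have "\<dots> = (\<integral>\<^sup>+ r. \<integral>\<^sup>+ \<theta>. ennreal (\<theta> powr (1 - s)) * ?K \<theta> r \<partial>lborel \<partial>lborel)"
    by (rule lborel_pair.Fubini') measurable
  also have "\<dots> = (\<integral>\<^sup>+ r. ennreal (c / (s - 2)) * ennreal (if 0 < r then r powr (- s) * exp (- c / r) else 0) \<partial>lborel)"
  proof (rule nn_integral_cong)
    fix r :: real
    show "(\<integral>\<^sup>+ \<theta>. ennreal (\<theta> powr (1 - s)) * ?K \<theta> r \<partial>lborel) =
        ennreal (c / (s - 2)) * ennreal (if 0 < r then r powr (- s) * exp (- c / r) else 0)"
    proof (cases "0 < r")
      case True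
      have "(\<integral>\<^sup>+ \<theta>. ennreal (\<theta> powr (1 - s)) * ?K \<theta> r \<partial>lborel) =
         (\<integral>\<^sup>+ \<theta>. ennreal (c / r\<^sup>2 * exp (- c / r)) * ennreal (if r < \<theta> then \<theta> powr (- (s - 1)) else 0) \<partial>lborel)"
        using True assms by (intro nn_integral_cong) (auto simp: ennreal_mult[symmetric] mult_ac)
      \<comment> \<open>The tail has exponent \<open>p = s - 1\<close>, so \<open>2 < s\<close> is
        precisely the condition for its convergence.\<close>
      also have "\<dots> = ennreal (c / r\<^sup>2 * exp (- c / r)) * ennreal (r powr (2 - s) / (s - 2))"
        using nn_integral_powr_tail[of r "s - 1"] True assms
        by (subst nn_integral_cmult) (auto simp: algebra_simps)
      also have "\<dots> = ennreal (c / (s - 2)) * ennreal (r powr (- s) * exp (- c / r))"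
      proof -
        have "r powr (2 - s) = r\<^sup>2 * r powr (- s)"
          using True by (simp add: powr_add[symmetric] powr_numeral[symmetric] del: powr_numeral)
        then show ?thesis
          using True assms by (simp add: ennreal_mult[symmetric] field_simps)
      qed
      finally show ?thesis
        using True by simp
    next
      case False
      then have "?K \<theta> r = 0" for \<theta> by auto
      with False show ?thesis by simp
    qed
  qed
  also have "\<dots> = ennreal (c / (s - 2)) * inv_gamma_integral s c"
    unfolding inv_gamma_integral_def by (rule nn_integral_cmult) measurable
  finally show ?thesis .
qed

section \<open>The mean of a new diagonal entry given the block\<close>

lemma ennreal_plus_mult: "0 \<le> x \<Longrightarrow> 0 \<le> y \<Longrightarrow> 0 \<le> z \<Longrightarrow> ennreal (x + y * z) = ennreal x + ennreal y * ennreal z"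
  by (simp add: ennreal_mult)

text \<open>The last assumption is the normal equation of a regression:
  \<open>D *v (axis k 1 - f)\<close> vanishes on \<open>J\<close>, hence is orthogonal to
  \<open>x\<close>, and the cross terms drop out. Stating it this way avoids inverting the
  \<open>J\<close>-block of \<open>D\<close> to obtain \<open>f\<close>.\<close>

lemma complete_square:
  assumes "transpose D = D" "supported J f" "supported J x" "k \<notin> J"
    and "\<And>j. j \<in> J \<Longrightarrow> (D *v f) $ j = D $ j $ k"
  shows "(axis k 1 - (x + f)) \<bullet> (D *v (axis k 1 - (x + f))) =
    (axis k 1 - f) \<bullet> (D *v (axis k 1 - f)) + x \<bullet> (D *v x)"
proof -
  let ?w = "axis k 1 - f"
  have "x $ j * (D *v ?w) $ j = 0" for j
    using assms(3,5) by (cases "j \<in> J") (auto simp: supported_def algebra_simps matrix_axis_nth)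
  then have 1: "x \<bullet> (D *v ?w) = 0"
    unfolding inner_vec_def inner_real_def by (simp only: sum.neutral_const)
  then have 2: "?w \<bullet> (D *v x) = 0"
    using dot_matrix_transpose[of D ?w x] assms(1) by (simp add: inner_commute)
  have "axis k 1 - (x + f) = ?w - x"
    by simp
  then show ?thesis
    using 1 2 by (simp only: matrix_vector_mult_diff_distrib inner_diff_left inner_diff_right)
qed

context
  fixes D :: "real^'m^'m" and J :: "'m set" and k :: 'm and f :: "real^'m" and a :: real
  assumes D: "pos_def D" and k: "k \<notin> J" and f: "supported J f"
    and regression: "\<And>j. j \<in> J \<Longrightarrow> (D *v f) $ j = D $ j $ k"
begin

text \<open>By the normal equations this is the Schur complement of the \<open>J\<close>-block in
  the block of \<open>D\<close> on \<open>insert k J\<close>.\<close>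

definition "residual = (axis k 1 - f) \<bullet> (D *v (axis k 1 - f))"

definition "gaussian_mass = (\<integral>\<^sup>+ y. ennreal (exp (- (y \<bullet> (D *v y)) / 2)) \<partial>vec_lborel J)"

text \<open>The contribution of the Gaussian fluctuation of \<open>\<gamma>\<close> to the mean of
  \<open>\<gamma> \<bullet> (C *v \<gamma>)\<close>, per unit of \<open>\<theta>\<close>.\<close>

definition "trace_ratio C = trace (restrict_zero J C ** matrix_inv (restrict_id J D))"

lemma residual_pos: "0 < residual"
proof -
  have "(axis k 1 - f) $ k \<noteq> 0"
    using f k by (simp add: supported_def axis_one_nth)
  then have "axis k 1 - f \<noteq> 0"
    by auto
  then show ?thesis
    unfolding residual_def by (rule pos_def_pos[OF D])
qed

text \<open>The substitution \<open>\<gamma> = f + sqrt \<theta> *\<^sub>R y\<close> makes the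
  Gaussian weight independent of \<open>\<theta>\<close>; its Jacobian lowers the exponent from
  \<open>a\<close> to \<open>a - card J / 2\<close>.\<close>

lemma nn_integral_schur_kernel:
  assumes [measurable]: "h \<in> borel_measurable borel" and "0 < \<theta>"
  shows "(\<integral>\<^sup>+ \<gamma>. h \<gamma> * ennreal (schur_kernel k a D \<gamma> \<theta>) \<partial>vec_lborel J) =
    ennreal (\<theta> powr (- (a - card J / 2)) * exp (- (residual / 2) / \<theta>)) *
    (\<integral>\<^sup>+ y. h (f + sqrt \<theta> *\<^sub>R y) * ennreal (exp (- (y \<bullet> (D *v y)) / 2)) \<partial>vec_lborel J)"
proof -
  let ?c = "\<theta> powr (- a) * exp (- (residual / 2) / \<theta>)"
  have "f \<in> span ((\<lambda>j. axis j 1) ` J)"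
    using f by (simp add: span_axis_iff)
  then have "(\<integral>\<^sup>+ \<gamma>. h \<gamma> * ennreal (schur_kernel k a D \<gamma> \<theta>) \<partial>vec_lborel J) =
     (\<integral>\<^sup>+ x. h (x + f) * ennreal (schur_kernel k a D (x + f) \<theta>) \<partial>vec_lborel J)"
    by (intro nn_integral_coord_translate[symmetric]) auto
  also have "\<dots> = (\<integral>\<^sup>+ x. h (x + f) * ennreal (?c * exp (- (x \<bullet> (D *v x)) / (2 * \<theta>))) \<partial>vec_lborel J)"
  proof (rule nn_integral_vec_cong)
    fix x :: "real^'m" assume "supported J x"
    then have "(axis k 1 - (x + f)) \<bullet> (D *v (axis k 1 - (x + f))) = residual + x \<bullet> (D *v x)"
      unfolding residual_def using complete_square[OF pos_def_sym[OF D] f _ k regression] by blast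
    moreover have "exp (- (r + q) / (2 * \<theta>)) = exp (- (r / 2) / \<theta>) * exp (- q / (2 * \<theta>))" for r q
      using \<open>0 < \<theta>\<close> by (simp add: exp_add[symmetric] field_simps)
    ultimately show "h (x + f) * ennreal (schur_kernel k a D (x + f) \<theta>) =
        h (x + f) * ennreal (?c * exp (- (x \<bullet> (D *v x)) / (2 * \<theta>)))"
      using \<open>0 < \<theta>\<close> by (simp only: schur_kernel_def if_True mult.assoc)
  qed measurable
  also have "\<dots> = ennreal (\<bar>sqrt \<theta>\<bar> ^ card J) * (\<integral>\<^sup>+ y. h (sqrt \<theta> *\<^sub>R y + f) *
      ennreal (?c * exp (- ((sqrt \<theta> *\<^sub>R y) \<bullet> (D *v (sqrt \<theta> *\<^sub>R y))) / (2 * \<theta>))) \<partial>vec_lborel J)"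
    by (rule nn_integral_coord_scale) (use \<open>0 < \<theta>\<close> in auto)
  also have "(\<integral>\<^sup>+ y. h (sqrt \<theta> *\<^sub>R y + f) *
      ennreal (?c * exp (- ((sqrt \<theta> *\<^sub>R y) \<bullet> (D *v (sqrt \<theta> *\<^sub>R y))) / (2 * \<theta>))) \<partial>vec_lborel J) =
    (\<integral>\<^sup>+ y. ennreal ?c * (h (f + sqrt \<theta> *\<^sub>R y) * ennreal (exp (- (y \<bullet> (D *v y)) / 2))) \<partial>vec_lborel J)"
  proof (rule nn_integral_cong)
    fix y :: "real^'m"
    have "(sqrt \<theta> *\<^sub>R y) \<bullet> (D *v (sqrt \<theta> *\<^sub>R y)) = \<theta> * (y \<bullet> (D *v y))"
      using \<open>0 < \<theta>\<close> by (simp add: matrix_vector_mult_scaleR mult.assoc[symmetric])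
    then have "- ((sqrt \<theta> *\<^sub>R y) \<bullet> (D *v (sqrt \<theta> *\<^sub>R y))) / (2 * \<theta>) = - (y \<bullet> (D *v y)) / 2"
      using \<open>0 < \<theta>\<close> by simp
    then show "h (sqrt \<theta> *\<^sub>R y + f) *
      ennreal (?c * exp (- ((sqrt \<theta> *\<^sub>R y) \<bullet> (D *v (sqrt \<theta> *\<^sub>R y))) / (2 * \<theta>))) =
      ennreal ?c * (h (f + sqrt \<theta> *\<^sub>R y) * ennreal (exp (- (y \<bullet> (D *v y)) / 2)))"
      by (simp only: ennreal_mult' powr_ge_zero exp_ge_zero mult_nonneg_nonneg) (simp add: mult_ac add.commute)
  qed
  also have "\<dots> = ennreal ?c * (\<integral>\<^sup>+ y. h (f + sqrt \<theta> *\<^sub>R y) * ennreal (exp (- (y \<bullet> (D *v y)) / 2)) \<partial>vec_lborel J)"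
    by (rule nn_integral_cmult) measurable
  also have "ennreal (\<bar>sqrt \<theta>\<bar> ^ card J) * \<dots> = ennreal (\<bar>sqrt \<theta>\<bar> ^ card J * ?c) *
     (\<integral>\<^sup>+ y. h (f + sqrt \<theta> *\<^sub>R y) * ennreal (exp (- (y \<bullet> (D *v y)) / 2)) \<partial>vec_lborel J)"
    by (simp add: ennreal_mult[symmetric] mult.assoc[symmetric])
  also have "\<bar>sqrt \<theta>\<bar> ^ card J * ?c = \<theta> powr (- (a - card J / 2)) * exp (- (residual / 2) / \<theta>)"
  proof -
    have "\<bar>sqrt \<theta>\<bar> ^ card J = \<theta> powr (card J / 2)"
      using \<open>0 < \<theta>\<close> by (simp add: powr_half_sqrt[symmetric] powr_power)
    then have "\<bar>sqrt \<theta>\<bar> ^ card J * \<theta> powr (- a) = \<theta> powr (- (a - card J / 2))"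
      by (simp add: powr_add[symmetric])
    then show ?thesis
      by (simp add: mult.assoc[symmetric])
  qed
  finally show ?thesis .
qed

lemma gaussian_mass_restrict:
  "gaussian_mass = (\<integral>\<^sup>+ y. ennreal (exp (- (y \<bullet> (restrict_id J D *v y)) / 2)) \<partial>vec_lborel J)"
  unfolding gaussian_mass_def by (rule nn_integral_vec_cong) (auto simp: restrict_id_quad)

lemma trace_ratio_nonneg: "pos_def C \<Longrightarrow> 0 \<le> trace_ratio C"
  unfolding trace_ratio_def
  by (rule gaussian_quadratic_moment_cov(2)) (auto intro: pos_def_restrict_id D pos_def_nonneg)

text \<open>The cross term between \<open>f\<close> and \<open>y\<close> is odd in \<open>y\<close>,
  so symmetrisation leaves the form at \<open>f\<close> and the second moment.\<close>

lemma gaussian_shifted_moment: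
  assumes "pos_def C" "0 < \<theta>"
  shows "(\<integral>\<^sup>+ y. ennreal (\<theta> + (f + sqrt \<theta> *\<^sub>R y) \<bullet> (C *v (f + sqrt \<theta> *\<^sub>R y))) *
      ennreal (exp (- (y \<bullet> (D *v y)) / 2)) \<partial>vec_lborel J) =
    ennreal (f \<bullet> (C *v f) + \<theta> * (1 + trace_ratio C)) * gaussian_mass"
proof -
  let ?E = "\<lambda>y. exp (- (y \<bullet> (D *v y)) / 2)"
  let ?q = "\<lambda>y. \<theta> + (f + sqrt \<theta> *\<^sub>R y) \<bullet> (C *v (f + sqrt \<theta> *\<^sub>R y))"
  note nonneg = pos_def_nonneg[OF assms(1)]
  have "(\<integral>\<^sup>+ y. ennreal (?q y) * ennreal (?E y) \<partial>vec_lborel J) =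
     (\<integral>\<^sup>+ y. ennreal (\<theta> + f \<bullet> (C *v f)) * ennreal (?E y) + ennreal \<theta> * ennreal (y \<bullet> (C *v y) * ?E y) \<partial>vec_lborel J)"
  proof (rule nn_integral_vec_symmetrize)
    fix y :: "real^'m"
    have q: "0 \<le> ?q y" for y
      using nonneg assms(2) by (intro add_nonneg_nonneg) auto
    have E: "?E (- y) = ?E y"
      by (simp add: linear_neg[OF matrix_vector_mul_linear])
    have "ennreal (?q y) * ennreal (?E y) + ennreal (?q (- y)) * ennreal (?E (- y)) =
       ennreal ((?q y + ?q (- y)) * ?E y)"
      unfolding E distrib_right[symmetric] ennreal_plus[OF q[of y] q[of "- y"], symmetric]
      by (rule ennreal_mult''[symmetric]) simp
    also have "?q y + ?q (- y) = 2 * (\<theta> + f \<bullet> (C *v f) + \<theta> * (y \<bullet> (C *v y)))"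
      using assms(2) by (simp add: algebra_simps)
    also have "ennreal (2 * (\<theta> + f \<bullet> (C *v f) + \<theta> * (y \<bullet> (C *v y))) * ?E y) =
       2 * (ennreal (\<theta> + f \<bullet> (C *v f)) * ennreal (?E y) + ennreal \<theta> * ennreal (y \<bullet> (C *v y) * ?E y))"
      using nonneg assms(2)
      by (simp add: ennreal_mult[symmetric] ennreal_plus[symmetric] ennreal_numeral[symmetric] algebra_simps
          del: ennreal_numeral ennreal_plus)
    finally show "ennreal (?q y) * ennreal (?E y) + ennreal (?q (- y)) * ennreal (?E (- y)) =
       2 * (ennreal (\<theta> + f \<bullet> (C *v f)) * ennreal (?E y) + ennreal \<theta> * ennreal (y \<bullet> (C *v y) * ?E y))" .
  qed measurable
  also have "\<dots> = ennreal (\<theta> + f \<bullet> (C *v f)) * gaussian_mass +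
      ennreal \<theta> * (\<integral>\<^sup>+ y. ennreal (y \<bullet> (C *v y) * ?E y) \<partial>vec_lborel J)"
    unfolding gaussian_mass_def
    by (subst nn_integral_add, measurable, subst nn_integral_cmult, measurable, subst nn_integral_cmult, measurable)
  also have "(\<integral>\<^sup>+ y. ennreal (y \<bullet> (C *v y) * ?E y) \<partial>vec_lborel J) =
     (\<integral>\<^sup>+ y. ennreal (y \<bullet> (C *v y) * exp (- (y \<bullet> (restrict_id J D *v y)) / 2)) \<partial>vec_lborel J)"
    by (rule nn_integral_vec_cong) (auto simp: restrict_id_quad)
  also have "\<dots> = ennreal (trace_ratio C) * gaussian_mass"
    unfolding trace_ratio_def gaussian_mass_restrict
    by (rule gaussian_quadratic_moment_cov(1)) (auto intro: pos_def_restrict_id D nonneg)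
  also have "ennreal (\<theta> + f \<bullet> (C *v f)) * gaussian_mass + ennreal \<theta> * (ennreal (trace_ratio C) * gaussian_mass) =
     ennreal (f \<bullet> (C *v f) + \<theta> * (1 + trace_ratio C)) * gaussian_mass"
  proof -
    have "ennreal (f \<bullet> (C *v f) + \<theta> * (1 + trace_ratio C)) =
        ennreal (\<theta> + f \<bullet> (C *v f)) + ennreal \<theta> * ennreal (trace_ratio C)"
      using nonneg[of f] trace_ratio_nonneg[OF assms(1)] assms(2)
      by (simp add: ennreal_mult[symmetric] ennreal_plus[symmetric] algebra_simps del: ennreal_plus)
    then show ?thesis
      by (simp only: distrib_right mult.assoc)
  qed
  finally show ?thesis .
qed

lemma schur_kernel_mass:
  "(\<integral>\<^sup>+ \<gamma>. \<integral>\<^sup>+ \<theta>. ennreal (schur_kernel k a D \<gamma> \<theta>) \<partial>lborel \<partial>vec_lborel J) =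
    inv_gamma_integral (a - card J / 2) (residual / 2) * gaussian_mass"
proof -
  have "(\<integral>\<^sup>+ \<gamma>. \<integral>\<^sup>+ \<theta>. ennreal (schur_kernel k a D \<gamma> \<theta>) \<partial>lborel \<partial>vec_lborel J) =
     (\<integral>\<^sup>+ \<theta>. \<integral>\<^sup>+ \<gamma>. ennreal (schur_kernel k a D \<gamma> \<theta>) \<partial>vec_lborel J \<partial>lborel)"
    by (rule nn_integral_coord_swap) auto
  also have "\<dots> = (\<integral>\<^sup>+ \<theta>. ennreal (if 0 < \<theta> then \<theta> powr (- (a - card J / 2)) * exp (- (residual / 2) / \<theta>) else 0)
      * gaussian_mass \<partial>lborel)"
  proof (rule nn_integral_cong)
    fix \<theta> :: real
    show "(\<integral>\<^sup>+ \<gamma>. ennreal (schur_kernel k a D \<gamma> \<theta>) \<partial>vec_lborel J) =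
      ennreal (if 0 < \<theta> then \<theta> powr (- (a - card J / 2)) * exp (- (residual / 2) / \<theta>) else 0) * gaussian_mass"
    proof (cases "0 < \<theta>")
      case True
      then show ?thesis
        using nn_integral_schur_kernel[of "\<lambda>_. 1" \<theta>] by (simp add: gaussian_mass_def)
    next
      case False
      then show ?thesis
        by (simp add: schur_kernel_def)
    qed
  qed
  also have "\<dots> = inv_gamma_integral (a - card J / 2) (residual / 2) * gaussian_mass"
    unfolding inv_gamma_integral_def by (rule nn_integral_multc) measurable
  finally show ?thesis .
qed

text \<open>With \<open>s = a - card J / 2\<close>, a weight \<open>\<theta>\<close> lowers
  \<open>s\<close> by one, and the recursion gives the factor \<open>residual / 2 / (s - 2)\<close>.
  Relating the mean to the same mass integral avoids any claim that this mass is finite.\<close>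

lemma schur_kernel_mean:
  assumes "pos_def C" and s: "2 < a - card J / 2"
  shows "(\<integral>\<^sup>+ \<gamma>. \<integral>\<^sup>+ \<theta>. ennreal (\<theta> + \<gamma> \<bullet> (C *v \<gamma>)) * ennreal (schur_kernel k a D \<gamma> \<theta>) \<partial>lborel \<partial>vec_lborel J) =
    ennreal (f \<bullet> (C *v f) + residual / (2 * a - card J - 4) * (1 + trace_ratio C)) *
    (\<integral>\<^sup>+ \<gamma>. \<integral>\<^sup>+ \<theta>. ennreal (schur_kernel k a D \<gamma> \<theta>) \<partial>lborel \<partial>vec_lborel J)"
proof -
  let ?s = "a - card J / 2"
  let ?I = "\<lambda>s. inv_gamma_integral s (residual / 2)"
  let ?\<phi> = "\<lambda>s \<theta>. ennreal (if 0 < \<theta> then \<theta> powr (- s) * exp (- (residual / 2) / \<theta>) else 0)"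
  have nn: "0 \<le> f \<bullet> (C *v f)" "0 \<le> trace_ratio C"
    using assms pos_def_nonneg trace_ratio_nonneg by auto
  have "(\<integral>\<^sup>+ \<gamma>. \<integral>\<^sup>+ \<theta>. ennreal (\<theta> + \<gamma> \<bullet> (C *v \<gamma>)) * ennreal (schur_kernel k a D \<gamma> \<theta>) \<partial>lborel \<partial>vec_lborel J) =
     (\<integral>\<^sup>+ \<theta>. \<integral>\<^sup>+ \<gamma>. ennreal (\<theta> + \<gamma> \<bullet> (C *v \<gamma>)) * ennreal (schur_kernel k a D \<gamma> \<theta>) \<partial>vec_lborel J \<partial>lborel)"
    by (rule nn_integral_coord_swap) auto
  also have "\<dots> = (\<integral>\<^sup>+ \<theta>. (ennreal (f \<bullet> (C *v f)) * ?\<phi> ?s \<theta> + ennreal (1 + trace_ratio C) * ?\<phi> (?s - 1) \<theta>)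
      * gaussian_mass \<partial>lborel)"
  proof (rule nn_integral_cong)
    fix \<theta> :: real
    show "(\<integral>\<^sup>+ \<gamma>. ennreal (\<theta> + \<gamma> \<bullet> (C *v \<gamma>)) * ennreal (schur_kernel k a D \<gamma> \<theta>) \<partial>vec_lborel J) =
      (ennreal (f \<bullet> (C *v f)) * ?\<phi> ?s \<theta> + ennreal (1 + trace_ratio C) * ?\<phi> (?s - 1) \<theta>) * gaussian_mass"
    proof (cases "0 < \<theta>")
      case True
      have p: "\<theta> powr (- (?s - 1)) = \<theta> * \<theta> powr (- ?s)"
        using True by (simp add: powr_mult_base algebra_simps)
      have "(\<integral>\<^sup>+ \<gamma>. ennreal (\<theta> + \<gamma> \<bullet> (C *v \<gamma>)) * ennreal (schur_kernel k a D \<gamma> \<theta>) \<partial>vec_lborel J) =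
         ?\<phi> ?s \<theta> * (ennreal (f \<bullet> (C *v f) + \<theta> * (1 + trace_ratio C)) * gaussian_mass)"
        using nn_integral_schur_kernel[OF _ True, of "\<lambda>\<gamma>. ennreal (\<theta> + \<gamma> \<bullet> (C *v \<gamma>))"]
          gaussian_shifted_moment[OF assms(1) True] True by simp
      also have "\<dots> = (ennreal (f \<bullet> (C *v f)) * ?\<phi> ?s \<theta> + ennreal (1 + trace_ratio C) * ?\<phi> (?s - 1) \<theta>) * gaussian_mass"
      proof -
        have "ennreal (f \<bullet> (C *v f) + \<theta> * (1 + trace_ratio C)) =
            ennreal (f \<bullet> (C *v f)) + ennreal \<theta> * ennreal (1 + trace_ratio C)"
          using True nn by (intro ennreal_plus_mult) auto
        moreover have "?\<phi> (?s - 1) \<theta> = ennreal \<theta> * ?\<phi> ?s \<theta>"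
          unfolding p using True by (simp only: if_True ennreal_mult' less_imp_le mult.assoc)
        ultimately show ?thesis
          by (simp only: distrib_right distrib_left mult_ac)
      qed
      finally show ?thesis .
    next
      case False
      then show ?thesis
        by (simp add: schur_kernel_def)
    qed
  qed
  also have "\<dots> = (ennreal (f \<bullet> (C *v f)) * ?I ?s + ennreal (1 + trace_ratio C) * ?I (?s - 1)) * gaussian_mass"
    unfolding inv_gamma_integral_def
    by (subst nn_integral_multc, measurable, subst nn_integral_add, measurable,
        subst nn_integral_cmult, measurable, subst nn_integral_cmult, measurable)
  also have "?I (?s - 1) = ennreal (residual / 2 / (?s - 2)) * ?I ?s"
    by (rule inv_gamma_integral_rec) (use residual_pos s in auto)
  also have "residual / 2 / (?s - 2) = residual / (2 * a - card J - 4)"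
    by (simp add: algebra_simps)
  also have "(ennreal (f \<bullet> (C *v f)) * ?I ?s + ennreal (1 + trace_ratio C) * (ennreal (residual / (2 * a - card J - 4)) * ?I ?s)) * gaussian_mass =
     ennreal (f \<bullet> (C *v f) + residual / (2 * a - card J - 4) * (1 + trace_ratio C)) * (?I ?s * gaussian_mass)"
  proof -
    have "0 \<le> residual / (2 * a - card J - 4)"
      using residual_pos s by (intro divide_nonneg_nonneg) auto
    then have e: "ennreal (f \<bullet> (C *v f) + residual / (2 * a - card J - 4) * (1 + trace_ratio C)) =
        ennreal (f \<bullet> (C *v f)) + ennreal (residual / (2 * a - card J - 4)) * ennreal (1 + trace_ratio C)"
      using nn by (intro ennreal_plus_mult) auto
    show ?thesis
      unfolding e by (simp only: distrib_right distrib_left mult_ac)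
  qed
  finally show ?thesis
    unfolding schur_kernel_mass .
qed

end

section \<open>Conditional means of the inverse Wishart law\<close>

lemma schur_border_diag: "supported J \<gamma> \<Longrightarrow> block_on J C \<Longrightarrow> k \<notin> J \<Longrightarrow>
    schur_border k C \<gamma> \<theta> $ k $ k = \<theta> + \<gamma> \<bullet> (C *v \<gamma>)"
  using supported_mult[of J C \<gamma>]
  by (simp add: schur_border_def border_def axis_one_nth supported_def block_on_def)

lemma restrict_id_restrict_id: "J \<subseteq> K \<Longrightarrow> restrict_id J (restrict_id K X) = restrict_id J X"
  by (auto simp: restrict_id_def vec_eq_iff)

text \<open>Testing against an arbitrary function \<open>G\<close> of the block is the weak form of
  a conditional expectation. Rows outside \<open>insert k J\<close> are integrated out first, then
  row \<open>k\<close> is averaged, and finally everything is reassembled with the entry replaced by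
  its mean.\<close>

lemma wishart_conditional_mean:
  fixes D :: "real^'m^'m" and d :: real
  assumes D: "pos_def D" and k: "k \<notin> J" and f: "supported J f"
    and regression: "\<And>j. j \<in> J \<Longrightarrow> (D *v f) $ j = D $ j $ k"
    and d: "0 < d + card J - 2"
    and [measurable]: "G \<in> borel_measurable borel"
  defines "a \<equiv> (d + 2 * real CARD('m)) / 2"
  defines "v \<equiv> (axis k 1 - f) \<bullet> (D *v (axis k 1 - f))"
  defines "r \<equiv> \<lambda>C. f \<bullet> (C *v f) + v / (d + card J - 2) * (1 + trace (restrict_zero J C ** matrix_inv (restrict_id J D)))"
  shows "(\<integral>\<^sup>+ X. G (restrict_id J X) * ennreal (X $ k $ k) * ennreal (wishart_kernel UNIV a D X) \<partial>sym_lborel) =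
    (\<integral>\<^sup>+ X. G (restrict_id J X) * ennreal (r (restrict_id J X)) * ennreal (wishart_kernel UNIV a D X) \<partial>sym_lborel)"
proof -
  let ?K = "insert k J" and ?R = "- insert k J"
  define b where "b = a - card ?R"
  have [measurable]: "r \<in> borel_measurable borel"
    unfolding r_def restrict_zero_def by measurable
  \<comment> \<open>Both integrands depend only on the block on \<open>insert k J\<close>, so one
    \<open>c\<close> serves both.\<close>
  obtain c where c: "\<And>H. H \<in> borel_measurable borel \<Longrightarrow>
    (\<integral>\<^sup>+ X. H (restrict_id ?K X) * ennreal (wishart_kernel UNIV a D X) \<partial>sym_lborel) =
    c * (\<integral>\<^sup>+ C. H C * ennreal (wishart_kernel ?K b D C) \<partial>sym_lborel_on ?K)"
    using wishart_kernel_marginal[of ?K ?R a D] unfolding b_def sym_lborel_eq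
    by (auto simp: Compl_partition)
  have "card ?R = CARD('m) - card ?K"
    by (simp add: Compl_eq_Diff_UNIV card_Diff_subset)
  moreover have "card ?K \<le> CARD('m)"
    by (rule card_mono) auto
  ultimately have "real (card ?R) = real CARD('m) - (card J + 1)"
    using k by (simp add: of_nat_diff)
  \<comment> \<open>Each of the \<open>CARD('m) - card J - 1\<close> rows outside
    \<open>insert k J\<close> lowers the exponent \<open>d / 2 + CARD('m)\<close> by one.\<close>
  then have b: "b = d / 2 + card J + 1"
    by (simp add: b_def a_def field_simps)
  have s: "2 < b - card J / 2" "2 * b - card J - 4 = d + card J - 2"
    using d by (simp_all add: b field_simps)
  have "(\<integral>\<^sup>+ X. G (restrict_id J X) * ennreal (X $ k $ k) * ennreal (wishart_kernel UNIV a D X) \<partial>sym_lborel) =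
     c * (\<integral>\<^sup>+ C. G (restrict_id J C) * ennreal (C $ k $ k) * ennreal (wishart_kernel ?K b D C) \<partial>sym_lborel_on ?K)"
    using c[of "\<lambda>C. G (restrict_id J C) * ennreal (C $ k $ k)"]
    by (simp add: restrict_id_restrict_id subset_insertI) (simp add: restrict_id_def)
  also have "(\<integral>\<^sup>+ C. G (restrict_id J C) * ennreal (C $ k $ k) * ennreal (wishart_kernel ?K b D C) \<partial>sym_lborel_on ?K) =
     (\<integral>\<^sup>+ C. ennreal (wishart_kernel J (b - 1) D C) * (\<integral>\<^sup>+ \<gamma>. \<integral>\<^sup>+ \<theta>. G (restrict_id J (schur_border k C \<gamma> \<theta>)) *
        ennreal (schur_border k C \<gamma> \<theta> $ k $ k) * ennreal (schur_kernel k b D \<gamma> \<theta>) \<partial>lborel \<partial>vec_lborel J) \<partial>sym_lborel_on J)"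
    by (rule nn_integral_wishart_kernel_insert[OF k]) measurable
  also have "\<dots> = (\<integral>\<^sup>+ C. ennreal (wishart_kernel J (b - 1) D C) * (\<integral>\<^sup>+ \<gamma>. \<integral>\<^sup>+ \<theta>. G (restrict_id J (schur_border k C \<gamma> \<theta>)) *
        ennreal (r (restrict_id J (schur_border k C \<gamma> \<theta>))) * ennreal (schur_kernel k b D \<gamma> \<theta>) \<partial>lborel \<partial>vec_lborel J) \<partial>sym_lborel_on J)"
  proof (rule nn_integral_sym_cong)
    fix C :: "real^'m^'m" assume C: "block_on J C" "transpose C = C"
    show "ennreal (wishart_kernel J (b - 1) D C) * (\<integral>\<^sup>+ \<gamma>. \<integral>\<^sup>+ \<theta>. G (restrict_id J (schur_border k C \<gamma> \<theta>)) *
        ennreal (schur_border k C \<gamma> \<theta> $ k $ k) * ennreal (schur_kernel k b D \<gamma> \<theta>) \<partial>lborel \<partial>vec_lborel J) =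
      ennreal (wishart_kernel J (b - 1) D C) * (\<integral>\<^sup>+ \<gamma>. \<integral>\<^sup>+ \<theta>. G (restrict_id J (schur_border k C \<gamma> \<theta>)) *
        ennreal (r (restrict_id J (schur_border k C \<gamma> \<theta>))) * ennreal (schur_kernel k b D \<gamma> \<theta>) \<partial>lborel \<partial>vec_lborel J)"
    proof (cases "pos_def C")
      case False
      then show ?thesis by (simp add: wishart_kernel_def)
    next
      case True
      have rC: "restrict_id J (schur_border k C \<gamma> \<theta>) = C" for \<gamma> \<theta>
        by (simp add: restrict_id_schur_border[OF k] restrict_id_block[OF C(1)])
      have "(\<integral>\<^sup>+ \<gamma>. \<integral>\<^sup>+ \<theta>. G C * ennreal (schur_border k C \<gamma> \<theta> $ k $ k) * ennreal (schur_kernel k b D \<gamma> \<theta>) \<partial>lborel \<partial>vec_lborel J) =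
         (\<integral>\<^sup>+ \<gamma>. \<integral>\<^sup>+ \<theta>. G C * (ennreal (\<theta> + \<gamma> \<bullet> (C *v \<gamma>)) * ennreal (schur_kernel k b D \<gamma> \<theta>)) \<partial>lborel \<partial>vec_lborel J)"
        by (rule nn_integral_vec_cong) (auto simp: schur_border_diag[OF _ C(1) k] mult.assoc)
      also have "\<dots> = G C * (\<integral>\<^sup>+ \<gamma>. \<integral>\<^sup>+ \<theta>. ennreal (\<theta> + \<gamma> \<bullet> (C *v \<gamma>)) * ennreal (schur_kernel k b D \<gamma> \<theta>) \<partial>lborel \<partial>vec_lborel J)"
        by (simp add: nn_integral_cmult)
      also have "\<dots> = G C * (ennreal (r C) * (\<integral>\<^sup>+ \<gamma>. \<integral>\<^sup>+ \<theta>. ennreal (schur_kernel k b D \<gamma> \<theta>) \<partial>lborel \<partial>vec_lborel J))"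
        using schur_kernel_mean[OF D k f regression True s(1)]
        by (simp add: r_def v_def residual_def[OF D k f regression] trace_ratio_def[OF D k f regression] s(2))
      also have "\<dots> = (\<integral>\<^sup>+ \<gamma>. \<integral>\<^sup>+ \<theta>. G C * ennreal (r C) * ennreal (schur_kernel k b D \<gamma> \<theta>) \<partial>lborel \<partial>vec_lborel J)"
        by (simp add: nn_integral_cmult mult.assoc)
      finally show ?thesis
        by (simp add: rC)
    qed
  qed measurable
  also have "\<dots> = (\<integral>\<^sup>+ C. G (restrict_id J C) * ennreal (r (restrict_id J C)) * ennreal (wishart_kernel ?K b D C) \<partial>sym_lborel_on ?K)"
    by (rule nn_integral_wishart_kernel_insert[OF k, symmetric]) measurable
  also have "c * \<dots> = (\<integral>\<^sup>+ X. G (restrict_id J X) * ennreal (r (restrict_id J X)) * ennreal (wishart_kernel UNIV a D X) \<partial>sym_lborel)"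
    using c[of "\<lambda>C. G (restrict_id J C) * ennreal (r (restrict_id J C))"]
    by (simp add: restrict_id_restrict_id subset_insertI)
  finally show ?thesis .
qed

text \<open>Take the modified row \<open>k\<close> as the bordering row. The congruence then fixes
  \<open>C\<close>, shifts \<open>u\<close> by a column of \<open>C\<close>, and shifts
  \<open>b\<close> by a number that depends on \<open>C\<close> and \<open>u\<close> only;
  translation invariance does the rest.\<close>

lemma nn_integral_sym_transvection:
  fixes h :: "real^'m^'m \<Rightarrow> ennreal"
  assumes "l \<noteq> k" and [measurable]: "h \<in> borel_measurable borel"
  defines "P \<equiv> mat 1 + outer (axis k 1) (axis l 1)"
  shows "(\<integral>\<^sup>+ X. h (P ** X ** transpose P) \<partial>sym_lborel) = (\<integral>\<^sup>+ X. h X \<partial>sym_lborel)"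
proof -
  let ?J = "- {k}" and ?e = "axis k 1 :: real^'m" and ?l = "axis l 1 :: real^'m"
  have U: "insert k ?J = UNIV" and k: "k \<notin> ?J"
    by auto
  have e: "?e \<bullet> ?e = 1" "?l \<bullet> ?e = 0" "?e \<bullet> ?l = 0"
    using assms(1) by (auto simp: inner_axis_axis)
  have tP: "transpose P = mat 1 + outer ?l ?e"
    by (simp add: P_def transpose_add transpose_outer)
  have border: "P ** border k C u b ** transpose P = border k C (u + C *v ?l) (b + (?l \<bullet> u + ?l \<bullet> u + ?l \<bullet> (C *v ?l)))"
    if C: "block_on ?J C" "transpose C = C" for C u b
  proof -
    have Ce: "C *v ?e = ?e"
      using block_on_axis(1)[OF C(1) k] .
    have "supported ?J ?l"
      using assms(1) by (simp add: supported_def axis_one_nth)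
    then have "?e \<bullet> (C *v ?l) = 0"
      using supported_axis_inner[OF supported_mult[OF C(1)] k] by blast
    then have *: "?e \<bullet> (C *v ?l) = 0" "(C *v ?l) \<bullet> ?e = 0"
      by (simp_all add: inner_commute)
    have "border k C u b ** transpose P = border k C u b + outer (border k C u b *v ?l) ?e"
      by (simp add: tP matrix_add_ldistrib matrix_mul_outer)
    also have "border k C u b *v ?l = C *v ?l + (?l \<bullet> u) *\<^sub>R ?e"
      by (simp add: border_def matrix_vector_mult_add_rdistrib outer_vec e scaleR_matrix_vector_assoc[symmetric] inner_commute)
    finally have 1: "border k C u b ** transpose P = border k C u b + outer (C *v ?l + (?l \<bullet> u) *\<^sub>R ?e) ?e" .
    have tB: "transpose (border k C u b) *v ?l = C *v ?l + (?l \<bullet> u) *\<^sub>R ?e"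
      using C(2)
      by (simp add: border_def transpose_add transpose_outer transpose_scalar matrix_vector_mult_add_rdistrib outer_vec e
          scaleR_matrix_vector_assoc[symmetric] inner_commute)
    have "P ** border k C u b ** transpose P = P ** (border k C u b + outer (C *v ?l + (?l \<bullet> u) *\<^sub>R ?e) ?e)"
      by (simp only: matrix_mul_assoc[symmetric] 1)
    also have "\<dots> = border k C u b + outer (C *v ?l + (?l \<bullet> u) *\<^sub>R ?e) ?e
       + outer ?e (C *v ?l + (?l \<bullet> u) *\<^sub>R ?e) + (?l \<bullet> (C *v ?l)) *\<^sub>R outer ?e ?e"
      by (simp add: P_def matrix_add_ldistrib matrix_add_rdistrib outer_matrix_mul tB transpose_outer outer_vec
          matrix_vector_mult_add_rdistrib transpose_add e inner_add_right outer_scale_right outer_add_right inner_commute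
          scaleR_matrix_vector_assoc[symmetric])
    also have "\<dots> = border k C (u + C *v ?l) (b + (?l \<bullet> u + ?l \<bullet> u + ?l \<bullet> (C *v ?l)))"
      by (simp add: border_def vec_eq_iff algebra_simps)
    finally show ?thesis .
  qed
  have "(\<integral>\<^sup>+ X. h (P ** X ** transpose P) \<partial>sym_lborel) = (\<integral>\<^sup>+ C. \<integral>\<^sup>+ u. \<integral>\<^sup>+ b. h (P ** border k C u b ** transpose P)
      \<partial>lborel \<partial>vec_lborel ?J \<partial>sym_lborel_on ?J)"
    unfolding sym_lborel_eq using nn_integral_sym_insert[OF k, of "\<lambda>X. h (P ** X ** transpose P)"] by (simp add: U)
  also have "\<dots> = (\<integral>\<^sup>+ C. \<integral>\<^sup>+ u. \<integral>\<^sup>+ b. h (border k C u b) \<partial>lborel \<partial>vec_lborel ?J \<partial>sym_lborel_on ?J)"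
  proof (rule nn_integral_sym_cong)
    fix C :: "real^'m^'m" assume C: "block_on ?J C" "transpose C = C"
    have "C *v ?l \<in> span ((\<lambda>j. axis j 1) ` ?J)"
      unfolding span_axis_iff
      using assms(1) by (intro supported_mult[OF C(1)]) (simp add: supported_def axis_one_nth)
    then have tr: "(\<integral>\<^sup>+ u. \<integral>\<^sup>+ b. h (border k C (u + C *v ?l) b) \<partial>lborel \<partial>vec_lborel ?J) =
        (\<integral>\<^sup>+ u. \<integral>\<^sup>+ b. h (border k C u b) \<partial>lborel \<partial>vec_lborel ?J)"
      by (intro nn_integral_coord_translate) auto
    have "(\<integral>\<^sup>+ b. h (border k C (u + C *v ?l) (b + x)) \<partial>lborel) = (\<integral>\<^sup>+ b. h (border k C (u + C *v ?l) b) \<partial>lborel)" for u x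
      by (rule nn_integral_lborel_translate) measurable
    then show "(\<integral>\<^sup>+ u. \<integral>\<^sup>+ b. h (P ** border k C u b ** transpose P) \<partial>lborel \<partial>vec_lborel ?J) =
       (\<integral>\<^sup>+ u. \<integral>\<^sup>+ b. h (border k C u b) \<partial>lborel \<partial>vec_lborel ?J)"
      by (simp only: border[OF C] tr)
  qed measurable
  also have "\<dots> = (\<integral>\<^sup>+ X. h X \<partial>sym_lborel)"
    unfolding sym_lborel_eq using nn_integral_sym_insert[OF k, of h] by (simp add: U)
  finally show ?thesis .
qed

text \<open>Transforming scale and argument together cancels \<open>P\<close> inside the trace, and
  \<open>det P = 1\<close> keeps the determinant.\<close>

lemma wishart_kernel_congruence:
  fixes P D X :: "real^'m^'m"
  assumes "det P = 1"
  shows "wishart_kernel UNIV a (P ** D ** transpose P) (P ** X ** transpose P) = wishart_kernel UNIV a D X"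
proof -
  have inv: "invertible P" "invertible (transpose P)"
    using assms by (simp_all add: invertible_det_nz det_transpose)
  have pd: "pos_def (P ** X ** transpose P) \<longleftrightarrow> pos_def X"
    using pos_def_congruence[OF inv(2), of X] by simp
  have r: "restrict_zero UNIV D = D" for D :: "real^'m^'m"
    by (simp add: restrict_zero_def vec_eq_iff)
  have "trace (matrix_inv (P ** X ** transpose P) ** (P ** D ** transpose P)) = trace (matrix_inv X ** D)" if "pos_def X"
  proof -
    let ?Q = "matrix_inv (transpose P)"
    have X: "invertible X"
      using that by (rule pos_def_invertible)
    have "matrix_inv (P ** X ** transpose P) = ?Q ** (matrix_inv X ** matrix_inv P)"
      using inv X by (simp add: matrix_inv_mult invertible_mult)
    then have "trace (matrix_inv (P ** X ** transpose P) ** (P ** D ** transpose P)) =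
        trace (?Q ** (matrix_inv X ** (matrix_inv P ** P) ** D ** transpose P))"
      by (simp only: matrix_mul_assoc)
    also have "\<dots> = trace ((matrix_inv X ** (matrix_inv P ** P) ** D ** transpose P) ** ?Q)"
      by (rule trace_mul_sym)
    also have "\<dots> = trace (matrix_inv X ** (matrix_inv P ** P) ** D ** (transpose P ** ?Q))"
      by (simp only: matrix_mul_assoc)
    finally show ?thesis
      using inv by (simp add: matrix_inv_left matrix_inv_right)
  qed
  then show ?thesis
    using assms by (simp add: wishart_kernel_def pd r det_mul det_transpose)
qed

section \<open>Two diagonal blocks\<close>

definition emb :: "real^'q \<Rightarrow> real^'q \<Rightarrow> real^('q + 'q)" where
  "emb x y = (\<chi> s. case s of Inl i \<Rightarrow> x $ i | Inr i \<Rightarrow> y $ i)"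

lemma emb_nth [simp]: "emb x y $ Inl i = x $ i" "emb x y $ Inr i = y $ i"
  by (simp_all add: emb_def)

lemma block_matrix_nth [simp]:
  "block_matrix A B C D $ Inl i $ Inl j = A $ i $ j"
  "block_matrix A B C D $ Inl i $ Inr j = B $ i $ j"
  "block_matrix A B C D $ Inr i $ Inl j = C $ i $ j"
  "block_matrix A B C D $ Inr i $ Inr j = D $ i $ j"
  by (simp_all add: block_matrix_def)

lemma vec_sum_eq_iff: "v = w \<longleftrightarrow> (\<forall>i. v $ Inl i = w $ Inl i) \<and> (\<forall>i. v $ Inr i = w $ Inr i)"
  for v w :: "'a^('m::finite + 'n::finite)"
  by (metis sum.exhaust vec_eq_iff)

lemma emb_cases:
  fixes z :: "real^('q::finite + 'q)"
  obtains x y where "z = emb x y"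
proof
  show "z = emb (\<chi> i. z $ Inl i) (\<chi> i. z $ Inr i)"
    by (simp add: vec_sum_eq_iff)
qed

lemma axis_Inl: "axis (Inl i) 1 = emb (axis i 1) 0"
  and axis_Inr: "axis (Inr i) 1 = emb 0 (axis i 1)"
  by (simp_all add: vec_sum_eq_iff axis_one_nth)

lemma emb_add: "emb x y + emb x' y' = emb (x + x') (y + y')"
  and emb_diff: "emb x y - emb x' y' = emb (x - x') (y - y')"
  and emb_eq_0: "emb x y = 0 \<longleftrightarrow> x = 0 \<and> y = 0"
  by (simp_all add: vec_sum_eq_iff vec_eq_iff)

lemma sum_UNIV_sum: "(\<Sum>s\<in>UNIV. g s) = (\<Sum>i\<in>UNIV. g (Inl i)) + (\<Sum>i\<in>UNIV. g (Inr i))"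
  for g :: "'m::finite + 'n::finite \<Rightarrow> 'a::comm_monoid_add"
  by (simp add: UNIV_Plus_UNIV[symmetric] sum.Plus del: UNIV_Plus_UNIV)

lemma inner_emb: "emb x y \<bullet> emb x' y' = x \<bullet> x' + y \<bullet> y'"
  by (simp add: inner_vec_def sum_UNIV_sum)

lemma block_matrix_emb: "block_matrix A B C D *v emb x y = emb (A *v x + B *v y) (C *v x + D *v y)"
  by (simp add: vec_sum_eq_iff matrix_vector_mult_def sum_UNIV_sum)

lemma block_matrix_mult: "block_matrix A B C D ** block_matrix A' B' C' D' =
    block_matrix (A ** A' + B ** C') (A ** B' + B ** D') (C ** A' + D ** C') (C ** B' + D ** D')"
  by (simp add: vec_sum_eq_iff matrix_matrix_mult_def sum_UNIV_sum)

lemma trace_block_matrix: "trace (block_matrix A B C D) = trace A + trace D"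
  by (simp add: trace_def sum_UNIV_sum)

lemma block_matrix_one: "block_matrix (mat 1) 0 0 (mat 1) = mat 1"
  by (simp add: vec_sum_eq_iff mat_def)

context
  fixes n :: real and S F V :: "real^'q^'q" and D :: "real^('q + 'q)^('q + 'q)"
  assumes n: "0 < n" and S: "pos_def S" and V: "V = S - F ** S ** transpose F" and V_pos: "pos_def V"
    and D: "D = n *\<^sub>R block_matrix S (S ** transpose F) (F ** S) S"
begin

lemma scale_quad: "emb x y \<bullet> (D *v emb x' y') =
    n * (x \<bullet> (S *v x') + x \<bullet> (S *v (transpose F *v y')) + y \<bullet> (F *v (S *v x')) + y \<bullet> (S *v y'))"
  by (simp add: D scaleR_matrix_vector_assoc[symmetric] block_matrix_emb inner_emb inner_add_right
      matrix_vector_mul_assoc)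

text \<open>Completing the square in \<open>x\<close> exhibits \<open>V\<close> as the Schur
  complement of \<open>S\<close>. The square vanishes at \<open>x = - (transpose F *v y)\<close>,
  which is where the regression vector below comes from.\<close>

lemma scale_quad_eq: "emb x y \<bullet> (D *v emb x y) =
    n * ((x + transpose F *v y) \<bullet> (S *v (x + transpose F *v y)) + y \<bullet> (V *v y))"
proof -
  have "(transpose F *v y) \<bullet> (S *v (transpose F *v y)) = y \<bullet> (F ** S ** transpose F *v y)"
    by (simp add: dot_matrix_transpose matrix_vector_mul_assoc matrix_mul_assoc)
  moreover have "(transpose F *v y) \<bullet> (S *v x) = y \<bullet> (F *v (S *v x))"
    by (simp add: dot_matrix_transpose)
  moreover have "x \<bullet> (S *v (transpose F *v y)) = (S *v x) \<bullet> (transpose F *v y)"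
    using dot_matrix_transpose[of S x] pos_def_sym[OF S] by simp
  ultimately show ?thesis
    unfolding scale_quad by (simp add: V algebra_simps)
qed

lemma pos_def_scale: "pos_def D"
  unfolding pos_def_def
proof (intro conjI allI impI)
  have "S $ i $ j = S $ j $ i" for i j
    using arg_cong[OF pos_def_sym[OF S], of "\<lambda>A. A $ i $ j"] by (simp add: transpose_def)
  moreover have SF: "transpose (S ** transpose F) = F ** S"
    using pos_def_sym[OF S] by (simp add: matrix_transpose_mul)
  have "(S ** transpose F) $ j $ i = (F ** S) $ i $ j" for i j
    using arg_cong[OF SF, of "\<lambda>A. A $ i $ j"] by (simp add: transpose_def)
  ultimately show "transpose D = D"
    by (simp add: D transpose_scalar vec_sum_eq_iff transpose_def)
  fix z :: "real^('q + 'q)" assume "z \<noteq> 0"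
  obtain x y where z: "z = emb x y"
    using emb_cases by blast
  show "0 < z \<bullet> (D *v z)"
  proof (cases "y = 0")
    case True
    then have "x \<noteq> 0"
      using \<open>z \<noteq> 0\<close> by (simp add: z emb_eq_0)
    then show ?thesis
      using n pos_def_pos[OF S] True by (simp add: z scale_quad_eq)
  next
    case False
    then show ?thesis
      using n pos_def_pos[OF V_pos False] pos_def_nonneg[OF S]
      unfolding z scale_quad_eq by (intro mult_pos_pos add_nonneg_pos) auto
  qed
qed

text \<open>Conjugation by \<open>P\<close> fixes the first diagonal block and turns the quadratic form of the second
  block at \<open>w\<close> into a diagonal entry.\<close>

lemma wishart_block_mean:
  fixes w :: "real^'q" and G :: "real^'q^'q \<Rightarrow> ennreal"
  assumes P: "det P = 1" "transpose P *v axis (Inr i) 1 = emb 0 w" "\<And>x. transpose P *v emb x 0 = emb x 0"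
    and inv: "\<And>h. h \<in> borel_measurable borel \<Longrightarrow>
      (\<integral>\<^sup>+ X. h (P ** X ** transpose P) \<partial>sym_lborel) = (\<integral>\<^sup>+ X. h X \<partial>sym_lborel)"
    and [measurable]: "G \<in> borel_measurable borel"
  defines "\<rho> \<equiv> \<lambda>A. (transpose F *v w) \<bullet> (A *v (transpose F *v w)) +
      n * (w \<bullet> (V *v w)) / (n + CARD('q)) * (1 + trace (A ** matrix_inv (n *\<^sub>R S)))"
  shows "(\<integral>\<^sup>+ X. G (fst (diag_blocks X)) * ennreal (w \<bullet> (snd (diag_blocks X) *v w)) * ennreal (iw_kernel (n + 2) D X) \<partial>sym_lborel) =
    (\<integral>\<^sup>+ X. G (fst (diag_blocks X)) * ennreal (\<rho> (fst (diag_blocks X))) * ennreal (iw_kernel (n + 2) D X) \<partial>sym_lborel)"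
proof -
  let ?J = "range Inl :: ('q + 'q) set" and ?k = "Inr i :: 'q + 'q"
  let ?D = "P ** D ** transpose P"
  let ?top = "\<lambda>Y :: real^('q + 'q)^('q + 'q). (\<chi> i j. Y $ Inl i $ Inl j) :: real^'q^'q"
  define a where "a = (n + 2 + 2 * real CARD('q + 'q)) / 2"
  define f where "f = emb (transpose F *v w) 0"
  have PXP: "x \<bullet> (P ** X ** transpose P *v y) = (transpose P *v x) \<bullet> (X *v (transpose P *v y))" for X x y
    by (simp add: dot_matrix_transpose matrix_vector_mul_assoc matrix_mul_assoc)
  have entry: "X $ s $ t = axis s 1 \<bullet> (X *v axis t 1)" for X :: "real^('q + 'q)^('q + 'q)" and s t
    by (simp add: inner_axis' matrix_axis_nth)
  have vec_entry: "y $ s = axis s 1 \<bullet> y" for y :: "real^('q + 'q)" and s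
    by (simp add: inner_axis')
  have Pinl: "transpose P *v axis (Inl j) 1 = axis (Inl j) 1" for j
    by (simp add: axis_Inl P(3))
  have top: "(P ** X ** transpose P) $ Inl s $ Inl t = X $ Inl s $ Inl t" for X s t
    by (subst (1 2) entry) (simp add: PXP Pinl)
  have invP: "invertible P"
    using P(1) by (simp add: invertible_det_nz)
  have pdD: "pos_def ?D"
    using pos_def_congruence[OF transpose_invertible[OF invP], of D] pos_def_scale by simp
  have k: "?k \<notin> ?J"
    by auto
  have f: "supported ?J f"
    unfolding supported_def
  proof (intro allI impI)
    fix s :: "'q + 'q" assume "s \<notin> range Inl"
    then show "f $ s = 0"
      by (cases s) (auto simp: f_def)
  qed
  \<comment> \<open>Normal equations: on the first block
    \<open>D *v emb (transpose F *v w) 0\<close> and \<open>D *v emb 0 w\<close> are both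
    \<open>n\<close> times \<open>S *v (transpose F *v w)\<close>.\<close>
  have reg: "(?D *v f) $ s = ?D $ s $ ?k" if "s \<in> ?J" for s
  proof -
    from that obtain j where s: "s = Inl j"
      by blast
    have "(?D *v f) $ s = axis (Inl j) 1 \<bullet> (D *v f)"
      unfolding s by (subst vec_entry) (simp add: PXP Pinl f_def P(3))
    moreover have "?D $ s $ ?k = axis (Inl j) 1 \<bullet> (D *v emb 0 w)"
      unfolding s by (subst entry) (simp add: PXP Pinl P(2))
    ultimately show ?thesis
      by (simp add: axis_Inl f_def scale_quad)
  qed
  \<comment> \<open>At the pulled back vector the square in \<open>scale_quad_eq\<close> vanishes
    and only the term with \<open>V\<close> survives.\<close>
  have v: "(axis ?k 1 - f) \<bullet> (?D *v (axis ?k 1 - f)) = n * (w \<bullet> (V *v w))"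
  proof -
    have "transpose P *v (axis ?k 1 - f) = emb (- (transpose F *v w)) w"
      by (simp add: matrix_vector_mult_diff_distrib P(2,3) f_def emb_diff)
    then show ?thesis
      unfolding PXP by (simp add: scale_quad_eq)
  qed
  have card: "card ?J = CARD('q)"
    by (simp add: card_image)
  \<comment> \<open>Here \<open>n + 2 + card ?J - 2\<close> becomes \<open>n + q\<close>.
    Conjugation fixes the first block of \<open>D\<close>, so the matrix inverted in the trace is
    \<open>n *\<^sub>R S\<close>.\<close>
  have r: "f \<bullet> (restrict_id ?J X *v f) + n * (w \<bullet> (V *v w)) / (n + 2 + card ?J - 2) *
      (1 + trace (restrict_zero ?J (restrict_id ?J X) ** matrix_inv (restrict_id ?J ?D))) = \<rho> (?top X)" for X
  proof -
    have D': "restrict_id ?J ?D = block_matrix (n *\<^sub>R S) 0 0 (mat 1)"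
      by (simp add: vec_sum_eq_iff restrict_id_def top mat_def image_iff) (simp add: D)
    have iS: "invertible (n *\<^sub>R S)"
      using pos_def_invertible[OF S] n by (simp add: scalar_invertible)
    have "block_matrix (n *\<^sub>R S) 0 0 (mat 1) ** block_matrix (matrix_inv (n *\<^sub>R S)) 0 0 (mat 1) = mat 1"
      by (simp add: block_matrix_mult matrix_inv_right[OF iS] block_matrix_one)
    then have D'': "matrix_inv (restrict_id ?J ?D) = block_matrix (matrix_inv (n *\<^sub>R S)) 0 0 (mat 1)"
      unfolding D' by (rule matrix_inv_eqI)
    have X': "restrict_zero ?J (restrict_id ?J X) = block_matrix (?top X) 0 0 0"
      by (simp add: vec_sum_eq_iff restrict_id_def restrict_zero_def image_iff)
    have X'': "restrict_id ?J X = block_matrix (?top X) 0 0 (mat 1)"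
      by (simp add: vec_sum_eq_iff restrict_id_def mat_def image_iff)
    have tr: "trace (restrict_zero ?J (restrict_id ?J X) ** matrix_inv (restrict_id ?J ?D)) =
        trace (?top X ** matrix_inv (n *\<^sub>R S))"
      unfolding D'' X' by (simp add: block_matrix_mult trace_block_matrix trace_0[unfolded mat_0])
    have q: "f \<bullet> (restrict_id ?J X *v f) = (transpose F *v w) \<bullet> (?top X *v (transpose F *v w))"
      unfolding X'' f_def by (simp add: block_matrix_emb inner_emb)
    show ?thesis
      unfolding tr q card by (simp add: \<rho>_def)
  qed
  \<comment> \<open>Every factor of the integrand is rewritten as a function of
    \<open>P ** X ** transpose P\<close>, so that \<open>inv\<close> can remove the
    conjugation.\<close>
  have iw: "iw_kernel (n + 2) D X = wishart_kernel UNIV a ?D (P ** X ** transpose P)" for X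
    by (simp add: wishart_kernel_congruence[OF P(1)] iw_kernel_eq a_def)
  have fst: "fst (diag_blocks X) = ?top (P ** X ** transpose P)" for X :: "real^('q + 'q)^('q + 'q)"
    by (simp add: diag_blocks_def top)
  have top_restrict: "?top (restrict_id ?J X) = ?top X" for X
    by (simp add: restrict_id_def vec_eq_iff)
  have snd: "w \<bullet> (snd (diag_blocks X) *v w) = (P ** X ** transpose P) $ ?k $ ?k" for X :: "real^('q + 'q)^('q + 'q)"
  proof -
    have "block_matrix (\<chi> i j. X $ Inl i $ Inl j) (\<chi> i j. X $ Inl i $ Inr j) (\<chi> i j. X $ Inr i $ Inl j)
        (snd (diag_blocks X)) = X"
      by (simp add: vec_sum_eq_iff diag_blocks_def)
    moreover have "emb 0 w \<bullet> (block_matrix a b c d *v emb 0 w) = w \<bullet> (d *v w)" for a b c d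
      by (simp add: block_matrix_emb inner_emb)
    ultimately have "emb 0 w \<bullet> (X *v emb 0 w) = w \<bullet> (snd (diag_blocks X) *v w)"
      by metis
    then show ?thesis
      by (subst entry) (simp add: PXP P(2))
  qed
  have [measurable]: "\<rho> \<in> borel_measurable borel"
    unfolding \<rho>_def by measurable
  have "(\<integral>\<^sup>+ X. G (fst (diag_blocks X)) * ennreal (w \<bullet> (snd (diag_blocks X) *v w)) * ennreal (iw_kernel (n + 2) D X) \<partial>sym_lborel) =
     (\<integral>\<^sup>+ X. G (?top X) * ennreal (X $ ?k $ ?k) * ennreal (wishart_kernel UNIV a ?D X) \<partial>sym_lborel)"
    unfolding iw fst snd by (rule inv) measurable
  also have "\<dots> = (\<integral>\<^sup>+ X. G (?top X) * ennreal (\<rho> (?top X)) * ennreal (wishart_kernel UNIV a ?D X) \<partial>sym_lborel)"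
    using wishart_conditional_mean[OF pdD k f reg, of "n + 2" "\<lambda>X. G (?top X)"] n
    unfolding v a_def[symmetric] r by (simp add: top_restrict)
  also have "\<dots> = (\<integral>\<^sup>+ X. G (fst (diag_blocks X)) * ennreal (\<rho> (fst (diag_blocks X))) * ennreal (iw_kernel (n + 2) D X) \<partial>sym_lborel)"
    unfolding iw fst by (rule inv[symmetric]) measurable
  finally show ?thesis .
qed

text \<open>The conditional mean over an empty block: the residual is the diagonal entry
  \<open>n * S $ i $ i\<close> of \<open>D\<close>, and the denominator \<open>d - 2 = n\<close>
  cancels the factor \<open>n\<close>.\<close>

lemma wishart_mean_diag:
  "(\<integral>\<^sup>+ X. ennreal (snd (diag_blocks X) $ i $ i) * ennreal (iw_kernel (n + 2) D X) \<partial>sym_lborel) =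
   (\<integral>\<^sup>+ X. ennreal (S $ i $ i) * ennreal (iw_kernel (n + 2) D X) \<partial>sym_lborel)"
proof -
  have "restrict_zero {} C = 0" for C :: "real^('q + 'q)^('q + 'q)"
    by (simp add: restrict_zero_def vec_eq_iff)
  moreover have "axis (Inr i) 1 \<bullet> (D *v axis (Inr i) 1) = n * S $ i $ i"
    by (simp add: inner_axis' matrix_axis_nth D)
  ultimately show ?thesis
    using wishart_conditional_mean[OF pos_def_scale, of "Inr i" "{}" 0 "n + 2" "\<lambda>_. 1"] n
    by (simp add: supported_def iw_kernel_eq diag_blocks_def trace_def)
qed

end

section \<open>From kernel integrals to the process\<close>

lemma borel_measurable_iw_kernel [measurable]: "iw_kernel d D \<in> borel_measurable borel"
  unfolding iw_kernel_eq by measurable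

text \<open>The normalising integral is a common divisor, so equal kernel integrals give equal
  expectations without knowing its value.\<close>

lemma nn_integral_inverse_wishart:
  assumes [measurable]: "h \<in> borel_measurable borel"
  shows "(\<integral>\<^sup>+ X. h X \<partial>inverse_wishart d D) =
    (\<integral>\<^sup>+ X. h X * ennreal (iw_kernel d D X) \<partial>sym_lborel) / (\<integral>\<^sup>+ Y. ennreal (iw_kernel d D Y) \<partial>sym_lborel)"
proof -
  have [measurable_cong]: "sets sym_lborel = sets borel"
    by (simp add: sym_lborel_def)
  show ?thesis
    unfolding inverse_wishart_def
    by (subst nn_integral_density)
      (auto simp: nn_integral_divide[symmetric] ennreal_times_divide mult.commute)
qed

lemma integrable_matrix:
  fixes Y :: "'w \<Rightarrow> real^'n^'m"
  assumes "\<And>i j. integrable M (\<lambda>\<omega>. Y \<omega> $ i $ j)"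
  shows "integrable M Y"
proof -
  have "Y \<omega> = (\<Sum>i\<in>UNIV. \<Sum>j\<in>UNIV. Y \<omega> $ i $ j *\<^sub>R axis i (axis j 1))" for \<omega>
  proof -
    have "(\<Sum>i\<in>UNIV. \<Sum>j\<in>UNIV. Y \<omega> $ i $ j * axis i (axis j 1) $ r $ s) = Y \<omega> $ r $ s" for r s
    proof -
      have "Y \<omega> $ i $ j * axis i (axis j 1) $ r $ s = (if s = j then (if r = i then Y \<omega> $ i $ j else 0) else 0)" for i j
        by (simp add: axis_def)
      then show ?thesis
        by simp
    qed
    then show ?thesis
      by (simp add: vec_eq_iff)
  qed
  then have "Y = (\<lambda>\<omega>. \<Sum>i\<in>UNIV. \<Sum>j\<in>UNIV. Y \<omega> $ i $ j *\<^sub>R axis i (axis j 1))"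
    by (rule ext)
  moreover have "integrable M (\<lambda>\<omega>. \<Sum>i\<in>UNIV. \<Sum>j\<in>UNIV. Y \<omega> $ i $ j *\<^sub>R axis i (axis j 1))"
    using assms by (intro Bochner_Integration.integrable_sum integrable_scaleR_left) auto
  ultimately show ?thesis
    by (rule ssubst[where P = "integrable M"])
qed

lemma quad_axis: "axis i 1 \<bullet> (A *v axis i 1) = A $ i $ i"
  for A :: "real^'n^'n"
  by (simp add: inner_axis' matrix_axis_nth)

lemma quad_axis_add:
  fixes A :: "real^'n^'n"
  assumes "transpose A = A"
  shows "(axis i 1 + axis j 1) \<bullet> (A *v (axis i 1 + axis j 1)) = A $ i $ i + 2 * A $ i $ j + A $ j $ j"
  using arg_cong[OF assms, of "\<lambda>B. B $ i $ j"]
  by (simp add: transpose_def inner_axis' matrix_axis_nth algebra_simps)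

text \<open>Testing the form at the sum and the difference of two axes bounds an off-diagonal entry,
  which reduces integrability to the diagonal.\<close>

lemma pos_def_entry_bound:
  assumes "pos_def A"
  shows "\<bar>A $ i $ j\<bar> \<le> A $ i $ i + A $ j $ j"
proof -
  have sym: "A $ j $ i = A $ i $ j"
    using arg_cong[OF pos_def_sym[OF assms], of "\<lambda>B. B $ i $ j"] by (simp add: transpose_def)
  have "0 \<le> (axis i 1 + axis j 1) \<bullet> (A *v (axis i 1 + axis j 1))"
    "0 \<le> (axis i 1 - axis j 1) \<bullet> (A *v (axis i 1 - axis j 1))"
    using assms by (rule pos_def_nonneg)+
  then have "0 \<le> A $ i $ i + 2 * A $ i $ j + A $ j $ j" "0 \<le> A $ i $ i - 2 * A $ i $ j + A $ j $ j"
    by (simp_all add: inner_axis' matrix_axis_nth algebra_simps sym)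
  moreover have "0 \<le> A $ i $ i" "0 \<le> A $ j $ j"
    using pos_def_diag_pos[OF assms] less_imp_le by auto
  ultimately show ?thesis
    by linarith
qed

theorem theorem3p3:
  fixes M :: "'w measure"
    and n :: real
    and S F V :: "real^'q^'q"
    and Sig :: "nat \<Rightarrow> 'w \<Rightarrow> real^'q^'q"
    and t :: nat
  assumes "n > 0"
    and "pos_def S"
    and "V = S - F ** S ** transpose F"
    and "pos_def V"
    and "iwar_process M n F S Sig"
    and "t \<ge> 1"
  shows "integrable M (Sig t) \<and>
    (AE \<omega> in M. matrix_cond_exp M (gen_algebra M (Sig (t - 1))) (Sig t) \<omega> =
       F ** Sig (t - 1) \<omega> ** transpose F
       + ((n / (n + real CARD('q))) * (1 + trace (Sig (t - 1) \<omega> ** matrix_inv (n *\<^sub>R S)))) *\<^sub>R V)"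
proof -
  define D where "D = n *\<^sub>R block_matrix S (S ** transpose F) (F ** S) S"
  define A where "A = Sig (t - 1)"
  define B where "B = Sig t"
  define W where "W = inverse_wishart (n + 2) D"
  define R where "R X = F ** X ** transpose F
    + ((n / (n + real CARD('q))) * (1 + trace (X ** matrix_inv (n *\<^sub>R S)))) *\<^sub>R V" for X
  interpret prob_space M
    using assms(5) by (simp add: iwar_process_def)
  have [measurable]: "A \<in> borel_measurable M" "B \<in> borel_measurable M"
    and pdA: "\<And>\<omega>. \<omega> \<in> space M \<Longrightarrow> pos_def (A \<omega>)" and pdB: "\<And>\<omega>. \<omega> \<in> space M \<Longrightarrow> pos_def (B \<omega>)"
    and law: "distr M (borel \<Otimes>\<^sub>M borel) (\<lambda>\<omega>. (A \<omega>, B \<omega>)) = distr W (borel \<Otimes>\<^sub>M borel) diag_blocks"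
    using assms(5,6) by (auto simp: iwar_process_def A_def B_def W_def D_def)
  have [measurable]: "R \<in> borel_measurable borel"
    unfolding R_def[abs_def] by measurable
  have [measurable_cong]: "sets W = sets borel"
    by (simp add: W_def inverse_wishart_def sym_lborel_def)
  have [measurable]: "diag_blocks \<in> borel \<rightarrow>\<^sub>M (borel :: (real^'q^'q) measure) \<Otimes>\<^sub>M borel"
    unfolding diag_blocks_def by measurable
  have transfer: "(\<integral>\<^sup>+ \<omega>. h (A \<omega>) (B \<omega>) \<partial>M) = (\<integral>\<^sup>+ X. h (fst (diag_blocks X)) (snd (diag_blocks X)) \<partial>W)"
    if [measurable]: "case_prod h \<in> borel_measurable (borel \<Otimes>\<^sub>M borel)" for h
  proof -
    have "(\<integral>\<^sup>+ \<omega>. h (A \<omega>) (B \<omega>) \<partial>M) = (\<integral>\<^sup>+ p. case_prod h p \<partial>distr M (borel \<Otimes>\<^sub>M borel) (\<lambda>\<omega>. (A \<omega>, B \<omega>)))"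
      by (subst nn_integral_distr) auto
    also have "\<dots> = (\<integral>\<^sup>+ X. h (fst (diag_blocks X)) (snd (diag_blocks X)) \<partial>W)"
      unfolding law by (subst nn_integral_distr) (auto simp: case_prod_beta)
    finally show ?thesis .
  qed
  note params = assms(1-4) D_def
  have quad_R: "w \<bullet> (R X *v w) = (transpose F *v w) \<bullet> (X *v (transpose F *v w)) +
      n * (w \<bullet> (V *v w)) / (n + CARD('q)) * (1 + trace (X ** matrix_inv (n *\<^sub>R S)))" for w X
    by (simp add: R_def matrix_vector_mult_add_rdistrib inner_add_right dot_matrix_transpose matrix_vector_mul_assoc
        matrix_mul_assoc scaleR_matrix_vector_assoc[symmetric])
  \<comment> \<open>The vectors reached by the identity and by one transvection inside the second
    block; they suffice for polarisation.\<close>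
  define good where "good = range (\<lambda>i. axis i 1 :: real^'q) \<union> {axis i 1 + axis j 1 |i j. i \<noteq> j}"
  have mean: "(\<integral>\<^sup>+ \<omega>. G (A \<omega>) * ennreal (w \<bullet> (B \<omega> *v w)) \<partial>M) = (\<integral>\<^sup>+ \<omega>. G (A \<omega>) * ennreal (w \<bullet> (R (A \<omega>) *v w)) \<partial>M)"
    if "w \<in> good" and [measurable]: "G \<in> borel_measurable borel" for G w
  proof -
    have *: "(\<integral>\<^sup>+ \<omega>. G (A \<omega>) * ennreal (w \<bullet> (B \<omega> *v w)) \<partial>M) = (\<integral>\<^sup>+ \<omega>. G (A \<omega>) * ennreal (w \<bullet> (R (A \<omega>) *v w)) \<partial>M)"
      if P: "det P = 1" "transpose P *v axis (Inr i) 1 = emb 0 w" "\<And>x. transpose P *v emb x 0 = emb x 0"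
       "\<And>h. h \<in> borel_measurable borel \<Longrightarrow>
         (\<integral>\<^sup>+ X. h (P ** X ** transpose P) \<partial>sym_lborel) = (\<integral>\<^sup>+ X. h X \<partial>sym_lborel)"
      for P :: "real^('q + 'q)^('q + 'q)" and i
      using transfer[of "\<lambda>X Y. G X * ennreal (w \<bullet> (Y *v w))"] transfer[of "\<lambda>X Y. G X * ennreal (w \<bullet> (R X *v w))"]
        wishart_block_mean[OF params P, of G]
      by (simp add: W_def nn_integral_inverse_wishart quad_R)
    from \<open>w \<in> good\<close> consider i where "w = axis i 1" | i j where "w = axis i 1 + axis j 1" "i \<noteq> j"
      by (auto simp: good_def)
    then show ?thesis
    proof cases
      case 1
      then show ?thesis
        by (intro *[of "mat 1" i]) (simp_all add: axis_Inr)
    next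
      case 2
      \<comment> \<open>Adds row \<open>Inr j\<close> to row \<open>Inr i\<close>, so the first
        block stays fixed and the entry at \<open>Inr i\<close> becomes the form at
        \<open>axis i 1 + axis j 1\<close>.\<close>
      let ?P = "mat 1 + outer (axis (Inr i) 1) (axis (Inr j) 1) :: real^('q + 'q)^('q + 'q)"
      show ?thesis
      proof (rule *[of ?P i])
        show "det ?P = 1"
          using 2 by (intro det_column_add) (simp add: axis_one_nth)
        show "transpose ?P *v axis (Inr i) 1 = emb 0 w"
          unfolding transpose_shear_vec by (simp add: inner_axis_axis) (simp add: axis_Inr emb_add 2)
        show "transpose ?P *v emb x 0 = emb x 0" for x
          unfolding transpose_shear_vec by (simp add: inner_axis')
        show "(\<integral>\<^sup>+ X. h (?P ** X ** transpose ?P) \<partial>sym_lborel) = (\<integral>\<^sup>+ X. h X \<partial>sym_lborel)"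
          if "h \<in> borel_measurable borel" for h
          using 2 that by (intro nn_integral_sym_transvection) auto
      qed
    qed
  qed
  have B_diag: "(\<integral>\<^sup>+ \<omega>. ennreal (B \<omega> $ i $ i) \<partial>M) = ennreal (S $ i $ i)" for i
  proof -
    \<comment> \<open>The constant \<open>S $ i $ i\<close> is also moved between the two laws; its
      integral is evaluated over \<open>M\<close>, which has mass one, so the normalising integral
      need not be known.\<close>
    have "(\<integral>\<^sup>+ \<omega>. ennreal (B \<omega> $ i $ i) \<partial>M) = (\<integral>\<^sup>+ \<omega>. ennreal (S $ i $ i) \<partial>M)"
      using transfer[of "\<lambda>X Y. ennreal (Y $ i $ i)"] transfer[of "\<lambda>X Y. ennreal (S $ i $ i)"]
        wishart_mean_diag[OF params, of i]
      unfolding W_def by (simp add: nn_integral_inverse_wishart del: nn_integral_const)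
    then show ?thesis
      by (simp add: emeasure_space_1)
  qed
  have int_diag: "integrable M (\<lambda>\<omega>. B \<omega> $ i $ i)" for i
    using pos_def_diag_pos[OF pdB]
    by (intro integrableI_nonneg) (auto simp: B_diag intro!: AE_I2 less_imp_le)
  have int_B: "integrable M (\<lambda>\<omega>. B \<omega> $ i $ j)" for i j
  proof (rule Bochner_Integration.integrable_bound)
    show "integrable M (\<lambda>\<omega>. B \<omega> $ i $ i + B \<omega> $ j $ j)"
      by (intro Bochner_Integration.integrable_add int_diag)
    show "AE \<omega> in M. norm (B \<omega> $ i $ j) \<le> norm (B \<omega> $ i $ i + B \<omega> $ j $ j)"
      using pos_def_entry_bound[OF pdB] by (intro AE_I2) (simp, meson abs_ge_self order_trans)
  qed measurable
  have int_quad_B: "integrable M (\<lambda>\<omega>. w \<bullet> (B \<omega> *v w))" for w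
    unfolding inner_vec_def matrix_vector_mult_def
    by (auto intro!: Bochner_Integration.integrable_sum integrable_mult_right integrable_mult_left int_B)
  have quad_B_nonneg: "0 \<le> w \<bullet> (B \<omega> *v w)" if "\<omega> \<in> space M" for w \<omega>
    using pdB[OF that] by (rule pos_def_nonneg)
  have quad_R_nonneg: "0 \<le> w \<bullet> (R (A \<omega>) *v w)" if "\<omega> \<in> space M" for w \<omega>
  proof -
    have nS: "pos_def (n *\<^sub>R S)"
      using assms(1,2) by (auto simp: pos_def_def transpose_scalar scaleR_matrix_vector_assoc[symmetric])
    have "restrict_zero UNIV X = X" for X :: "real^'q^'q"
      by (simp add: restrict_zero_def vec_eq_iff)
    then have "0 \<le> trace (A \<omega> ** matrix_inv (n *\<^sub>R S))"
      using gaussian_quadratic_moment_cov(2)[of UNIV "n *\<^sub>R S" "A \<omega>"] nS pos_def_nonneg[OF pdA[OF that]]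
      by (simp add: block_on_def)
    then show ?thesis
      unfolding quad_R using pos_def_nonneg[OF pdA[OF that]] pos_def_nonneg[OF assms(4)] assms(1)
      by (intro add_nonneg_nonneg mult_nonneg_nonneg divide_nonneg_nonneg) auto
  qed
  have int_quad_R: "integrable M (\<lambda>\<omega>. w \<bullet> (R (A \<omega>) *v w))" if "w \<in> good" for w
  proof (rule integrableI_nonneg)
    \<comment> \<open>Integrability of the candidate is inherited from \<open>B\<close>: by
      \<open>mean\<close> with \<open>G = 1\<close> the two integrals agree.\<close>
    have "(\<integral>\<^sup>+ \<omega>. ennreal (w \<bullet> (R (A \<omega>) *v w)) \<partial>M) = (\<integral>\<^sup>+ \<omega>. ennreal (w \<bullet> (B \<omega> *v w)) \<partial>M)"
      using mean[OF that, of "\<lambda>_. 1"] by simp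
    also have "\<dots> < \<infinity>"
      using int_quad_B[of w] quad_B_nonneg
      by (subst nn_integral_eq_integral) auto
    finally show "(\<integral>\<^sup>+ \<omega>. ennreal (w \<bullet> (R (A \<omega>) *v w)) \<partial>M) < \<infinity>" .
  qed (use quad_R_nonneg in auto)
  have set_mean: "(\<integral>\<omega>. indicator U (A \<omega>) * (w \<bullet> (B \<omega> *v w)) \<partial>M) = (\<integral>\<omega>. indicator U (A \<omega>) * (w \<bullet> (R (A \<omega>) *v w)) \<partial>M)"
    if "w \<in> good" and [measurable]: "U \<in> sets borel" for w U
  proof -
    \<comment> \<open>Nonnegativity of both forms lets the identity pass from \<open>ennreal\<close>
      to real integrals over the events generated by \<open>A\<close>.\<close>
    have "(\<integral>\<^sup>+ \<omega>. ennreal (indicator U (A \<omega>) * (w \<bullet> (B \<omega> *v w))) \<partial>M) =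
       (\<integral>\<^sup>+ \<omega>. ennreal (indicator U (A \<omega>) * (w \<bullet> (R (A \<omega>) *v w))) \<partial>M)"
      using mean[OF that(1), of "indicator U"] by (simp add: ennreal_mult' ennreal_indicator)
    then show ?thesis
      using quad_B_nonneg quad_R_nonneg
      by (subst (1 2) integral_eq_nn_integral) auto
  qed
  \<comment> \<open>The diagonal is treated apart because twice an axis vector need not belong to
    \<open>good\<close>.\<close>
  define polar where "polar \<phi> i j = (if i = j then \<phi> (axis i 1) else
    (\<phi> (axis i 1 + axis j 1) - \<phi> (axis i 1) - \<phi> (axis j 1)) / 2)"
    for \<phi> :: "real^'q \<Rightarrow> real" and i j
  have polar: "X $ i $ j = polar (\<lambda>w. w \<bullet> (X *v w)) i j" if "transpose X = X" for X i j
    by (simp add: polar_def quad_axis quad_axis_add[OF that])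
  have sym_R: "transpose (R X) = R X" if "transpose X = X" for X
    using pos_def_sym[OF assms(4)] that
    by (simp add: R_def transpose_add transpose_scalar matrix_transpose_mul matrix_mul_assoc)
  have axis_good: "axis i 1 \<in> good" "i \<noteq> j \<Longrightarrow> axis i 1 + axis j 1 \<in> good" for i j
    by (auto simp: good_def)
  have int_R: "integrable M (\<lambda>\<omega>. R (A \<omega>) $ i $ j)" for i j
  proof -
    have "integrable M (\<lambda>\<omega>. polar (\<lambda>w. w \<bullet> (R (A \<omega>) *v w)) i j)"
      unfolding polar_def using axis_good
      by (cases "i = j") (auto intro!: integrable_divide Bochner_Integration.integrable_diff int_quad_R)
    then show ?thesis
      by (rule Bochner_Integration.integrable_cong[THEN iffD1, rotated -1])
        (auto simp: polar[OF sym_R[OF pos_def_sym[OF pdA]]])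
  qed
  define N where "N = gen_algebra M A"
  have A_N: "A \<in> borel_measurable N"
    unfolding N_def gen_algebra_def by (rule measurable_vimage_algebra1) auto
  have sub: "subalgebra M N"
    unfolding subalgebra_def N_def gen_algebra_def
    by (auto simp: sets_vimage_algebra2 intro!: measurable_sets)
  interpret N: sigma_finite_subalgebra M N
    by (rule finite_measure_subalgebra_is_sigma_finite, unfold_locales) (rule sub)
  have cond: "AE \<omega> in M. real_cond_exp M N (\<lambda>\<omega>. B \<omega> $ i $ j) \<omega> = R (A \<omega>) $ i $ j" for i j
  proof (rule N.real_cond_exp_charact)
    fix E assume "E \<in> sets N"
    then obtain U where U: "U \<in> sets borel" "E = A -` U \<inter> space M"
      by (auto simp: N_def gen_algebra_def sets_vimage_algebra2)
    note [measurable] = U(1)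
    have ind: "indicator E \<omega> = (indicator U (A \<omega>) :: real)" if "\<omega> \<in> space M" for \<omega>
      using that by (simp add: U(2) indicator_def)
    have int_ind: "integrable M (\<lambda>\<omega>. indicator U (A \<omega>) * f \<omega>)" if "integrable M f" for f :: "'w \<Rightarrow> real"
      using that by (rule Bochner_Integration.integrable_bound) (use that in \<open>auto simp: indicator_def\<close>)
    have "(\<integral>\<omega>\<in>E. B \<omega> $ i $ j \<partial>M) = (\<integral>\<omega>. polar (\<lambda>w. indicator U (A \<omega>) * (w \<bullet> (B \<omega> *v w))) i j \<partial>M)"
      unfolding set_lebesgue_integral_def
      by (rule Bochner_Integration.integral_cong)
        (auto simp: ind polar[OF pos_def_sym[OF pdB]], simp add: polar_def algebra_simps)
    \<comment> \<open>\<open>polar\<close> is linear in its functional argument, so integration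
      passes through it.\<close>
    also have "\<dots> = polar (\<lambda>w. \<integral>\<omega>. indicator U (A \<omega>) * (w \<bullet> (B \<omega> *v w)) \<partial>M) i j"
      unfolding polar_def by (simp add: int_ind int_quad_B)
    also have "\<dots> = polar (\<lambda>w. \<integral>\<omega>. indicator U (A \<omega>) * (w \<bullet> (R (A \<omega>) *v w)) \<partial>M) i j"
      unfolding polar_def using axis_good by (simp add: set_mean)
    also have "\<dots> = (\<integral>\<omega>. polar (\<lambda>w. indicator U (A \<omega>) * (w \<bullet> (R (A \<omega>) *v w))) i j \<partial>M)"
      unfolding polar_def using axis_good by (simp add: int_ind int_quad_R)
    also have "\<dots> = (\<integral>\<omega>\<in>E. R (A \<omega>) $ i $ j \<partial>M)"
      unfolding set_lebesgue_integral_def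
      by (rule Bochner_Integration.integral_cong)
        (auto simp: ind polar[OF sym_R[OF pos_def_sym[OF pdA]]], simp add: polar_def algebra_simps)
    finally show "(\<integral>\<omega>\<in>E. B \<omega> $ i $ j \<partial>M) = (\<integral>\<omega>\<in>E. R (A \<omega>) $ i $ j \<partial>M)" .
  next
    have "(\<lambda>X. R X $ i $ j) \<in> borel_measurable borel"
      by measurable
    from measurable_compose[OF A_N this] show "(\<lambda>\<omega>. R (A \<omega>) $ i $ j) \<in> borel_measurable N" .
  qed (rule int_B int_R)+
  have "AE \<omega> in M. \<forall>i j. real_cond_exp M N (\<lambda>\<omega>. B \<omega> $ i $ j) \<omega> = R (A \<omega>) $ i $ j"
    by (intro eventually_all_finite cond)
  then have "AE \<omega> in M. matrix_cond_exp M N B \<omega> = R (A \<omega>)"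
    by (rule eventually_mono) (simp add: matrix_cond_exp_def vec_eq_iff)
  moreover have "integrable M B"
    by (rule integrable_matrix) (rule int_B)
  ultimately show ?thesis
    unfolding N_def R_def A_def B_def by simp
qed

end
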